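(* Let $m_{2,n}$ be the number of minimal deterministic finite automata over the binary alphabet $\{a,b\}$ with $n$ transient states (and a unique sink) that recognize a finite language. Then \[ 2^{n-1}c_n\le m_{2,n}\le 2^{n-1}r_n, \] where $c_n$ and $r_n$ are the numbers of compacted and relaxed binary trees of size $n$. As a consequence, there exist positive constants $\kappa_1,\kappa_2$ such that \[ \kappa_1 n^{3/4}\le \frac{m_{2,n}}{n!\,8^n e^{3a_1 n^{1/3}}}\le \kappa_2 n, \] where $a_1\approx -2.338$ is the largest root of the Airy function $\mathrm{Ai}$.
   Context: A deterministic finite automaton (DFA) is a tuple $(\Sigma,Q,\delta,q_0,F)$ with finite alphabet $\Sigma$, finite state set $Q$, total transition function $\delta:Q\times\Sigma\to Q$, initial state $q_0$ and set $F\subseteq Q$ of final states; it accepts a word if reading it from $q_0$ ends in $F$. A DFA is minimal if no DFA with fewer states recognizes the same language; minimal DFAs are counted up to isomorphism (equivalently, by the Myhill–Nerode theorem, $m_{2,n}$ is the number of finite languages over $\{a,b\}$ whose minimal DFA consists of a unique sink (a non-final state all of whose transitions return to itself) together with $n$ further states). A (rooted, plane) binary tree is either a leaf or an internal node with an ordered pair (left, right) of binary subtrees; its size is its number of internal nodes; postorder visits left subtree, right subtree, then root. A relaxed binary tree of size $n$ is obtained from a binary tree $T$ with $n$ internal nodes (its spine) by keeping the left-most leaf and turning every other leaf $\ell$ into a pointer to a vertex (internal node or the left-most leaf) preceding $\ell$ in postorder; it is a directed acyclic graph on the internal nodes and the left-most leaf, each internal node having a left and right out-edge (to its child if that child is internal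 or the left-most leaf, otherwise to the pointer's target). Two relaxed trees are equal iff they have the same spine and pointer targets. For a vertex $u$ define the binary tree $B(u)$: a single leaf if $u$ is the left-most leaf, otherwise the tree with left and right subtrees $B(v),B(w)$ where $v,w$ are the left and right out-neighbours of $u$. A compacted binary tree is a relaxed binary tree with $B(u)\not\cong B(v)$ for all distinct vertices $u,v$. $r_n$ and $c_n$ are the numbers of relaxed and of compacted binary trees of size $n$. $\mathrm{Ai}$ is the solution of $\mathrm{Ai}''=x\mathrm{Ai}$ decaying at $+\infty$. *)

theory Defs
  imports Complex_Main
begin

text \<open>The alphabet {a,b} is represented by bool (a = False, b = True).
A DFA is a tuple (k, delta, q0, F) whose state set is {..<k}.\<close>

type_synonym dfa = "nat \<times> (nat \<Rightarrow> bool \<Rightarrow> nat) \<times> nat \<times> nat set"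

definition dfa_states :: "dfa \<Rightarrow> nat" where
  "dfa_states D = fst D"

definition wf_dfa :: "dfa \<Rightarrow> bool" where
  "wf_dfa D = (case D of (k, \<delta>, q0, F) \<Rightarrow>
     q0 < k \<and> F \<subseteq> {..<k} \<and> (\<forall>q<k. \<forall>c. \<delta> q c < k))"

definition dfa_lang :: "dfa \<Rightarrow> bool list set" where
  "dfa_lang D = (case D of (k, \<delta>, q0, F) \<Rightarrow> {w. foldl \<delta> q0 w \<in> F})"

definition minimal_dfa :: "dfa \<Rightarrow> bool" where
  "minimal_dfa D = (wf_dfa D \<and>
     (\<forall>D'. wf_dfa D' \<and> dfa_lang D' = dfa_lang D \<longrightarrow> dfa_states D \<le> dfa_states D'))"

definition is_sink :: "dfa \<Rightarrow> nat \<Rightarrow> bool" where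
  "is_sink D q = (case D of (k, \<delta>, q0, F) \<Rightarrow>
     q < k \<and> q \<notin> F \<and> (\<forall>c. \<delta> q c = q))"

definition dfa_iso :: "dfa \<Rightarrow> dfa \<Rightarrow> bool" where
  "dfa_iso D D' = (case D of (k, \<delta>, q0, F) \<Rightarrow> case D' of (k', \<delta>', q0', F') \<Rightarrow>
     (\<exists>h. bij_betw h {..<k} {..<k'} \<and> h q0 = q0' \<and>
          (\<forall>q<k. (\<forall>c. h (\<delta> q c) = \<delta>' (h q) c) \<and> (q \<in> F \<longleftrightarrow> h q \<in> F'))))"

definition min_fin_dfas :: "nat \<Rightarrow> dfa set" where
  "min_fin_dfas n = {D. minimal_dfa D \<and> finite (dfa_lang D) \<and>
      card {q. is_sink D q} = 1 \<and> dfa_states D = n + 1}"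

definition m2 :: "nat \<Rightarrow> nat" where
  "m2 n = card (min_fin_dfas n // {(D, D'). D \<in> min_fin_dfas n \<and> D' \<in> min_fin_dfas n \<and> dfa_iso D D'})"

datatype bt = L | N bt bt

fun bt_size :: "bt \<Rightarrow> nat" where
  "bt_size L = 0"
| "bt_size (N l r) = bt_size l + bt_size r + 1"

text \<open>Postorder list of all vertices (leaves and internal nodes); True marks internal nodes.
Position 0 is always the left-most leaf.\<close>
fun po :: "bt \<Rightarrow> bool list" where
  "po L = [False]"
| "po (N l r) = po l @ po r @ [True]"

text \<open>For each postorder position (starting at offset off): None for a leaf,
Some (i, j) for an internal node whose left/right children are at positions i, j.\<close>
fun nodes :: "nat \<Rightarrow> bt \<Rightarrow> (nat \<times> nat) option list" where
  "nodes off L = [None]"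
| "nodes off (N l r) =
     nodes off l @ nodes (off + length (po l)) r
       @ [Some (off + length (po l) - 1, off + length (po l) + length (po r) - 1)]"

text \<open>Pointer assignment: ptr i is the target of the leaf at postorder position i
(for every leaf other than the left-most one); it must be a vertex (internal node or
position 0) preceding i. ptr is 0 at all other arguments (normalisation).\<close>
definition valid_ptr :: "bt \<Rightarrow> (nat \<Rightarrow> nat) \<Rightarrow> bool" where
  "valid_ptr T ptr = (\<forall>i.
     (if i < length (po T) \<and> 0 < i \<and> \<not> po T ! i
      then ptr i < i \<and> (ptr i = 0 \<or> po T ! ptr i)
      else ptr i = 0))"

definition relaxed_trees :: "nat \<Rightarrow> (bt \<times> (nat \<Rightarrow> nat)) set" where
  "relaxed_trees n = {(T, ptr). bt_size T = n \<and> valid_ptr T ptr}"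

definition r_num :: "nat \<Rightarrow> nat" where
  "r_num n = card (relaxed_trees n)"

definition tgt :: "bt \<Rightarrow> (nat \<Rightarrow> nat) \<Rightarrow> nat \<Rightarrow> nat" where
  "tgt T ptr c = (if c = 0 \<or> po T ! c then c else ptr c)"

text \<open>B(u) for all positions u, computed in postorder (entries at non-vertex leaf
positions are irrelevant placeholders).\<close>
definition bvals :: "bt \<Rightarrow> (nat \<Rightarrow> nat) \<Rightarrow> bt list" where
  "bvals T ptr = foldl (\<lambda>acc k. acc @ [case nodes 0 T ! k of
        None \<Rightarrow> L
      | Some (i, j) \<Rightarrow> N (acc ! tgt T ptr i) (acc ! tgt T ptr j)])
     [] [0..<length (po T)]"

definition is_vertex :: "bt \<Rightarrow> nat \<Rightarrow> bool" where
  "is_vertex T u = (u < length (po T) \<and> (u = 0 \<or> po T ! u))"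

definition compacted_trees :: "nat \<Rightarrow> (bt \<times> (nat \<Rightarrow> nat)) set" where
  "compacted_trees n = {(T, ptr). (T, ptr) \<in> relaxed_trees n \<and>
     (\<forall>u v. is_vertex T u \<and> is_vertex T v \<and> u \<noteq> v \<longrightarrow> bvals T ptr ! u \<noteq> bvals T ptr ! v)}"

definition c_num :: "nat \<Rightarrow> nat" where
  "c_num n = card (compacted_trees n)"

definition airy_sol :: "(real \<Rightarrow> real) \<Rightarrow> bool" where
  "airy_sol f = ((\<exists>f'. \<forall>x. (f has_real_derivative f' x) (at x) \<and>
                          (f' has_real_derivative x * f x) (at x))
               \<and> (f \<longlongrightarrow> 0) at_top \<and> (\<exists>x. f x \<noteq> 0))"

text \<open>Ai is (a nonzero multiple of) the decaying solution of y'' = x y; its zeros do not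
depend on the normalisation.\<close>
definition Ai :: "real \<Rightarrow> real" where
  "Ai = (SOME f. airy_sol f)"

definition airy_a1 :: real where
  "airy_a1 = (GREATEST x. Ai x = 0)"

end

theory Submission
  imports Defs "HOL-Analysis.Analysis" "HOL-Real_Asymp.Real_Asymp"
begin

text \<open>Reading a relaxed tree in postorder turns it into a tree whose leaves carry numbers: leaf labels
  refer to the internal nodes (or to the left-most leaf, \<open>0\<close>) already completed. A minimal automaton of
  a finite language, explored by depth-first search, is such a tree together with a set of accepting
  states that contains the first completed state (the only one all of whose transitions lead to the
  sink); this gives the factor \<open>2 ^ (n - 1)\<close>. Conversely every tree in which no two nodes have the same
  pair of children yields a minimal automaton, and these trees are exactly the compacted ones.

  For the asymptotics, stacks of \<open>M\<close> trees with \<open>K\<close> internal nodes satisfy a two-term recurrence in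
  \<open>(K, M)\<close>, up to a small negative term in the compacted case. Following Elvey Price, Fang and Wallner, an
  explicit function built from \<open>Ai (a1 + 2 powr (1/3) * M / n powr (1/3))\<close> with \<open>n = 2 * K + M - 1\<close> satisfies
  this recurrence up to an error that a slowly varying factor turns into a sign, so that it is a
  super- or subsolution; comparison gives the bounds.\<close>

text \<open>The rescaled recurrence reads \<open>u Y(n-1, M-1) + Y(n-1, M+1) = s Y(n, M)\<close>
  with \<open>u\<close> about \<open>1 - 2 M / n\<close>. Put \<open>h = n powr (-1/3)\<close> and
  \<open>x = M h\<close>. The second difference of \<open>F (a1 + c x)\<close> contributes
  \<open>c^2 h^2 F'' = c^2 h^2 (a1 + c x) F\<close>; for \<open>c^3 = 2\<close> its \<open>x\<close>
  part cancels the drift \<open>-2 x h^2 F\<close> and leaves a rate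
  \<open>s = 2 + c^2 a1 h^2 + sigma h^3\<close> that does not depend on \<open>M\<close>. The
  boundary value 0 at \<open>M = 0\<close> makes \<open>a1\<close> a root, and positivity makes it
  the largest one. The product of the rates is of order
  \<open>2^n exp (3/2 c^2 a1 n powr (1/3)) n powr (sigma/2)\<close>, and \<open>M = 1\<close>
  contributes a further \<open>h\<close>, because \<open>F\<close> vanishes linearly at
  \<open>a1\<close>. At \<open>n = 2 K\<close> the exponential part is
  \<open>4^K exp (3 a1 K powr (1/3))\<close>. The power of \<open>K\<close> is
  \<open>sigma/2 - 1/3\<close>: it is \<open>1\<close> for relaxed trees
  (\<open>sigma = 8/3\<close>) and \<open>3/4\<close> for compacted ones
  (\<open>sigma = 13/6\<close>), whose negative term lowers \<open>sigma\<close> by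
  \<open>1/2\<close>.\<close>

section \<open>Pointer trees and their recurrence\<close>

text \<open>The label \<open>j\<close> of a leaf refers to the \<open>j\<close>-th internal node in postorder, counted from \<open>1\<close>, or to the
  left-most leaf if \<open>j = 0\<close>. The argument \<open>k\<close> below is the number of the first internal node of a subtree.\<close>

datatype rt = Ptr nat | Node rt rt

fun num_nodes :: "rt \<Rightarrow> nat" where
  "num_nodes (Ptr j) = 0"
| "num_nodes (Node l r) = num_nodes l + num_nodes r + 1"

fun well_labelled :: "nat \<Rightarrow> rt \<Rightarrow> bool" where
  "well_labelled k (Ptr j) \<longleftrightarrow> j < k"
| "well_labelled k (Node l r) \<longleftrightarrow> well_labelled k l \<and> well_labelled (k + num_nodes l) r"

fun root_label :: "nat \<Rightarrow> rt \<Rightarrow> nat" where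
  "root_label k (Ptr j) = j"
| "root_label k (Node l r) = k + num_nodes l + num_nodes r"

text \<open>The recursion follows postorder, so that entry \<open>i\<close> belongs to the node
  numbered \<open>k + i\<close>. Two equal entries are the repetition that compaction
  forbids.\<close>

fun child_pairs :: "nat \<Rightarrow> rt \<Rightarrow> (nat \<times> nat) list" where
  "child_pairs k (Ptr j) = []"
| "child_pairs k (Node l r) = child_pairs k l @ child_pairs (k + num_nodes l) r @ [(root_label k l, root_label (k + num_nodes l) r)]"

lemma length_child_pairs [simp]: "length (child_pairs k t) = num_nodes t"
  by (induction k t rule: child_pairs.induct) auto

lemma root_label_less: "well_labelled k t \<Longrightarrow> root_label k t < k + num_nodes t"
  by (cases t) auto

lemma child_pairs_less:
  assumes "well_labelled k t" "i < num_nodes t"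
  shows "fst (child_pairs k t ! i) < k + i \<and> snd (child_pairs k t ! i) < k + i"
  using assms
proof (induction k t arbitrary: i rule: child_pairs.induct)
  case (2 k l r)
  consider "i < num_nodes l" | "num_nodes l \<le> i" "i < num_nodes l + num_nodes r" | "i = num_nodes l + num_nodes r"
    using "2.prems" by force
  then show ?case
  proof cases
    case 1
    then show ?thesis using 2 by (auto simp: nth_append)
  next
    case 2
    then have "fst (child_pairs (k + num_nodes l) r ! (i - num_nodes l)) < k + num_nodes l + (i - num_nodes l) \<and>
               snd (child_pairs (k + num_nodes l) r ! (i - num_nodes l)) < k + num_nodes l + (i - num_nodes l)"
      using "2.prems" "2.IH"(2)[of "i - num_nodes l"] by auto
    then show ?thesis using 2 by (auto simp: nth_append)
  next
    case 3
    then show ?thesis using "2.prems" root_label_less[of k l] root_label_less[of "k + num_nodes l" r]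
      by (auto simp: nth_append)
  qed
qed auto

text \<open>A list of trees is the stack of a postorder traversal, its head being the most recent tree.\<close>

fun total_nodes :: "rt list \<Rightarrow> nat" where
  "total_nodes [] = 0"
| "total_nodes (t # ts) = num_nodes t + total_nodes ts"

fun well_labelled_stack :: "rt list \<Rightarrow> bool" where
  "well_labelled_stack [] = True"
| "well_labelled_stack (t # ts) \<longleftrightarrow> well_labelled_stack ts \<and> well_labelled (1 + total_nodes ts) t"

fun stack_pairs :: "rt list \<Rightarrow> (nat \<times> nat) list" where
  "stack_pairs [] = []"
| "stack_pairs (t # ts) = stack_pairs ts @ child_pairs (1 + total_nodes ts) t"

lemma length_stack_pairs [simp]: "length (stack_pairs ts) = total_nodes ts"
  by (induction ts) auto

text \<open>Children precede their parent in postorder, so the number of the last node never occurs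
  as a label. The strict bound is what identifies the possible repetitions in
  \<open>e_num_Suc\<close>.\<close>

lemma stack_pairs_less: "well_labelled_stack ts \<Longrightarrow> (a, b) \<in> set (stack_pairs ts) \<Longrightarrow> a < total_nodes ts \<and> b < total_nodes ts"
proof (induction ts)
  case (Cons t ts)
  from Cons.prems(2) consider "(a, b) \<in> set (stack_pairs ts)" | "(a, b) \<in> set (child_pairs (1 + total_nodes ts) t)"
    by auto
  then show ?case
  proof cases
    case 1
    then show ?thesis using Cons by auto
  next
    case 2
    then obtain i where "i < num_nodes t" "child_pairs (1 + total_nodes ts) t ! i = (a, b)"
      by (metis in_set_conv_nth length_child_pairs)
    then show ?thesis using child_pairs_less[of "1 + total_nodes ts" t i] Cons.prems by auto
  qed
qed auto

definition stacks :: "nat \<Rightarrow> nat \<Rightarrow> rt list set" where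
  "stacks K M = {ts. length ts = M \<and> total_nodes ts = K \<and> well_labelled_stack ts}"

definition dstacks :: "nat \<Rightarrow> nat \<Rightarrow> rt list set" where
  "dstacks K M = {ts \<in> stacks K M. distinct (stack_pairs ts)}"

lemma stacks_0: "stacks K 0 = (if K = 0 then {[]} else {})"
  by (auto simp: stacks_def)

text \<open>The top tree is a pointer, with \<open>K + 1\<close> possible targets, or a node. In the
  second case, removing this last node in postorder leaves its two subtrees on the stack, the right
  one on top because it was completed later.\<close>

lemma stacks_Suc:
  "stacks K (Suc M) =
     (\<lambda>(j, ts). Ptr j # ts) ` ({..K} \<times> stacks K M) \<union>
     (if K = 0 then {} else (\<lambda>us. Node (us ! 1) (us ! 0) # drop 2 us) ` stacks (K - 1) (M + 2))"
proof (rule set_eqI, rule iffI)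
  fix us assume us: "us \<in> stacks K (Suc M)"
  then obtain t ts where tts: "us = t # ts" by (cases us) (auto simp: stacks_def)
  show "us \<in> (\<lambda>(j, ts). Ptr j # ts) ` ({..K} \<times> stacks K M) \<union>
     (if K = 0 then {} else (\<lambda>us. Node (us ! 1) (us ! 0) # drop 2 us) ` stacks (K - 1) (M + 2))"
  proof (cases t)
    case (Ptr j)
    then show ?thesis using us tts by (auto simp: stacks_def image_iff)
  next
    case (Node l r)
    then have "r # l # ts \<in> stacks (K - 1) (M + 2)" "K \<noteq> 0"
      using us tts by (auto simp: stacks_def add_ac)
    then show ?thesis using Node tts by (auto simp: image_iff intro!: bexI[of _ "r # l # ts"])
  qed
next
  fix us assume "us \<in> (\<lambda>(j, ts). Ptr j # ts) ` ({..K} \<times> stacks K M) \<union>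
     (if K = 0 then {} else (\<lambda>us. Node (us ! 1) (us ! 0) # drop 2 us) ` stacks (K - 1) (M + 2))"
  then show "us \<in> stacks K (Suc M)"
  proof
    assume "us \<in> (\<lambda>(j, ts). Ptr j # ts) ` ({..K} \<times> stacks K M)"
    then show ?thesis by (auto simp: stacks_def)
  next
    assume "us \<in> (if K = 0 then {} else (\<lambda>us. Node (us ! 1) (us ! 0) # drop 2 us) ` stacks (K - 1) (M + 2))"
    then obtain vs where vs: "vs \<in> stacks (K - 1) (M + 2)" "K \<noteq> 0"
      "us = Node (vs ! 1) (vs ! 0) # drop 2 vs" by (auto split: if_splits)
    then obtain r l ts where "vs = r # l # ts"
      by (auto simp: stacks_def length_Suc_conv numeral_2_eq_2)
    then show ?thesis using vs by (auto simp: stacks_def add_ac)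
  qed
qed

lemma stacks_split: "us \<in> stacks K (M + 2) \<Longrightarrow> \<exists>r l ts. us = r # l # ts"
  by (cases us; cases "tl us") (auto simp: stacks_def)

lemma inj_combine: "inj_on (\<lambda>us. Node (us ! 1) (us ! 0) # drop 2 us) (stacks K (M + 2))"
proof (rule inj_onI)
  fix us vs assume *: "us \<in> stacks K (M + 2)" "vs \<in> stacks K (M + 2)"
    "Node (us ! 1) (us ! 0) # drop 2 us = Node (vs ! 1) (vs ! 0) # drop 2 vs"
  then obtain r l ts r' l' ts' where "us = r # l # ts" "vs = r' # l' # ts'"
    using stacks_split by metis
  then show "us = vs" using * by auto
qed

lemma finite_stacks: "finite (stacks K M)"
\<comment> \<open>Each of the two cases of \<open>stacks_Suc\<close> lowers \<open>2 * K + M\<close>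
  by one. Up to a shift this is the time coordinate \<open>n\<close> of the analysis.\<close>
proof (induction "2 * K + M" arbitrary: K M rule: less_induct)
  case less
  show ?case
  proof (cases M)
    case 0
    then show ?thesis by (simp add: stacks_0)
  next
    case (Suc M')
    show ?thesis unfolding Suc stacks_Suc
      using less.hyps[of K M'] less.hyps[of "K - 1" "M' + 2"] Suc by auto
  qed
qed

definition w_num :: "nat \<Rightarrow> nat \<Rightarrow> nat" where "w_num K M = card (stacks K M)"
definition e_num :: "nat \<Rightarrow> nat \<Rightarrow> nat" where "e_num K M = card (dstacks K M)"

lemma w_num_0: "w_num K 0 = (if K = 0 then 1 else 0)"
  by (simp add: w_num_def stacks_0)

lemma w_num_Suc:
  "w_num K (Suc M) = (K + 1) * w_num K M + (if K = 0 then 0 else w_num (K - 1) (M + 2))"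
proof -
  have i: "inj_on (\<lambda>(j, ts). Ptr j # ts) ({..K} \<times> stacks K M)"
    by (auto simp: inj_on_def)
  show ?thesis
    unfolding w_num_def stacks_Suc
    using card_image[OF i] card_image[OF inj_combine, of "K - 1" M]
    by (subst card_Un_disjoint) (auto simp: finite_stacks card_cartesian_product)
qed

lemma finite_dstacks: "finite (dstacks K M)"
  by (simp add: dstacks_def finite_stacks)

lemma e_num_0: "e_num K 0 = (if K = 0 then 1 else 0)"
proof -
  have "dstacks K 0 = (if K = 0 then {[]} else {})" by (auto simp: dstacks_def stacks_0)
  then show ?thesis by (simp add: e_num_def)
qed

text \<open>Combining the two topmost trees of a stack creates a repeated pair of children only if
  both are pointers and their targets are one of the \<open>K - 1\<close> pairs already present.\<close>

lemma e_num_Suc: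
  assumes "K > 0"
  shows "(K + 1) * e_num K M + e_num (K - 1) (M + 2) \<le> e_num K (Suc M) + (K - 1) * e_num (K - 1) M"
proof -
  let ?f = "\<lambda>(j, ts). Ptr j # ts" and ?g = "\<lambda>us. Node (us ! 1) (us ! 0) # drop 2 us"
  define Bad where "Bad = (\<Union>ts \<in> dstacks (K - 1) M. (\<lambda>(a, b). Ptr b # Ptr a # ts) ` set (stack_pairs ts))"
  have card_Bad: "card Bad \<le> (K - 1) * e_num (K - 1) M" and fin_Bad: "finite Bad"
  proof -
    have "card Bad \<le> (\<Sum>ts \<in> dstacks (K - 1) M. card ((\<lambda>(a, b). Ptr b # Ptr a # ts) ` set (stack_pairs ts)))"
      unfolding Bad_def by (rule card_UN_le[OF finite_dstacks])
    also have "\<dots> \<le> (\<Sum>ts \<in> dstacks (K - 1) M. K - 1)"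
    proof (rule sum_mono)
      fix ts assume "ts \<in> dstacks (K - 1) M"
      then have "card (set (stack_pairs ts)) \<le> K - 1"
        using card_length[of "stack_pairs ts"] by (auto simp: dstacks_def stacks_def)
      then show "card ((\<lambda>(a, b). Ptr b # Ptr a # ts) ` set (stack_pairs ts)) \<le> K - 1"
        using card_image_le[of "set (stack_pairs ts)" "\<lambda>(a, b). Ptr b # Ptr a # ts"] by simp
    qed
    finally show "card Bad \<le> (K - 1) * e_num (K - 1) M" by (simp add: e_num_def mult.commute)
    show "finite Bad" unfolding Bad_def by (auto simp: finite_dstacks)
  qed
  have f: "?f ` ({..K} \<times> dstacks K M) \<subseteq> dstacks K (Suc M)"
    using assms by (auto simp: dstacks_def stacks_def)
  have g: "?g ` (dstacks (K - 1) (M + 2) - Bad) \<subseteq> dstacks K (Suc M)"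
  proof safe
    fix us assume us: "us \<in> dstacks (K - 1) (M + 2)" "us \<notin> Bad"
    then obtain r l ts where us': "us = r # l # ts"
      by (auto simp: dstacks_def stacks_def length_Suc_conv numeral_2_eq_2)
    let ?a = "root_label (1 + total_nodes ts) l" and ?b = "root_label (1 + total_nodes ts + num_nodes l) r"
    have *: "total_nodes ts + num_nodes l + num_nodes r = K - 1" "well_labelled_stack ts" "well_labelled (1 + total_nodes ts) l" "well_labelled (1 + total_nodes ts + num_nodes l) r"
      "distinct (stack_pairs us)" "length ts = M"
      using us us' by (auto simp: dstacks_def stacks_def add_ac)
    have new: "(?a, ?b) \<notin> set (stack_pairs us)"
    proof
      assume in_us: "(?a, ?b) \<in> set (stack_pairs us)"
      have lt: "?a < K - 1 \<and> ?b < K - 1"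
        using stack_pairs_less[OF _ in_us] us by (auto simp: dstacks_def stacks_def)
      \<comment> \<open>A node \<open>r\<close> would carry the number \<open>K - 1\<close>, against
        the strict bound. Once \<open>r\<close> is a pointer, the same argument applies to
        \<open>l\<close>.\<close>
      obtain b where r: "r = Ptr b"
        using lt *(1) by (cases r) auto
      obtain a where l: "l = Ptr a"
        using lt *(1) r by (cases l) auto
      have "ts \<in> dstacks (K - 1) M" using * us' r l by (auto simp: dstacks_def stacks_def)
      moreover have "(a, b) \<in> set (stack_pairs ts)" using in_us us' r l by auto
      ultimately have "us \<in> Bad" using us' r l unfolding Bad_def by force
      with us show False by simp
    qed
    have "stack_pairs (?g us) = stack_pairs us @ [(?a, ?b)]" using us' by (simp add: add_ac)
    then show "?g us \<in> dstacks K (Suc M)"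
      using new * assms us' by (auto simp: dstacks_def stacks_def add_ac)
  qed
  have i: "inj_on ?f ({..K} \<times> dstacks K M)" by (auto simp: inj_on_def)
  have i2: "inj_on ?g (dstacks (K - 1) (M + 2) - Bad)"
    by (rule inj_on_subset[OF inj_combine[of "K - 1" M]]) (auto simp: dstacks_def)
  have "(K + 1) * e_num K M + (e_num (K - 1) (M + 2) - card Bad)
      \<le> card ({..K} \<times> dstacks K M) + card (dstacks (K - 1) (M + 2) - Bad)"
    unfolding e_num_def using diff_card_le_card_Diff[OF fin_Bad]
    by (simp add: card_cartesian_product add_mono)
  also have "\<dots> = card (?f ` ({..K} \<times> dstacks K M)) + card (?g ` (dstacks (K - 1) (M + 2) - Bad))"
    using card_image[OF i] card_image[OF i2] by simp
  also have "\<dots> = card (?f ` ({..K} \<times> dstacks K M) \<union> ?g ` (dstacks (K - 1) (M + 2) - Bad))"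
    by (rule card_Un_disjoint[symmetric]) (auto simp: finite_dstacks)
  also have "\<dots> \<le> e_num K (Suc M)"
    unfolding e_num_def by (rule card_mono[OF finite_dstacks]) (use f g in auto)
  finally show ?thesis using card_Bad by linarith
qed

lemma e_num_Suc_0: "e_num 0 (Suc M) = e_num 0 M"
proof -
  have "dstacks 0 (Suc M) = (\<lambda>ts. Ptr 0 # ts) ` dstacks 0 M"
    by (auto simp: dstacks_def stacks_Suc)
  then show ?thesis unfolding e_num_def by (simp add: card_image inj_on_def)
qed

definition pointer_trees :: "nat \<Rightarrow> rt set" where "pointer_trees n = {t. num_nodes t = n \<and> well_labelled 1 t}"

lemma card_pointer_trees: "card (pointer_trees n) = w_num n 1"
proof -
  have "stacks n 1 = (\<lambda>t. [t]) ` pointer_trees n"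
    by (auto simp: stacks_def pointer_trees_def image_iff length_Suc_conv)
  then show ?thesis unfolding w_num_def by (simp add: card_image inj_on_def)
qed

lemma card_distinct_pointer_trees: "card {t \<in> pointer_trees n. distinct (child_pairs 1 t)} = e_num n 1"
proof -
  have "dstacks n 1 = (\<lambda>t. [t]) ` {t \<in> pointer_trees n. distinct (child_pairs 1 t)}"
    by (auto simp: dstacks_def stacks_def pointer_trees_def image_iff length_Suc_conv)
  then show ?thesis unfolding e_num_def by (simp add: card_image inj_on_def)
qed

lemma finite_pointer_trees: "finite (pointer_trees n)"
proof -
  have "(\<lambda>t. [t]) ` pointer_trees n \<subseteq> stacks n 1" by (auto simp: stacks_def pointer_trees_def)
  then have "finite ((\<lambda>t. [t]) ` pointer_trees n)" using finite_subset finite_stacks by blast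
  then show ?thesis by (simp add: finite_image_iff inj_on_def)
qed

section \<open>The Airy function\<close>

lemma deriv_mono:
  fixes f f' :: "real \<Rightarrow> real"
  assumes "a \<le> b" "\<And>x. a \<le> x \<Longrightarrow> x \<le> b \<Longrightarrow> (f has_real_derivative f' x) (at x)"
    "\<And>x. a \<le> x \<Longrightarrow> x \<le> b \<Longrightarrow> f' x \<ge> 0"
  shows "f a \<le> f b"
  using DERIV_nonneg_imp_nondecreasing[of a b f] assms by blast

lemma deriv_antimono:
  fixes f f' :: "real \<Rightarrow> real"
  assumes "a \<le> b" "\<And>x. a \<le> x \<Longrightarrow> x \<le> b \<Longrightarrow> (f has_real_derivative f' x) (at x)"
    "\<And>x. a \<le> x \<Longrightarrow> x \<le> b \<Longrightarrow> f' x \<le> 0"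
  shows "f b \<le> f a"
  using DERIV_nonpos_imp_nonincreasing[of a b f] assms by blast

text \<open>Taylor coefficients at 0 of the solution of \<open>y'' = x y\<close> with
  \<open>y 0 = p\<close> and \<open>y' 0 = q\<close>.\<close>

fun ac :: "real \<Rightarrow> real \<Rightarrow> nat \<Rightarrow> real" where
  "ac p q 0 = p"
| "ac p q (Suc 0) = q"
| "ac p q (Suc (Suc 0)) = 0"
| "ac p q (Suc (Suc (Suc k))) = ac p q k / ((real k + 2) * (real k + 3))"

text \<open>From \<open>k >= R ^ 3\<close> on, a step of three indices does not increase
  \<open>|ac p q k| R ^ k\<close>. These terms are therefore bounded for \<open>R > |x|\<close>,
  which gives convergence by Abel's lemma.\<close>

lemma summable_ac: "summable (\<lambda>n. ac p q n * x ^ n)"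
proof -
  define R where "R = \<bar>x\<bar> + 1"
  have R: "R > 0" "\<bar>x\<bar> < R" by (auto simp: R_def)
  obtain k0 :: nat where k0: "R ^ 3 \<le> real k0" using real_arch_simple by blast
  define B where "B = (\<Sum>i<k0+3. \<bar>ac p q i\<bar> * R ^ i)"
  have B0: "B \<ge> 0" unfolding B_def using R by (intro sum_nonneg) auto
  have bound: "\<bar>ac p q n\<bar> * R ^ n \<le> B" for n
  proof (induction n rule: less_induct)
    case (less n)
    show ?case
    proof (cases "n < k0 + 3")
      case True
      then show ?thesis unfolding B_def using R
        by (intro member_le_sum) auto
    next
      case False
      then obtain k where k: "n = Suc (Suc (Suc k))" "k \<ge> k0"
        by (intro that[of "n - 3"]) auto
      have "R ^ 3 \<le> real k" using k0 k by linarith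
      also have "\<dots> \<le> (real k + 2) * (real k + 3)" by (simp add: algebra_simps)
      finally have le: "R ^ 3 / ((real k + 2) * (real k + 3)) \<le> 1" by (simp add: divide_le_eq)
      have "\<bar>ac p q n\<bar> * R ^ n = (\<bar>ac p q k\<bar> * R ^ k) * (R ^ 3 / ((real k + 2) * (real k + 3)))"
        unfolding k by (simp add: abs_mult field_simps power3_eq_cube)
      also have "\<dots> \<le> B * 1"
        using less[of k] k le B0 R by (intro mult_mono) auto
      finally show ?thesis by simp
    qed
  qed
  have "summable (\<lambda>n. norm (ac p q n) * \<bar>x\<bar> ^ n)"
    by (rule Abel_lemma[where M = B and ?r0.0 = R]) (use R bound in auto)
  then show ?thesis
    using summable_norm_cancel[of "\<lambda>n. ac p q n * x ^ n"] by (simp add: abs_mult power_abs)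
qed

definition airy_ode :: "(real \<Rightarrow> real) \<Rightarrow> (real \<Rightarrow> real) \<Rightarrow> bool" where
  "airy_ode f f' \<longleftrightarrow> (\<forall>x. (f has_real_derivative f' x) (at x) \<and> (f' has_real_derivative x * f x) (at x))"

definition af :: "real \<Rightarrow> real \<Rightarrow> real \<Rightarrow> real" where
  "af p q x = (\<Sum>n. ac p q n * x ^ n)"
definition af' :: "real \<Rightarrow> real \<Rightarrow> real \<Rightarrow> real" where
  "af' p q x = (\<Sum>n. diffs (ac p q) n * x ^ n)"

lemma airy_ode_af: "airy_ode (af p q) (af' p q)"
  unfolding airy_ode_def
proof (intro allI conjI)
  fix x :: real
  let ?c = "ac p q"
  have s1: "summable (\<lambda>n. diffs ?c n * y ^ n)" for y :: real
    by (rule termdiff_converges_all) (rule summable_ac)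
  have s2: "summable (\<lambda>n. diffs (diffs ?c) n * y ^ n)" for y :: real
    by (rule termdiff_converges_all) (rule s1)
  show "(af p q has_real_derivative af' p q x) (at x)"
    using termdiffs_strong_converges_everywhere[of ?c x] summable_ac
    unfolding af_def af'_def by simp
  have d: "(af' p q has_real_derivative (\<Sum>n. diffs (diffs ?c) n * x ^ n)) (at x)"
    using termdiffs_strong_converges_everywhere[of "diffs ?c" x] s1
    unfolding af'_def by simp
  have shift: "diffs (diffs ?c) (Suc n) = ?c n" for n
    by (simp add: diffs_def add_ac del: of_nat_Suc) (simp add: field_simps add_nonneg_eq_0_iff)
  have "(\<Sum>n. diffs (diffs ?c) n * x ^ n) = (\<Sum>n. diffs (diffs ?c) (Suc n) * x ^ Suc n)"
    using suminf_split_head[OF s2[of x]] by (simp add: diffs_def)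
  also have "\<dots> = (\<Sum>n. x * (?c n * x ^ n))"
    unfolding shift by (simp add: mult_ac)
  also have "\<dots> = x * af p q x"
    unfolding af_def by (rule suminf_mult) (rule summable_ac)
  finally show "(af' p q has_real_derivative x * af p q x) (at x)" using d by simp
qed

lemma ac_nonneg: "p \<ge> 0 \<Longrightarrow> q \<ge> 0 \<Longrightarrow> ac p q n \<ge> 0"
  by (induction p q n rule: ac.induct) auto

lemma af_ge:
  assumes "p \<ge> 0" "q \<ge> 0" "x \<ge> 0"
  shows "af p q x \<ge> ac p q n * x ^ n" "af' p q x \<ge> diffs (ac p q) n * x ^ n"
proof -
  show "af p q x \<ge> ac p q n * x ^ n"
    using sum_le_suminf[OF summable_ac[of p q x], of "{n}"] assms ac_nonneg[of p q]
    unfolding af_def by simp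
  have s1: "summable (\<lambda>n. diffs (ac p q) n * y ^ n)" for y :: real
    by (rule termdiff_converges_all) (rule summable_ac)
  show "af' p q x \<ge> diffs (ac p q) n * x ^ n"
    using sum_le_suminf[OF s1[of x], of "{n}"] assms ac_nonneg[of p q]
    unfolding af'_def by (simp add: diffs_def)
qed

text \<open>The decaying solution is \<open>f1 - l * f2\<close> with \<open>l\<close> the limit of the decreasing quotient \<open>f1 / f2\<close>.\<close>

lemma airy_sol_exists: "\<exists>f. airy_sol f"
proof -
  define f1 f1' f2 f2' where "f1 = af 1 0" and "f1' = af' 1 0" and "f2 = af 0 1" and "f2' = af' 0 1"
  have d1: "(f1 has_real_derivative f1' x) (at x)" "(f1' has_real_derivative x * f1 x) (at x)"
    and d2: "(f2 has_real_derivative f2' x) (at x)" "(f2' has_real_derivative x * f2 x) (at x)" for x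
    using airy_ode_af unfolding airy_ode_def f1_def f1'_def f2_def f2'_def by auto
  note [derivative_intros] = d1[THEN DERIV_chain2] d2[THEN DERIV_chain2]
  have at0: "f1 0 = 1" "f1' 0 = 0" "f2 0 = 0" "f2' 0 = 1"
    unfolding f1_def f1'_def f2_def f2'_def af_def af'_def
    by (simp_all add: diffs_def)
  have wronski: "f1 x * f2' x - f1' x * f2 x = 1" for x
  proof -
    have "((\<lambda>x. f1 x * f2' x - f1' x * f2 x) has_real_derivative 0) (at x)" for x
      by (auto intro!: derivative_eq_intros simp: algebra_simps)
    then have "f1 x * f2' x - f1' x * f2 x = f1 0 * f2' 0 - f1' 0 * f2 0"
      by (intro DERIV_isconst_all) auto
    then show ?thesis by (simp add: at0)
  qed
  have f1: "f1 x \<ge> 1" and f2: "f2 x \<ge> x" and f2': "f2' x \<ge> 1" and f2'_lim: "f2' x \<ge> x ^ 3 / 3" if "x \<ge> 0" for x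
    using af_ge(1)[of 1 0 x 0] af_ge(1)[of 0 1 x 1] af_ge(2)[of 0 1 x 0] af_ge(2)[of 0 1 x 3] that
    unfolding f1_def f2_def f2'_def by (simp_all add: diffs_def eval_nat_numeral)
  define \<phi> where "\<phi> x = f1 x / f2 x" for x
  define \<psi> where "\<psi> x = \<phi> x - 1 / (f2 x * f2' x)" for x
  have phi_pos: "\<phi> x > 0" if "x > 0" for x
    using f1[of x] f2[of x] that by (simp add: \<phi>_def divide_pos_pos)
  have phi_dec: "\<phi> y \<le> \<phi> x" if "0 < x" "x \<le> y" for x y
  proof (rule DERIV_nonpos_imp_nonincreasing[OF that(2)])
    fix s assume "x \<le> s" "s \<le> y"
    then have s: "f2 s > 0" using f2[of s] that by linarith
    have "(\<phi> has_real_derivative (f1' s * f2 s - f1 s * f2' s) / (f2 s * f2 s)) (at s)"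
      unfolding \<phi>_def using s by (auto intro!: derivative_eq_intros)
    moreover have "f1' s * f2 s - f1 s * f2' s = -1" using wronski[of s] by simp
    ultimately show "\<exists>d. (\<phi> has_real_derivative d) (at s) \<and> d \<le> 0" using s by auto
  qed
  have psi_inc: "\<psi> x \<le> \<psi> y" if "0 < x" "x \<le> y" for x y
  proof (rule DERIV_nonneg_imp_nondecreasing[OF that(2)])
    fix s assume "x \<le> s" "s \<le> y"
    then have s: "f2 s > 0" "f2' s > 0" "s > 0" using f2[of s] f2'[of s] that by linarith+
    let ?d = "(f1' s * f2 s - f1 s * f2' s) / (f2 s * f2 s)
       + (f2' s * f2' s + f2 s * (s * f2 s)) / ((f2 s * f2' s) * (f2 s * f2' s))"
    have "(\<psi> has_real_derivative ?d) (at s)"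
      unfolding \<phi>_def \<psi>_def using s
      by (auto intro!: derivative_eq_intros) (simp add: minus_divide_left algebra_simps)
    moreover have "?d = s / (f2' s * f2' s)"
    proof -
      have "f1' s * f2 s - f1 s * f2' s = -1" using wronski[of s] by simp
      moreover have "(f2' s * f2' s + f2 s * (s * f2 s)) / ((f2 s * f2' s) * (f2 s * f2' s))
          = 1 / (f2 s * f2 s) + s / (f2' s * f2' s)"
        using s by (simp add: add_divide_distrib)
      ultimately show ?thesis by simp
    qed
    ultimately show "\<exists>d. (\<psi> has_real_derivative d) (at s) \<and> d \<ge> 0" using s by auto
  qed
  define l where "l = Inf (\<phi> ` {1..})"
  have bdd: "bdd_below (\<phi> ` {1..})"
    by (rule bdd_belowI[where m = 0]) (auto intro!: less_imp_le[OF phi_pos])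
  have l_le: "l \<le> \<phi> x" if "x \<ge> 1" for x
    unfolding l_def using bdd that by (intro cINF_lower) auto
  have l_ge: "\<psi> x \<le> l" if "x \<ge> 1" for x
    unfolding l_def
  proof (rule cINF_greatest)
    fix y :: real assume y: "y \<in> {1..}"
    have psi_le: "\<psi> s \<le> \<phi> s" if "s \<ge> 1" for s
    proof -
      have "f2 s > 0" "f2' s > 0" using f2[of s] f2'[of s] that by linarith+
      then show ?thesis by (simp add: \<psi>_def)
    qed
    show "\<psi> x \<le> \<phi> y"
      using psi_inc[of x y] psi_le[of y] psi_le[of x] phi_dec[of y x] that y by (cases "x \<le> y") auto
  qed auto
  define f f' where "f x = f1 x - l * f2 x" and "f' x = f1' x - l * f2' x" for x
  have "(f has_real_derivative f' x) (at x)" "(f' has_real_derivative x * f x) (at x)" for x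
    unfolding f_def f'_def by (auto intro!: derivative_eq_intros simp: algebra_simps)
  moreover have "f 0 \<noteq> 0" by (simp add: f_def at0)
  moreover have "(f \<longlongrightarrow> 0) at_top"
  proof (rule tendsto_sandwich[of "\<lambda>_. 0" f _ "\<lambda>x. 3 / x ^ 3"])
    have *: "0 \<le> f x \<and> f x \<le> 3 / x ^ 3" if "x \<ge> 1" for x
    proof
      have p: "f2 x > 0" "f2' x > 0" "x ^ 3 > 0" using f2[of x] f2'[of x] that by (linarith, linarith, simp)
      show "0 \<le> f x" using l_le[OF that] p(1) by (simp add: f_def \<phi>_def field_simps)
      have "f x = f2 x * (\<phi> x - l)" using p(1) by (simp add: f_def \<phi>_def field_simps)
      also have "\<dots> \<le> f2 x * (1 / (f2 x * f2' x))"
        using l_ge[OF that] p by (intro mult_left_mono) (auto simp: \<psi>_def)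
      also have "\<dots> = 1 / f2' x" using p by simp
      also have "\<dots> \<le> 1 / (x ^ 3 / 3)" using f2'_lim[of x] p that by (intro frac_le) auto
      finally show "f x \<le> 3 / x ^ 3" by simp
    qed
    have "\<forall>\<^sub>F x in at_top. 0 \<le> f x \<and> f x \<le> 3 / x ^ 3"
      using eventually_ge_at_top[of 1] by eventually_elim (rule *)
    then show "\<forall>\<^sub>F x in at_top. 0 \<le> f x" "\<forall>\<^sub>F x in at_top. f x \<le> 3 / x ^ 3"
      by (auto elim: eventually_mono)
    show "((\<lambda>x::real. 3 / x ^ 3) \<longlongrightarrow> 0) at_top" by real_asymp
  qed simp
  ultimately have "airy_sol f" unfolding airy_sol_def by blast
  then show ?thesis by blast
qed

text \<open>Gronwall: the energy \<open>f^2 + f'^2\<close> has derivative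
  \<open>2 (1 + s) f f'\<close>, in absolute value at most \<open>1 + K\<close> times the energy.
  Both directions are stated because the shifts in \<open>F_taylor\<close> go either way.\<close>

lemma airy_energy_le:
  assumes ode: "airy_ode f f'" and K: "\<And>s. s \<in> {a..b} \<Longrightarrow> \<bar>s\<bar> \<le> K" and "a \<le> b"
  shows "(f b)\<^sup>2 + (f' b)\<^sup>2 \<le> exp ((1 + K) * (b - a)) * ((f a)\<^sup>2 + (f' a)\<^sup>2)"
    and "(f a)\<^sup>2 + (f' a)\<^sup>2 \<le> exp ((1 + K) * (b - a)) * ((f b)\<^sup>2 + (f' b)\<^sup>2)"
proof -
  have d: "(f has_real_derivative f' x) (at x)" "(f' has_real_derivative x * f x) (at x)" for x
    using ode by (auto simp: airy_ode_def)
  note [derivative_intros] = d[THEN DERIV_chain2]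
  define e where "e x = (f x)\<^sup>2 + (f' x)\<^sup>2" for x
  have ab: "\<bar>2 * (1 + s) * f s * f' s\<bar> \<le> (1 + K) * e s" if "s \<in> {a..b}" for s
  proof -
    have 1: "\<bar>1 + s\<bar> \<le> 1 + K" using K[OF that] by linarith
    have 2: "\<bar>2 * f s * f' s\<bar> \<le> e s"
      using sum_squares_bound[of "\<bar>f s\<bar>" "\<bar>f' s\<bar>"] unfolding e_def by (simp add: abs_mult)
    have "\<bar>2 * (1 + s) * f s * f' s\<bar> = \<bar>1 + s\<bar> * \<bar>2 * f s * f' s\<bar>"
      unfolding abs_mult[symmetric] by (simp add: algebra_simps)
    also have "\<dots> \<le> (1 + K) * e s" using 1 2 by (intro mult_mono) auto
    finally show ?thesis .
  qed
  have "exp (- (1 + K) * b) * e b \<le> exp (- (1 + K) * a) * e a"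
  proof (rule deriv_antimono[OF \<open>a \<le> b\<close>])
    fix s assume s: "a \<le> s" "s \<le> b"
    show "((\<lambda>x. exp (- (1 + K) * x) * e x) has_real_derivative
            exp (- (1 + K) * s) * (2 * (1 + s) * f s * f' s - (1 + K) * e s)) (at s)"
      unfolding e_def by (auto intro!: derivative_eq_intros simp: algebra_simps power2_eq_square)
    show "exp (- (1 + K) * s) * (2 * (1 + s) * f s * f' s - (1 + K) * e s) \<le> 0"
      using ab[of s] s by (intro mult_nonneg_nonpos) auto
  qed
  then have "exp ((1 + K) * b) * (exp (- (1 + K) * b) * e b) \<le> exp ((1 + K) * b) * (exp (- (1 + K) * a) * e a)"
    by (intro mult_left_mono) auto
  then show "(f b)\<^sup>2 + (f' b)\<^sup>2 \<le> exp ((1 + K) * (b - a)) * ((f a)\<^sup>2 + (f' a)\<^sup>2)"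
    unfolding e_def[symmetric] mult.assoc[symmetric] exp_add[symmetric] by (simp add: algebra_simps)
  have "exp ((1 + K) * a) * e a \<le> exp ((1 + K) * b) * e b"
  proof (rule deriv_mono[OF \<open>a \<le> b\<close>])
    fix s assume s: "a \<le> s" "s \<le> b"
    show "((\<lambda>x. exp ((1 + K) * x) * e x) has_real_derivative
            exp ((1 + K) * s) * (2 * (1 + s) * f s * f' s + (1 + K) * e s)) (at s)"
      unfolding e_def by (auto intro!: derivative_eq_intros simp: algebra_simps power2_eq_square)
    show "exp ((1 + K) * s) * (2 * (1 + s) * f s * f' s + (1 + K) * e s) \<ge> 0"
      using ab[of s] s by (intro mult_nonneg_nonneg) auto
  qed
  then have "exp (- (1 + K) * a) * (exp ((1 + K) * a) * e a) \<le> exp (- (1 + K) * a) * (exp ((1 + K) * b) * e b)"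
    by (intro mult_left_mono) auto
  then show "(f a)\<^sup>2 + (f' a)\<^sup>2 \<le> exp ((1 + K) * (b - a)) * ((f b)\<^sup>2 + (f' b)\<^sup>2)"
    unfolding e_def[symmetric] mult.assoc[symmetric] exp_add[symmetric] by (simp add: algebra_simps)
qed

lemma airy_ode_unique:
  assumes "airy_ode f f'" "f a = 0" "f' a = 0"
  shows "f x = 0"
proof (cases "a \<le> x")
  case True
  have "(f x)\<^sup>2 + (f' x)\<^sup>2 \<le> exp ((1 + max \<bar>a\<bar> \<bar>x\<bar>) * (x - a)) * ((f a)\<^sup>2 + (f' a)\<^sup>2)"
    by (rule airy_energy_le(1)[OF assms(1) _ True]) auto
  then show ?thesis using assms
    by (simp add: sum_power2_le_zero_iff)
next
  case False
  have "(f x)\<^sup>2 + (f' x)\<^sup>2 \<le> exp ((1 + max \<bar>a\<bar> \<bar>x\<bar>) * (a - x)) * ((f a)\<^sup>2 + (f' a)\<^sup>2)"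
    by (rule airy_energy_le(2)[OF assms(1)]) (use False in auto)
  then show ?thesis using assms
    by (simp add: sum_power2_le_zero_iff)
qed

section \<open>Estimates for a decaying Airy solution to the right of its largest root\<close>

locale airy_pos =
  fixes F F' :: "real \<Rightarrow> real" and a1 :: real
  assumes ode: "airy_ode F F'"
    and F_root: "F a1 = 0"
    and F_pos: "\<And>x. x > a1 \<Longrightarrow> F x > 0"
    and F'_root: "F' a1 > 0"
    and F_lim: "(F \<longlongrightarrow> 0) at_top"
    and a1_neg: "a1 < 0"
begin

lemma dF: "(F has_real_derivative F' x) (at x)" "(F' has_real_derivative x * F x) (at x)"
  using ode by (auto simp: airy_ode_def)

lemmas [derivative_intros] = dF[THEN DERIV_chain2]

lemma F_nonneg: "x \<ge> a1 \<Longrightarrow> F x \<ge> 0"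
  using F_pos[of x] F_root by (cases "x = a1") auto

lemma isCont_F: "isCont F x" "isCont F' x"
  by (rule DERIV_isCont[OF dF(1)]) (rule DERIV_isCont[OF dF(2)])

text \<open>The derivative of \<open>exp (- s) (F' + F)\<close> is
  \<open>exp (- s) (s - 1) F\<close>, nonnegative beyond 1. A positive value of
  \<open>F' + F\<close> would thus persist and keep \<open>F\<close> away from 0, against the
  decay.\<close>

lemma F'_le:
  assumes "z \<ge> 1"
  shows "F' z \<le> - F z"
proof (rule ccontr)
  define \<delta> where "\<delta> = F' z + F z"
  assume "\<not> F' z \<le> - F z"
  then have \<delta>: "\<delta> > 0" by (simp add: \<delta>_def)
  have sum_ge: "F' s + F s \<ge> \<delta>" if "s \<ge> z" for s
  proof -
    have "exp (- z) * (F' z + F z) \<le> exp (- s) * (F' s + F s)"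
    proof (rule deriv_mono[OF that])
      fix x assume x: "z \<le> x" "x \<le> s"
      show "((\<lambda>s. exp (- s) * (F' s + F s)) has_real_derivative exp (- x) * ((x - 1) * F x)) (at x)"
        by (auto intro!: derivative_eq_intros simp: algebra_simps)
      have "F x \<ge> 0" using F_nonneg[of x] x assms a1_neg by simp
      then show "exp (- x) * ((x - 1) * F x) \<ge> 0" using x assms by simp
    qed
    then have "exp s * (exp (- z) * \<delta>) \<le> exp s * (exp (- s) * (F' s + F s))"
      unfolding \<delta>_def by (intro mult_left_mono) auto
    then have "exp (s - z) * \<delta> \<le> F' s + F s"
      unfolding mult.assoc[symmetric] exp_add[symmetric] by simp
    moreover have "1 * \<delta> \<le> exp (s - z) * \<delta>" using \<delta> that by (intro mult_right_mono) auto
    ultimately show ?thesis by linarith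
  qed
  have F_ge: "F s \<ge> \<delta> / 2" if "s \<ge> z + 1" for s
  proof -
    have zs: "z \<le> s" using that by simp
    have "exp z * (F z - \<delta>) \<le> exp s * (F s - \<delta>)"
    proof (rule deriv_mono[OF zs])
      fix x assume x: "z \<le> x" "x \<le> s"
      show "((\<lambda>s. exp s * (F s - \<delta>)) has_real_derivative exp x * (F' x + F x - \<delta>)) (at x)"
        by (auto intro!: derivative_eq_intros simp: algebra_simps)
      show "exp x * (F' x + F x - \<delta>) \<ge> 0" using sum_ge[of x] x by simp
    qed
    then have "exp (- s) * (exp z * (F z - \<delta>)) \<le> exp (- s) * (exp s * (F s - \<delta>))"
      by (intro mult_left_mono) auto
    then have "exp (z - s) * (F z - \<delta>) \<le> F s - \<delta>"
      unfolding mult.assoc[symmetric] exp_add[symmetric] by simp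
    moreover have "exp (z - s) * F z \<ge> 0" using F_nonneg[of z] assms a1_neg by simp
    moreover have "exp (z - s) * \<delta> \<le> (1 / 2) * \<delta>"
    proof (rule mult_right_mono)
      have "exp (s - z) \<ge> 2" using exp_ge_add_one_self[of "s - z"] that by linarith
      then have "inverse (exp (s - z)) \<le> inverse 2" by (intro le_imp_inverse_le) auto
      then show "exp (z - s) \<le> 1 / 2" by (simp add: exp_minus[symmetric])
    qed (use \<delta> in simp)
    ultimately show ?thesis by (simp add: algebra_simps)
  qed
  have "\<forall>\<^sub>F s in at_top. F s < \<delta> / 2" using F_lim \<delta> by (intro order_tendstoD) auto
  then have "\<forall>\<^sub>F s in at_top. s \<ge> z + 1 \<and> F s < \<delta> / 2"
    using eventually_ge_at_top by (rule eventually_conj[rotated])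
  then obtain s where "s \<ge> z + 1" "F s < \<delta> / 2"
    using eventually_happens trivial_limit_at_top_linorder by blast
  then show False using F_ge[of s] by simp
qed

text \<open>\<open>F' + (s + 1) F\<close> has derivative \<open>(s + 1) (F + F')\<close>,
  nonpositive by \<open>F'_le\<close>. A negative value would persist, force
  \<open>F' <= - \<delta>\<close> and drive \<open>F\<close> below 0.\<close>

lemma F'_ge:
  assumes "z \<ge> 1"
  shows "F' z \<ge> - (z + 1) * F z"
proof (rule ccontr)
  define \<delta> where "\<delta> = - (F' z + (z + 1) * F z)"
  assume "\<not> ?thesis"
  then have \<delta>: "\<delta> > 0" by (simp add: \<delta>_def algebra_simps)
  have le: "F' s \<le> - \<delta>" if "s \<ge> z" for s
  proof -
    have "F' s + (s + 1) * F s \<le> F' z + (z + 1) * F z"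
    proof (rule deriv_antimono[OF that])
      fix x assume x: "z \<le> x" "x \<le> s"
      show "((\<lambda>s. F' s + (s + 1) * F s) has_real_derivative (x + 1) * (F x + F' x)) (at x)"
        by (auto intro!: derivative_eq_intros simp: algebra_simps)
      show "(x + 1) * (F x + F' x) \<le> 0"
        using F'_le[of x] x assms by (intro mult_nonneg_nonpos) auto
    qed
    moreover have "(s + 1) * F s \<ge> 0" using F_nonneg[of s] that assms a1_neg by simp
    ultimately show ?thesis unfolding \<delta>_def by linarith
  qed
  define s where "s = z + F z / \<delta> + 1"
  have "F z \<ge> 0" using F_nonneg[of z] assms a1_neg by simp
  then have s: "s \<ge> z" using \<delta> by (simp add: s_def)
  have "F s + \<delta> * s \<le> F z + \<delta> * z"
  proof (rule deriv_antimono[OF s])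
    fix x assume x: "z \<le> x" "x \<le> s"
    show "((\<lambda>s. F s + \<delta> * s) has_real_derivative F' x + \<delta>) (at x)"
      by (auto intro!: derivative_eq_intros)
    show "F' x + \<delta> \<le> 0" using le[of x] x by simp
  qed
  then have "F s \<le> - \<delta>" using \<delta> by (simp add: s_def algebra_simps)
  then show False using F_nonneg[of s] s assms a1_neg \<delta> by simp
qed

lemma F_exp_decay: "\<exists>C>0. \<forall>y\<ge>0. F (a1 + y) \<le> C * exp (- y)"
proof -
  have "\<exists>B. \<forall>x. a1 \<le> x \<and> x \<le> 1 \<longrightarrow> F x \<le> B"
    using isCont_bounded[of a1 1 F] isCont_F a1_neg by simp
  then obtain B where B: "\<And>x. a1 \<le> x \<Longrightarrow> x \<le> 1 \<Longrightarrow> F x \<le> B" by blast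
  have B0: "B > 0" using B[of 1] F_pos[of 1] a1_neg by simp
  have dec: "exp z * F z \<le> exp 1 * F 1" if "z \<ge> 1" for z
  proof (rule deriv_antimono[OF that])
    fix x :: real assume x: "1 \<le> x" "x \<le> z"
    show "((\<lambda>z. exp z * F z) has_real_derivative exp x * (F x + F' x)) (at x)"
      by (auto intro!: derivative_eq_intros simp: algebra_simps)
    show "exp x * (F x + F' x) \<le> 0" using F'_le[of x] x by (intro mult_nonneg_nonpos) auto
  qed
  have le: "F z \<le> B * exp (1 - z)" if "z \<ge> a1" for z
  proof (cases "z \<le> 1")
    case True
    have "B * 1 \<le> B * exp (1 - z)" using True B0 by (intro mult_left_mono) auto
    then show ?thesis using B[of z] True that by simp
  next
    case False
    then have "exp (- z) * (exp z * F z) \<le> exp (- z) * (exp 1 * F 1)"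
      using dec[of z] by (intro mult_left_mono) auto
    then have "F z \<le> exp (1 - z) * F 1"
      unfolding mult.assoc[symmetric] exp_add[symmetric] by simp
    also have "\<dots> \<le> exp (1 - z) * B" using B[of 1] a1_neg by (intro mult_left_mono) auto
    finally show ?thesis by (simp add: mult.commute)
  qed
  show ?thesis
  proof (intro exI[of _ "B * exp (1 - a1)"] conjI allI impI)
    fix y :: real assume "y \<ge> 0"
    then have "F (a1 + y) \<le> B * exp (1 - (a1 + y))" by (intro le) simp
    also have "exp (1 - (a1 + y)) = exp (1 - a1) * exp (- y)" by (simp add: exp_add[symmetric])
    finally show "F (a1 + y) \<le> B * exp (1 - a1) * exp (- y)" by simp
  qed (use B0 in simp)
qed

text \<open>The quotient \<open>F z / (z - a1)\<close>, continued by \<open>F' a1\<close> at the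
  root, is continuous and positive on a compact interval, so it has a positive minimum
  there.\<close>

lemma F_lower: "\<exists>c>0. \<forall>y. 0 \<le> y \<and> y \<le> Y \<longrightarrow> c * y \<le> F (a1 + y)"
proof -
  define b where "b = a1 + max Y 1"
  have ab: "a1 \<le> b" by (simp add: b_def)
  obtain g where g: "\<And>z. F z - F a1 = g z * (z - a1)" "isCont g a1" "g a1 = F' a1"
    using dF(1)[of a1] unfolding CARAT_DERIV by blast
  have g_eq: "g z = F z / (z - a1)" if "z \<noteq> a1" for z
    using g(1)[of z] that F_root by simp
  have "isCont g z" for z
  proof (cases "z = a1")
    case False
    have "\<forall>\<^sub>F s in nhds z. s \<noteq> a1"
      using False by (intro t1_space_nhds) auto
    then have "\<forall>\<^sub>F s in nhds z. g s = F s / (s - a1)"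
      by (rule eventually_mono) (rule g_eq)
    moreover have "isCont (\<lambda>s. F s / (s - a1)) z"
      using False isCont_F by (intro continuous_intros) auto
    ultimately show ?thesis by (simp add: isCont_cong)
  qed (use g in simp)
  then obtain m where m: "\<And>z. a1 \<le> z \<Longrightarrow> z \<le> b \<Longrightarrow> m \<le> g z" "\<exists>z. a1 \<le> z \<and> z \<le> b \<and> g z = m"
    using isCont_eq_Lb[OF ab, of g] by blast
  have "g z > 0" if "z \<ge> a1" for z
    using g(3) g_eq[of z] F_pos[of z] F'_root that by (cases "z = a1") auto
  then have "m > 0" using m(2) by auto
  moreover have "m * y \<le> F (a1 + y)" if "0 \<le> y" "y \<le> Y" for y
  proof -
    have "m \<le> g (a1 + y)" using that by (intro m(1)) (auto simp: b_def)
    then have "m * y \<le> g (a1 + y) * y" using that by (intro mult_right_mono) auto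
    then show ?thesis using g(1)[of "a1 + y"] F_root by simp
  qed
  ultimately show ?thesis by blast
qed

text \<open>Near \<open>a1\<close> the factor \<open>y\<close> makes up for the simple zero of
  \<open>F\<close>; beyond 1, \<open>F'_le\<close> and \<open>F'_ge\<close> bound
  \<open>|F'|\<close> by a linear factor times \<open>F\<close>. This is what allows terms with
  \<open>F'\<close> to be measured against \<open>F\<close>.\<close>

lemma F'_bound: "\<exists>C>0. \<forall>y\<ge>0. y * \<bar>F' (a1 + y)\<bar> \<le> C * (1 + y)\<^sup>2 * F (a1 + y)"
proof -
  have "\<exists>B. \<forall>x. a1 \<le> x \<and> x \<le> 1 \<longrightarrow> \<bar>F' x\<bar> \<le> B"
    using isCont_bounded[of a1 1 "\<lambda>x. \<bar>F' x\<bar>"] isCont_F a1_neg by (simp add: continuous_rabs)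
  then obtain B where B: "\<And>x. a1 \<le> x \<Longrightarrow> x \<le> 1 \<Longrightarrow> \<bar>F' x\<bar> \<le> B" by blast
  obtain c where c: "c > 0" "\<And>y. 0 \<le> y \<Longrightarrow> y \<le> 1 - a1 \<Longrightarrow> c * y \<le> F (a1 + y)"
    using F_lower[of "1 - a1"] by blast
  have B0: "B \<ge> 0" using B[of 1] a1_neg by auto
  have "y * \<bar>F' (a1 + y)\<bar> \<le> max 1 (B / c) * (1 + y)\<^sup>2 * F (a1 + y)" if y: "y \<ge> 0" for y
  proof -
    have F0: "F (a1 + y) \<ge> 0" using F_nonneg y by simp
    have y2: "1 \<le> (1 + y)\<^sup>2" using y by simp
    show ?thesis
    proof (cases "y \<le> 1 - a1")
      case True
      have "y * \<bar>F' (a1 + y)\<bar> \<le> y * B" using True y B[of "a1 + y"] by (intro mult_left_mono) auto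
      also have "\<dots> = (B / c) * (c * y)" using c by simp
      also have "\<dots> \<le> (B / c) * F (a1 + y)" using c B0 True y by (intro mult_left_mono) auto
      also have "\<dots> \<le> (max 1 (B / c) * (1 + y)\<^sup>2) * F (a1 + y)"
      proof (rule mult_right_mono[OF _ F0])
        have "(B / c) * 1 \<le> max 1 (B / c) * (1 + y)\<^sup>2" using y2 B0 c by (intro mult_mono) auto
        then show "B / c \<le> max 1 (B / c) * (1 + y)\<^sup>2" by simp
      qed
      finally show ?thesis .
    next
      case False
      have "\<bar>F' (a1 + y)\<bar> \<le> (1 + y) * F (a1 + y)"
      proof -
        have "(a1 + y + 1) * F (a1 + y) \<le> (1 + y) * F (a1 + y)"
          using a1_neg F0 by (intro mult_right_mono) auto
        then show ?thesis using F'_le[of "a1 + y"] F'_ge[of "a1 + y"] False F0 by (simp add: algebra_simps)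
      qed
      then have "y * \<bar>F' (a1 + y)\<bar> \<le> (1 + y) * ((1 + y) * F (a1 + y))"
        using y F0 by (intro mult_mono) auto
      also have "\<dots> = 1 * ((1 + y)\<^sup>2 * F (a1 + y))" by (simp add: power2_eq_square)
      also have "\<dots> \<le> max 1 (B / c) * ((1 + y)\<^sup>2 * F (a1 + y))"
        using F0 by (intro mult_right_mono) auto
      finally show ?thesis by (simp add: mult.assoc)
    qed
  qed
  then show ?thesis by (intro exI[of _ "max 1 (B / c)"]) auto
qed

text \<open>All derivatives reduce to \<open>F\<close> and \<open>F'\<close> by
  \<open>F'' = z F\<close>. The remainder lives at an intermediate point, and the energy bound
  carries it back to \<open>z\<close>; the hypothesis on \<open>t\<close> keeps its exponential
  factor below 3. The error has to be relative to the values at \<open>z\<close> because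
  \<open>F\<close> vanishes at \<open>a1\<close> and decays at infinity.\<close>

lemma F_taylor:
  assumes z: "z \<ge> a1" and t: "\<bar>t\<bar> * (2 + \<bar>z\<bar>) \<le> 1"
  shows "\<bar>F (z + t) - (1 + z * t\<^sup>2 / 2 + t ^ 3 / 6) * F z - (t + z * t ^ 3 / 6 + t ^ 4 / 12) * F' z\<bar>
           \<le> (1 + \<bar>z\<bar>)\<^sup>2 * (t ^ 4 * F z + \<bar>t\<bar> ^ 5 * \<bar>F' z\<bar>)"
proof (cases "t = 0")
  case False
  define df where "df m x = (if m = 0 then F x else if m = 1 then F' x else if m = 2 then x * F x
     else if m = 3 then F x + x * F' x else if m = 4 then 2 * F' x + x\<^sup>2 * F x
     else 4 * x * F x + x\<^sup>2 * F' x)" for m :: nat and x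
  have der: "\<forall>m x. m < 5 \<and> z - 1 \<le> x \<and> x \<le> z + 1 \<longrightarrow> DERIV (df m) x :> df (Suc m) x"
  proof (intro allI impI)
    fix m :: nat and x assume "m < 5 \<and> z - 1 \<le> x \<and> x \<le> z + 1"
    then have "m = 0 \<or> m = 1 \<or> m = 2 \<or> m = 3 \<or> m = 4" by auto
    moreover have "(F has_real_derivative F' x) (at x)" "(F' has_real_derivative x * F x) (at x)"
      "((\<lambda>x. x * F x) has_real_derivative F x + x * F' x) (at x)"
      "((\<lambda>x. F x + x * F' x) has_real_derivative 2 * F' x + x\<^sup>2 * F x) (at x)"
      "((\<lambda>x. 2 * F' x + x\<^sup>2 * F x) has_real_derivative 4 * x * F x + x\<^sup>2 * F' x) (at x)"
      by (auto intro!: derivative_eq_intros simp: algebra_simps power2_eq_square)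
    ultimately show "DERIV (df m) x :> df (Suc m) x"
      unfolding df_def by (elim disjE) simp_all
  qed
  have t1: "\<bar>t\<bar> \<le> 1 / 2"
  proof -
    have "\<bar>t\<bar> * 2 \<le> \<bar>t\<bar> * (2 + \<bar>z\<bar>)" by (intro mult_left_mono) auto
    then show ?thesis using t by linarith
  qed
  then have t2: "- 1 \<le> t" "t \<le> 1" by linarith+
  have df0: "df 0 = F" by (rule ext) (simp add: df_def)
  obtain \<xi> where \<xi>: "if z + t < z then z + t < \<xi> \<and> \<xi> < z else z < \<xi> \<and> \<xi> < z + t"
    "F (z + t) = (\<Sum>m<5. df m z / fact m * (z + t - z) ^ m) + df 5 \<xi> / fact 5 * (z + t - z) ^ 5"
    using Taylor[of 5 df F "z - 1" "z + 1" z "z + t"] der df0 t2 False by auto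
  have \<xi>z: "\<bar>\<xi> - z\<bar> \<le> \<bar>t\<bar>" using \<xi>(1) by (auto split: if_splits)
  have exp_z: "F (z + t) = (1 + z * t\<^sup>2 / 2 + t ^ 3 / 6) * F z + (t + z * t ^ 3 / 6 + t ^ 4 / 12) * F' z
     + z\<^sup>2 * t ^ 4 / 24 * F z + df 5 \<xi> / 120 * t ^ 5"
    unfolding \<xi>(2) by (simp add: df_def eval_nat_numeral) (simp add: algebra_simps add_divide_distrib)
  have F0: "F z \<ge> 0" using F_nonneg z by simp
  have energy: "(F \<xi>)\<^sup>2 + (F' \<xi>)\<^sup>2 \<le> 3 * ((F z)\<^sup>2 + (F' z)\<^sup>2)"
  proof -
    have e3: "exp ((1 + (\<bar>z\<bar> + 1)) * d) \<le> 3" if "0 \<le> d" "d \<le> \<bar>t\<bar>" for d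
    proof -
      have "(1 + (\<bar>z\<bar> + 1)) * d \<le> (1 + (\<bar>z\<bar> + 1)) * \<bar>t\<bar>" using that by (intro mult_left_mono) auto
      also have "\<dots> \<le> 1" using t by (simp add: algebra_simps)
      finally have "exp ((1 + (\<bar>z\<bar> + 1)) * d) \<le> exp 1" by simp
      then show ?thesis using exp_le by linarith
    qed
    show ?thesis
    proof (cases "z \<le> \<xi>")
      case True
      have "(F \<xi>)\<^sup>2 + (F' \<xi>)\<^sup>2 \<le> exp ((1 + (\<bar>z\<bar> + 1)) * (\<xi> - z)) * ((F z)\<^sup>2 + (F' z)\<^sup>2)"
        by (rule airy_energy_le(1)[OF ode _ True]) (use \<xi>z t1 in auto)
      also have "\<dots> \<le> 3 * ((F z)\<^sup>2 + (F' z)\<^sup>2)"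
        using True \<xi>z by (intro mult_right_mono e3) auto
      finally show ?thesis .
    next
      case False
      then have zx: "\<xi> \<le> z" by simp
      have "(F \<xi>)\<^sup>2 + (F' \<xi>)\<^sup>2 \<le> exp ((1 + (\<bar>z\<bar> + 1)) * (z - \<xi>)) * ((F z)\<^sup>2 + (F' z)\<^sup>2)"
        by (rule airy_energy_le(2)[OF ode _ zx]) (use \<xi>z t1 in auto)
      also have "\<dots> \<le> 3 * ((F z)\<^sup>2 + (F' z)\<^sup>2)"
        using zx \<xi>z by (intro mult_right_mono e3) auto
      finally show ?thesis .
    qed
  qed
  define S where "S = F z + \<bar>F' z\<bar>"
  have S0: "S \<ge> 0" using F0 by (simp add: S_def)
  have le: "\<bar>v\<bar> \<le> 2 * S" if "v\<^sup>2 \<le> 3 * ((F z)\<^sup>2 + (F' z)\<^sup>2)" for v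
  proof (rule power2_le_imp_le)
    have "3 * ((F z)\<^sup>2 + (F' z)\<^sup>2) \<le> (2 * S)\<^sup>2"
    proof -
      define A B where "A = F z" and "B = \<bar>F' z\<bar>"
      have "A \<ge> 0" "B \<ge> 0" and B2: "(F' z)\<^sup>2 = B\<^sup>2" using F0 by (auto simp: A_def B_def)
      then have "A * B \<ge> 0" "A\<^sup>2 \<ge> 0" "B\<^sup>2 \<ge> 0" by simp_all
      then have "0 \<le> A\<^sup>2 + (8 * (A * B) + B\<^sup>2)" by (intro add_nonneg_nonneg) auto
      then have "3 * (A\<^sup>2 + B\<^sup>2) \<le> 4 * A\<^sup>2 + 8 * (A * B) + 4 * B\<^sup>2" by (simp add: algebra_simps)
      also have "\<dots> = (2 * (A + B))\<^sup>2" by (simp add: power2_eq_square algebra_simps)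
      finally show ?thesis unfolding S_def B2 A_def B_def .
    qed
    then show "\<bar>v\<bar>\<^sup>2 \<le> (2 * S)\<^sup>2" using that by simp
    show "0 \<le> 2 * S" using S0 by simp
  qed
  have "(F \<xi>)\<^sup>2 \<ge> 0" "(F' \<xi>)\<^sup>2 \<ge> 0" by simp_all
  then have bF: "\<bar>F \<xi>\<bar> \<le> 2 * S" "\<bar>F' \<xi>\<bar> \<le> 2 * S"
    using energy by (intro le; linarith)+
  define w where "w = 1 + \<bar>z\<bar>"
  have w: "w \<ge> 1" "\<bar>\<xi>\<bar> \<le> w" using \<xi>z t1 by (auto simp: w_def)
  have d5: "\<bar>df 5 \<xi>\<bar> \<le> 10 * w\<^sup>2 * S"
  proof -
    have "\<bar>df 5 \<xi>\<bar> \<le> 4 * \<bar>\<xi>\<bar> * \<bar>F \<xi>\<bar> + \<bar>\<xi>\<bar>\<^sup>2 * \<bar>F' \<xi>\<bar>"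
      using abs_triangle_ineq[of "4 * \<xi> * F \<xi>" "\<xi>\<^sup>2 * F' \<xi>"] by (simp add: df_def abs_mult)
    also have "\<dots> \<le> 4 * (w * w) * (2 * S) + w\<^sup>2 * (2 * S)"
    proof (intro add_mono mult_mono)
      have "\<bar>\<xi>\<bar> * 1 \<le> w * w" using w by (intro mult_mono) auto
      then show "\<bar>\<xi>\<bar> \<le> w * w" by simp
      show "\<bar>\<xi>\<bar>\<^sup>2 \<le> w\<^sup>2" using w by (intro power_mono) auto
    qed (use w bF S0 in auto)
    finally show ?thesis by (simp add: power2_eq_square algebra_simps)
  qed
  have z2: "z\<^sup>2 \<le> w\<^sup>2" using power_mono[of "\<bar>z\<bar>" w 2] by (simp add: w_def)
  have t4: "\<bar>t\<bar> ^ 4 = t ^ 4" by simp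
  have "F (z + t) - (1 + z * t\<^sup>2 / 2 + t ^ 3 / 6) * F z - (t + z * t ^ 3 / 6 + t ^ 4 / 12) * F' z
      = z\<^sup>2 * t ^ 4 / 24 * F z + df 5 \<xi> / 120 * t ^ 5"
    unfolding exp_z by simp
  also have "\<bar>\<dots>\<bar> \<le> \<bar>z\<^sup>2 * t ^ 4 / 24 * F z\<bar> + \<bar>df 5 \<xi> / 120 * t ^ 5\<bar>" by (rule abs_triangle_ineq)
  also have "\<dots> = z\<^sup>2 * (t ^ 4 / 24 * F z) + \<bar>df 5 \<xi>\<bar> * (\<bar>t\<bar> ^ 5 / 120)"
    using F0 by (simp add: abs_mult power_abs)
  also have "\<dots> \<le> w\<^sup>2 * (t ^ 4 / 24 * F z) + 10 * w\<^sup>2 * S * (\<bar>t\<bar> ^ 5 / 120)"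
    using z2 d5 F0 by (intro add_mono mult_right_mono) auto
  also have "\<dots> = w\<^sup>2 * (t ^ 4 / 24 * F z + \<bar>t\<bar> ^ 5 / 12 * F z + \<bar>t\<bar> ^ 5 / 12 * \<bar>F' z\<bar>)"
    by (simp add: S_def algebra_simps)
  also have "\<dots> \<le> w\<^sup>2 * (t ^ 4 * F z + \<bar>t\<bar> ^ 5 * \<bar>F' z\<bar>)"
  proof (rule mult_left_mono)
    have "\<bar>t\<bar> ^ 5 = \<bar>t\<bar> * t ^ 4" unfolding t4[symmetric] by (simp add: eval_nat_numeral)
    also have "\<dots> \<le> 1 * t ^ 4" using t1 by (intro mult_right_mono) auto
    finally have "\<bar>t\<bar> ^ 5 * F z \<le> t ^ 4 * F z" using F0 by (intro mult_right_mono) auto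
    moreover have "\<bar>t\<bar> ^ 5 * \<bar>F' z\<bar> \<ge> 0" "t ^ 4 * F z \<ge> 0" using F0 by simp_all
    moreover have "a / 24 + b / 12 + c / 12 \<le> a + c" if "b \<le> a" "0 \<le> c" "0 \<le> a" for a b c :: real
      using that by linarith
    ultimately show "t ^ 4 / 24 * F z + \<bar>t\<bar> ^ 5 / 12 * F z + \<bar>t\<bar> ^ 5 / 12 * \<bar>F' z\<bar> \<le> t ^ 4 * F z + \<bar>t\<bar> ^ 5 * \<bar>F' z\<bar>"
      by (metis times_divide_eq_left)
  qed simp
  finally show ?thesis by (simp add: w_def)
qed simp

end

section \<open>Roots of Airy solutions, and the passage to \<open>Ai\<close>\<close>

lemma airy_no_root_nonneg:
  assumes "airy_ode f f'" "(f \<longlongrightarrow> 0) at_top" "x0 \<ge> 0" "f x0 = 0"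
  shows "f x = 0"
proof -
  have d: "(f has_real_derivative f' x) (at x)" "(f' has_real_derivative x * f x) (at x)" for x
    using assms(1) by (auto simp: airy_ode_def)
  note [derivative_intros] = d[THEN DERIV_chain2]
  \<comment> \<open>\<open>f f'\<close> has derivative \<open>f'^2 + x f^2\<close>, so from a root
    \<open>x0 >= 0\<close> on it is nonnegative and \<open>f^2\<close> cannot decrease. As
    \<open>f\<close> tends to 0, it vanishes beyond \<open>x0\<close>, and then everywhere by
    uniqueness.\<close>
  have prod: "f x * f' x \<ge> 0" if "x0 \<le> x" for x
  proof -
    have "f x0 * f' x0 \<le> f x * f' x"
    proof (rule deriv_mono[OF that])
      fix y assume "x0 \<le> y" "y \<le> x"
      then show "f' y * f' y + y * f y * f y \<ge> 0" using assms(3) by (simp add: mult.assoc)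
      show "((\<lambda>x. f x * f' x) has_real_derivative f' y * f' y + y * f y * f y) (at y)"
        by (auto intro!: derivative_eq_intros simp: algebra_simps)
    qed
    then show ?thesis using assms by simp
  qed
  have mono: "(f x)\<^sup>2 \<le> (f y)\<^sup>2" if "x0 \<le> x" "x \<le> y" for x y
  proof (rule deriv_mono[OF that(2)])
    fix s assume s: "x \<le> s" "s \<le> y"
    then show "0 \<le> 2 * (f s * f' s)" using prod that by simp
    show "((\<lambda>x. (f x)\<^sup>2) has_real_derivative 2 * (f s * f' s)) (at s)"
      by (auto intro!: derivative_eq_intros simp: algebra_simps power2_eq_square)
  qed
  have zero: "f x = 0" if "x0 \<le> x" for x
  proof (rule ccontr)
    assume "f x \<noteq> 0"
    then have "(f x)\<^sup>2 > 0" by simp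
    moreover have "((\<lambda>y. (f y)\<^sup>2) \<longlongrightarrow> 0) at_top" using tendsto_power[OF assms(2), of 2] by simp
    ultimately have "\<forall>\<^sub>F y in at_top. (f y)\<^sup>2 < (f x)\<^sup>2" by (rule order_tendstoD(2)[rotated])
    then have "\<forall>\<^sub>F y in at_top. y \<ge> x \<and> (f y)\<^sup>2 < (f x)\<^sup>2"
      using eventually_ge_at_top by (rule eventually_conj[rotated])
    then obtain y where "y \<ge> x" "(f y)\<^sup>2 < (f x)\<^sup>2"
      using eventually_happens trivial_limit_at_top_linorder by blast
    then show False using mono[of x y] that by simp
  qed
  have "f' (x0 + 1) = 0"
    by (rule DERIV_local_const[OF d(1)[of "x0 + 1"], of 1]) (auto intro!: zero[THEN trans] zero[symmetric])
  then show ?thesis using airy_ode_unique[OF assms(1), of "x0 + 1"] zero by simp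
qed

text \<open>Sturm comparison with \<open>sin\<close> on an interval of length \<open>\<pi>\<close> to the left of \<open>-1\<close>.\<close>

lemma airy_root_exists:
  assumes "airy_ode f f'"
  shows "\<exists>x. f x = 0"
proof (rule ccontr)
  assume no: "\<nexists>x. f x = 0"
  define a where "a = - 1 - pi"
  define g g' where "g x = sgn (f a) * f x" and "g' x = sgn (f a) * f' x" for x
  have d: "(f has_real_derivative f' x) (at x)" "(f' has_real_derivative x * f x) (at x)" for x
    using assms by (auto simp: airy_ode_def)
  have dg: "(g has_real_derivative g' x) (at x)" "(g' has_real_derivative x * g x) (at x)" for x
    unfolding g_def g'_def using d by (auto intro!: derivative_eq_intros)
  note [derivative_intros] = dg[THEN DERIV_chain2]
  have "f a \<noteq> 0" using no by blast
  then have ga: "g a > 0" unfolding g_def by (cases "f a > 0") (auto simp: sgn_if)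
  have gpos: "g x > 0" if "a \<le> x" for x
  proof (rule ccontr)
    assume "\<not> g x > 0"
    moreover have "isCont g y" for y using dg(1) DERIV_isCont by blast
    ultimately have "\<exists>y\<ge>a. y \<le> x \<and> g y = 0" using IVT2[of g x 0 a] ga that by simp
    then obtain y where "g y = 0" by blast
    then show False using no ga unfolding g_def by auto
  qed
  \<comment> \<open>Monotonicity of the Wronskian of \<open>g\<close> and
    \<open>sin (x - a)\<close>. At the two ends the sine vanishes and the cosine is \<open>1\<close>
    and \<open>-1\<close>, so \<open>g a\<close> and \<open>g (-1)\<close> cannot both be
    positive.\<close>
  have "g a * cos (a - a) - g' a * sin (a - a) \<le> g (-1) * cos (-1 - a) - g' (-1) * sin (-1 - a)"
  proof (rule deriv_mono[of a "-1"])
    fix x assume x: "a \<le> x" "x \<le> -1"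
    show "((\<lambda>x. g x * cos (x - a) - g' x * sin (x - a)) has_real_derivative
        (- 1 - x) * (g x * sin (x - a))) (at x)"
      by (auto intro!: derivative_eq_intros simp: algebra_simps)
    have "sin (x - a) \<ge> 0" using x by (intro sin_ge_zero) (auto simp: a_def)
    then show "0 \<le> (- 1 - x) * (g x * sin (x - a))"
      using gpos[of x] x by (intro mult_nonneg_nonneg) auto
  qed (simp add: a_def)
  then have "g a \<le> - g (-1)" by (simp add: a_def)
  then show False using ga gpos[of "-1"] by (simp add: a_def)
qed

lemma airy_pos_Ai: "\<exists>F F'. airy_pos F F' airy_a1"
proof -
  have sol: "airy_sol Ai" unfolding Ai_def using airy_sol_exists by (rule someI_ex)
  then obtain f' where ode: "airy_ode Ai f'" and lim: "(Ai \<longlongrightarrow> 0) at_top" and nz: "\<exists>x. Ai x \<noteq> 0"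
    unfolding airy_sol_def airy_ode_def by blast
  have d: "(Ai has_real_derivative f' x) (at x)" "(f' has_real_derivative x * Ai x) (at x)" for x
    using ode by (auto simp: airy_ode_def)
  have cont: "isCont Ai x" for x using d(1) DERIV_isCont by blast
  define S where "S = {x. Ai x = 0}"
  have neg: "x < 0" if "x \<in> S" for x
    using airy_no_root_nonneg[OF ode lim, of x] that nz by (force simp: S_def)
  have bdd: "bdd_above S" using neg by (intro bdd_aboveI[of _ 0]) (auto intro: less_imp_le)
  have "closed S" unfolding S_def
    using cont by (intro closed_Collect_eq continuous_at_imp_continuous_on) auto
  then have Sup: "Sup S \<in> S"
    using airy_root_exists[OF ode] bdd by (intro closed_contains_Sup) (auto simp: S_def)
  have a1: "airy_a1 = Sup S"
    unfolding airy_a1_def using Sup bdd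
    by (intro Greatest_equality) (auto simp: S_def intro: cSup_upper)
  have a1_root: "Ai airy_a1 = 0" and a1_neg: "airy_a1 < 0"
    using Sup neg unfolding a1 by (auto simp: S_def)
  have no: "Ai x \<noteq> 0" if "x > airy_a1" for x
    using cSup_upper[OF _ bdd, of x] that unfolding a1 by (auto simp: S_def)
  \<comment> \<open>The choice in \<open>Ai\<close> determines neither sign nor scale, so the
    solution is oriented to be positive to the right of its largest root.\<close>
  define \<sigma> where "\<sigma> = sgn (Ai 0)"
  have \<sigma>: "\<sigma> \<noteq> 0" "\<sigma> * Ai 0 > 0" using no[of 0] a1_neg by (auto simp: \<sigma>_def sgn_if)
  define F F' where "F x = \<sigma> * Ai x" and "F' x = \<sigma> * f' x" for x
  have ode': "airy_ode F F'"
    unfolding airy_ode_def F_def F'_def using d by (auto intro!: derivative_eq_intros)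
  have contF: "isCont F x" for x using ode' DERIV_isCont unfolding airy_ode_def by blast
  have pos: "F x > 0" if x: "x > airy_a1" for x
  proof (rule ccontr)
    assume "\<not> F x > 0"
    then have le: "F x \<le> 0" and F0: "F 0 \<ge> 0" using \<sigma> by (auto simp: F_def)
    have "\<exists>y > airy_a1. F y = 0"
    proof (cases "x \<le> 0")
      case True
      then have "\<exists>y\<ge>x. y \<le> 0 \<and> F y = 0" using IVT[of F x 0 0] le F0 contF by simp
      then show ?thesis using x by (meson less_le_trans)
    next
      case False
      then have "\<exists>y\<ge>0. y \<le> x \<and> F y = 0" using IVT2[of F x 0 0] le F0 contF by simp
      then show ?thesis using a1_neg by (meson less_le_trans)
    qed
    then show False using no \<sigma> by (auto simp: F_def)
  qed
  have F_root: "F airy_a1 = 0" by (simp add: F_def a1_root)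
  have "F' airy_a1 > 0"
  proof (rule ccontr)
    assume "\<not> F' airy_a1 > 0"
    moreover have "F' airy_a1 \<noteq> 0"
      using airy_ode_unique[OF ode' F_root] pos[of 0] a1_neg by force
    ultimately have "F' airy_a1 < 0" by simp
    moreover have "DERIV F airy_a1 :> F' airy_a1" using ode' by (auto simp: airy_ode_def)
    ultimately obtain e where "e > 0" "\<And>h. h > 0 \<Longrightarrow> h < e \<Longrightarrow> F (airy_a1 + h) < F airy_a1"
      using DERIV_neg_dec_right by blast
    from this(2)[of "e / 2"] this(1) pos[of "airy_a1 + e / 2"] F_root show False by simp
  qed
  moreover have "(F \<longlongrightarrow> 0) at_top"
    unfolding F_def using tendsto_mult_left[OF lim, of \<sigma>] by simp
  ultimately have "airy_pos F F' airy_a1"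
    using ode' F_root pos a1_neg by unfold_locales auto
  then show ?thesis by blast
qed

section \<open>Order calculus\<close>

definition hh :: "nat \<Rightarrow> real" where "hh n = real n powr (-1/3)"
definition xx :: "nat \<Rightarrow> nat \<Rightarrow> real" where "xx n M = real M * hh n"
text \<open>In this region a polynomial factor of degree up to \<open>D\<close> in
  \<open>1 + x\<close> costs at most one power of \<open>h\<close>. The condition
  \<open>M >= 1\<close> gives \<open>h <= x\<close>, which is used to trade \<open>h\<close> for
  \<open>x\<close> in front of \<open>F'\<close>.\<close>

definition rg :: "nat \<Rightarrow> nat \<Rightarrow> nat \<Rightarrow> bool" where
  "rg D n M \<longleftrightarrow> M \<ge> 1 \<and> (1 + xx n M) ^ D * hh n \<le> 1"

text \<open>The order calculus for expansions in \<open>h = n powr (-1/3)\<close> and \<open>x = M * h\<close>: polynomial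
  growth in \<open>x\<close> is ignored, and so are the points where \<open>x\<close> exceeds a small power of \<open>1 / h\<close>.\<close>

definition sw :: "(nat \<Rightarrow> nat \<Rightarrow> real) \<Rightarrow> nat \<Rightarrow> (nat \<Rightarrow> nat \<Rightarrow> real) \<Rightarrow> bool" where
  "sw G k f \<longleftrightarrow> (\<exists>C D. C \<ge> 0 \<and> (\<forall>\<^sub>F n in sequentially. \<forall>M. rg D n M \<longrightarrow>
      \<bar>f n M\<bar> \<le> C * hh n ^ k * (1 + xx n M) ^ D * \<bar>G n M\<bar>))"

abbreviation sm :: "nat \<Rightarrow> (nat \<Rightarrow> nat \<Rightarrow> real) \<Rightarrow> bool" where
  "sm \<equiv> sw (\<lambda>_ _. 1)"

lemma hh_pos: "n \<ge> 1 \<Longrightarrow> hh n > 0" by (simp add: hh_def)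
lemma hh_nonneg: "hh n \<ge> 0" by (simp add: hh_def)
lemma hh_le_1: "n \<ge> 1 \<Longrightarrow> hh n \<le> 1" using powr_mono[of "-1/3" 0 "real n"] by (simp add: hh_def)

lemma hh_cube: "n \<ge> 1 \<Longrightarrow> hh n ^ 3 = 1 / real n"
proof -
  assume n: "n \<ge> 1"
  have "hh n ^ 3 = hh n powr real 3" using hh_pos[OF n] by (intro powr_realpow[symmetric])
  also have "\<dots> = real n powr (-1)" by (simp add: hh_def powr_powr)
  finally show ?thesis using n by (simp add: powr_minus_divide)
qed

lemma xx_nonneg: "xx n M \<ge> 0" by (simp add: xx_def hh_nonneg)

lemma rg_mono:
  assumes "rg D n M" "D' \<le> D"
  shows "rg D' n M"
proof -
  have "(1 + xx n M) ^ D' * hh n \<le> (1 + xx n M) ^ D * hh n"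
    using assms(2) xx_nonneg[of n M] hh_nonneg by (intro mult_right_mono power_increasing) auto
  then show ?thesis using assms(1) by (auto simp: rg_def)
qed

lemma swI:
  assumes "C \<ge> 0" "\<And>n M. n \<ge> n0 \<Longrightarrow> n \<ge> 1 \<Longrightarrow> rg D n M \<Longrightarrow> \<bar>f n M\<bar> \<le> C * hh n ^ k * (1 + xx n M) ^ D * \<bar>G n M\<bar>"
  shows "sw G k f"
  unfolding sw_def eventually_sequentially using assms
  by (intro exI[of _ C] exI[of _ D] conjI exI[of _ "max n0 1"]) auto

text \<open>A larger exponent shrinks the region and weakens the bound, so estimates obtained with
  different exponents can be brought to a common one.\<close>

lemma swE:
  assumes "sw G k f"
  obtains C D n0 where "C \<ge> 0" "n0 \<ge> 1" "\<And>n M D'. n \<ge> n0 \<Longrightarrow> D' \<ge> D \<Longrightarrow> rg D' n M \<Longrightarrow>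
     \<bar>f n M\<bar> \<le> C * hh n ^ k * (1 + xx n M) ^ D' * \<bar>G n M\<bar>"
proof -
  obtain C D n0 where *: "C \<ge> 0" "\<And>n M. n \<ge> n0 \<Longrightarrow> rg D n M \<Longrightarrow>
     \<bar>f n M\<bar> \<le> C * hh n ^ k * (1 + xx n M) ^ D * \<bar>G n M\<bar>"
    using assms unfolding sw_def eventually_sequentially by blast
  show ?thesis
  proof (rule that[of C "max n0 1" D])
    fix n M D' assume a: "max n0 1 \<le> n" "D \<le> D'" "rg D' n M"
    have "\<bar>f n M\<bar> \<le> C * hh n ^ k * (1 + xx n M) ^ D * \<bar>G n M\<bar>"
      using * a rg_mono by auto
    also have "\<dots> \<le> C * hh n ^ k * (1 + xx n M) ^ D' * \<bar>G n M\<bar>"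
      using * a xx_nonneg[of n M] hh_nonneg[of n]
      by (intro mult_right_mono mult_left_mono power_increasing) auto
    finally show "\<bar>f n M\<bar> \<le> C * hh n ^ k * (1 + xx n M) ^ D' * \<bar>G n M\<bar>" .
  qed (use * in auto)
qed

lemma sw_add:
  assumes "sw G k f" "sw G k g"
  shows "sw G k (\<lambda>n M. f n M + g n M)"
proof -
  obtain C1 D1 n1 where 1: "C1 \<ge> 0" "\<And>n M D'. n \<ge> n1 \<Longrightarrow> D' \<ge> D1 \<Longrightarrow> rg D' n M \<Longrightarrow>
     \<bar>f n M\<bar> \<le> C1 * hh n ^ k * (1 + xx n M) ^ D' * \<bar>G n M\<bar>" using swE[OF assms(1)] by metis
  obtain C2 D2 n2 where 2: "C2 \<ge> 0" "\<And>n M D'. n \<ge> n2 \<Longrightarrow> D' \<ge> D2 \<Longrightarrow> rg D' n M \<Longrightarrow>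
     \<bar>g n M\<bar> \<le> C2 * hh n ^ k * (1 + xx n M) ^ D' * \<bar>G n M\<bar>" using swE[OF assms(2)] by metis
  show ?thesis
  proof (rule swI[of "C1 + C2" "max n1 n2" "max D1 D2"])
    fix n M assume a: "max n1 n2 \<le> n" "rg (max D1 D2) n M"
    have "\<bar>f n M + g n M\<bar> \<le> \<bar>f n M\<bar> + \<bar>g n M\<bar>" by (rule abs_triangle_ineq)
    also have "\<dots> \<le> C1 * hh n ^ k * (1 + xx n M) ^ max D1 D2 * \<bar>G n M\<bar> + C2 * hh n ^ k * (1 + xx n M) ^ max D1 D2 * \<bar>G n M\<bar>"
      using a by (intro add_mono 1 2) auto
    finally show "\<bar>f n M + g n M\<bar> \<le> (C1 + C2) * hh n ^ k * (1 + xx n M) ^ max D1 D2 * \<bar>G n M\<bar>"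
      by (simp add: algebra_simps)
  qed (use 1 2 in auto)
qed

lemma sw_mult:
  assumes "sw G k f" "sw G' l g"
  shows "sw (\<lambda>n M. G n M * G' n M) (k + l) (\<lambda>n M. f n M * g n M)"
proof -
  obtain C1 D1 n1 where 1: "C1 \<ge> 0" "\<And>n M D'. n \<ge> n1 \<Longrightarrow> D' \<ge> D1 \<Longrightarrow> rg D' n M \<Longrightarrow>
     \<bar>f n M\<bar> \<le> C1 * hh n ^ k * (1 + xx n M) ^ D' * \<bar>G n M\<bar>" using swE[OF assms(1)] by metis
  obtain C2 D2 n2 where 2: "C2 \<ge> 0" "\<And>n M D'. n \<ge> n2 \<Longrightarrow> D' \<ge> D2 \<Longrightarrow> rg D' n M \<Longrightarrow>
     \<bar>g n M\<bar> \<le> C2 * hh n ^ l * (1 + xx n M) ^ D' * \<bar>G' n M\<bar>" using swE[OF assms(2)] by metis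
  show ?thesis
  proof (rule swI[of "C1 * C2" "max n1 n2" "D1 + D2"])
    fix n M assume a: "max n1 n2 \<le> n" "rg (D1 + D2) n M"
    then have r: "rg D1 n M" "rg D2 n M" using rg_mono by auto
    have "\<bar>f n M * g n M\<bar> \<le> (C1 * hh n ^ k * (1 + xx n M) ^ D1 * \<bar>G n M\<bar>) * (C2 * hh n ^ l * (1 + xx n M) ^ D2 * \<bar>G' n M\<bar>)"
      unfolding abs_mult using a r 1(1) hh_nonneg xx_nonneg[of n M]
      by (intro mult_mono 1 2 mult_nonneg_nonneg) auto
    also have "\<dots> = C1 * C2 * hh n ^ (k + l) * (1 + xx n M) ^ (D1 + D2) * \<bar>G n M * G' n M\<bar>"
      by (simp add: power_add abs_mult algebra_simps)
    finally show "\<bar>f n M * g n M\<bar> \<le> C1 * C2 * hh n ^ (k + l) * (1 + xx n M) ^ (D1 + D2) * \<bar>G n M * G' n M\<bar>" .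
  qed (use 1 2 in auto)
qed

lemma sw_mono:
  assumes "sw G k f" "l \<le> k"
  shows "sw G l f"
proof -
  obtain C D n0 where *: "C \<ge> 0" "n0 \<ge> 1" "\<And>n M D'. n \<ge> n0 \<Longrightarrow> D' \<ge> D \<Longrightarrow> rg D' n M \<Longrightarrow>
     \<bar>f n M\<bar> \<le> C * hh n ^ k * (1 + xx n M) ^ D' * \<bar>G n M\<bar>" using swE[OF assms(1)] by metis
  show ?thesis
  proof (rule swI[of C n0 D])
    fix n M assume a: "n0 \<le> n" "rg D n M"
    have "hh n ^ k \<le> hh n ^ l" using hh_nonneg hh_le_1 a * assms(2)
      by (intro power_decreasing) auto
    then have "C * hh n ^ k * (1 + xx n M) ^ D * \<bar>G n M\<bar> \<le> C * hh n ^ l * (1 + xx n M) ^ D * \<bar>G n M\<bar>"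
      using * xx_nonneg[of n M] by (intro mult_right_mono mult_left_mono) auto
    then show "\<bar>f n M\<bar> \<le> C * hh n ^ l * (1 + xx n M) ^ D * \<bar>G n M\<bar>"
      using *(3)[of n D M] a by auto
  qed (use * in auto)
qed

lemma sw_bound:
  assumes "sw G k g" "\<And>n M. n \<ge> n1 \<Longrightarrow> rg E n M \<Longrightarrow> \<bar>f n M\<bar> \<le> \<bar>g n M\<bar>"
  shows "sw G k f"
proof -
  obtain C D n0 where *: "C \<ge> 0" "n0 \<ge> 1" "\<And>n M D'. n \<ge> n0 \<Longrightarrow> D' \<ge> D \<Longrightarrow> rg D' n M \<Longrightarrow>
     \<bar>g n M\<bar> \<le> C * hh n ^ k * (1 + xx n M) ^ D' * \<bar>G n M\<bar>" using swE[OF assms(1)] by metis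
  show ?thesis
  proof (rule swI[of C "max n0 n1" "max D E"])
    fix n M assume a: "max n0 n1 \<le> n" "rg (max D E) n M"
    then have "rg E n M" by (auto intro: rg_mono)
    then show "\<bar>f n M\<bar> \<le> C * hh n ^ k * (1 + xx n M) ^ max D E * \<bar>G n M\<bar>"
      using assms(2)[of n M] *(3)[of n "max D E" M] a by auto
  qed (use * in auto)
qed

lemma sw_cong:
  assumes "sw G k g" "\<And>n M. n \<ge> n1 \<Longrightarrow> rg E n M \<Longrightarrow> f n M = g n M"
  shows "sw G k f"
  using sw_bound[OF assms(1), of n1 E f] assms(2) by simp

lemma sm_mult: "sm k f \<Longrightarrow> sm l g \<Longrightarrow> sm (k + l) (\<lambda>n M. f n M * g n M)"
  using sw_mult[of "\<lambda>_ _. 1" k f "\<lambda>_ _. 1" l g] by simp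

lemma sm_sw_mult: "sm k f \<Longrightarrow> sw G l g \<Longrightarrow> sw G (k + l) (\<lambda>n M. f n M * g n M)"
  using sw_mult[of "\<lambda>_ _. 1" k f G l g] by simp

lemma sm_const: "sm 0 (\<lambda>n M. a)"
  by (rule swI[of "\<bar>a\<bar>" 0 0]) auto

lemma sm_h: "sm 1 (\<lambda>n M. hh n)"
  by (rule swI[of 1 0 0]) (auto simp: hh_nonneg)

lemma sm_x: "sm 0 (\<lambda>n M. xx n M)"
  by (rule swI[of 1 0 1]) (auto simp: xx_nonneg)

lemma sm_pow: "sm k f \<Longrightarrow> sm (p * k) (\<lambda>n M. f n M ^ p)"
proof (induction p)
  case 0
  then show ?case using sm_const[of 1] by simp
next
  case (Suc p)
  then show ?case using sm_mult[of k f "p * k" "\<lambda>n M. f n M ^ p"] by (simp add: add.commute)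
qed

lemma sm_hpow: "sm k (\<lambda>n M. hh n ^ k)"
  using sm_pow[OF sm_h, of k] by simp

lemma sw_uminus: "sw G k f \<Longrightarrow> sw G k (\<lambda>n M. - f n M)"
  by (rule sw_bound[of G k f 0 0]) auto

lemma sw_diff: "sw G k f \<Longrightarrow> sw G k g \<Longrightarrow> sw G k (\<lambda>n M. f n M - g n M)"
  using sw_add[OF _ sw_uminus, of G k f g] by simp

lemma sm0_h: "sm 0 (\<lambda>n M. hh n)" by (rule sw_mono[OF sm_h]) simp
lemma sm0_mult: "sm 0 f \<Longrightarrow> sm 0 g \<Longrightarrow> sm 0 (\<lambda>n M. f n M * g n M)" using sm_mult[of 0 f 0 g] by simp
lemma sm0_pow: "sm 0 f \<Longrightarrow> sm 0 (\<lambda>n M. f n M ^ p)" using sm_pow[of 0 f p] by simp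

lemmas sm0_intros = sw_add sw_diff sw_uminus sm0_mult sm0_pow sm0_h sm_x sm_const

lemma sm_approx_mult:
  assumes "sm k (\<lambda>n M. f n M - f' n M)" "sm l g" "sm k' (\<lambda>n M. g n M - g' n M)" "sm l' f'"
    "m \<le> k + l" "m \<le> l' + k'"
  shows "sm m (\<lambda>n M. f n M * g n M - f' n M * g' n M)"
proof -
  have "sm m (\<lambda>n M. (f n M - f' n M) * g n M + f' n M * (g n M - g' n M))"
    using sm_mult[OF assms(1,2)] sm_mult[OF assms(4,3)] assms(5,6) by (intro sw_add) (auto elim: sw_mono)
  then show ?thesis by (rule sw_cong[where ?n1.0 = 0 and E = 0]) (simp add: algebra_simps)
qed

lemma sm_of_approx: "sm k (\<lambda>n M. f n M - g n M) \<Longrightarrow> sm l g \<Longrightarrow> l \<le> k \<Longrightarrow> sm l f"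
proof -
  assume "sm k (\<lambda>n M. f n M - g n M)" "sm l g" "l \<le> k"
  then have "sm l (\<lambda>n M. (f n M - g n M) + g n M)" by (intro sw_add) (auto elim: sw_mono)
  then show ?thesis by simp
qed

lemma sm_div_h:
  assumes "sm (k + p) f"
  shows "sm k (\<lambda>n M. f n M / hh n ^ p)"
proof -
  obtain C D n0 where *: "C \<ge> 0" "n0 \<ge> 1" "\<And>n M D'. n \<ge> n0 \<Longrightarrow> D' \<ge> D \<Longrightarrow> rg D' n M \<Longrightarrow>
     \<bar>f n M\<bar> \<le> C * hh n ^ (k + p) * (1 + xx n M) ^ D' * \<bar>1\<bar>" using swE[OF assms] by metis
  show ?thesis
  proof (rule swI[of C n0 D])
    fix n M assume a: "n0 \<le> n" "1 \<le> n" "rg D n M"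
    have "\<bar>f n M\<bar> \<le> (C * hh n ^ k * (1 + xx n M) ^ D) * hh n ^ p"
      using *(3)[of n D M] a by (simp add: power_add mult_ac)
    then show "\<bar>f n M / hh n ^ p\<bar> \<le> C * hh n ^ k * (1 + xx n M) ^ D * \<bar>1\<bar>"
      using hh_pos[OF a(2)] by (simp add: abs_divide divide_le_eq)
  qed (use * in auto)
qed

text \<open>With the doubled exponent, half a power of \<open>h\<close> already pays for
  \<open>(1 + x) ^ D\<close>, and the other half remains as a small factor.\<close>

lemma rg_half:
  assumes "n \<ge> 1" "rg (2 * D) n M"
  shows "hh n * (1 + xx n M) ^ D \<le> sqrt (hh n)"
proof -
  have "((1 + xx n M) ^ D)\<^sup>2 * hh n \<le> 1" using assms(2) by (simp add: rg_def power_mult[symmetric] mult.commute)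
  then have "(hh n * (1 + xx n M) ^ D)\<^sup>2 \<le> hh n"
    using hh_nonneg[of n] mult_left_mono[of "((1 + xx n M) ^ D)\<^sup>2 * hh n" 1 "hh n"]
    by (simp add: power2_eq_square algebra_simps)
  then show ?thesis by (rule real_le_rsqrt)
qed

lemma hh_lim: "hh \<longlonglongrightarrow> 0" unfolding hh_def by real_asymp

lemma sm_small:
  assumes "sm 1 f" "\<epsilon> > 0"
  obtains D n0 where "\<And>n M. n \<ge> n0 \<Longrightarrow> rg D n M \<Longrightarrow> \<bar>f n M\<bar> \<le> \<epsilon>"
proof -
  obtain C D n1 where *: "C \<ge> 0" "n1 \<ge> 1" "\<And>n M D'. n \<ge> n1 \<Longrightarrow> D' \<ge> D \<Longrightarrow> rg D' n M \<Longrightarrow>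
     \<bar>f n M\<bar> \<le> C * hh n ^ 1 * (1 + xx n M) ^ D' * \<bar>1\<bar>" using swE[OF assms(1)] by metis
  have "(\<lambda>n. C * sqrt (hh n)) \<longlonglongrightarrow> C * sqrt 0" using hh_lim by (intro tendsto_intros)
  then have "\<forall>\<^sub>F n in sequentially. C * sqrt (hh n) < \<epsilon>" using assms(2) by (intro order_tendstoD(2)) auto
  then obtain n2 where n2: "\<And>n. n \<ge> n2 \<Longrightarrow> C * sqrt (hh n) < \<epsilon>" unfolding eventually_sequentially by blast
  show ?thesis
  proof (rule that[of "max n1 n2" "2 * D"])
    fix n M assume a: "max n1 n2 \<le> n" "rg (2 * D) n M"
    have "\<bar>f n M\<bar> \<le> C * (hh n * (1 + xx n M) ^ D)"
      using *(3)[of n D M] a rg_mono[of "2 * D" n M D] by (simp add: mult.assoc)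
    also have "\<dots> \<le> C * sqrt (hh n)" using rg_half[of n D M] a * by (intro mult_left_mono) auto
    also have "\<dots> \<le> \<epsilon>" using n2[of n] a by simp
    finally show "\<bar>f n M\<bar> \<le> \<epsilon>" .
  qed
qed

lemma eventually_swI:
  assumes "\<forall>\<^sub>F n in sequentially. \<bar>f n\<bar> \<le> C * hh n ^ k"
  shows "sm k (\<lambda>n M. f n)"
proof -
  obtain n0 where "\<And>n. n \<ge> n0 \<Longrightarrow> \<bar>f n\<bar> \<le> C * hh n ^ k"
    using assms unfolding eventually_sequentially by blast
  moreover have "C * hh n ^ k \<le> \<bar>C\<bar> * hh n ^ k" for n
    using hh_nonneg by (intro mult_right_mono) auto
  ultimately show ?thesis by (intro swI[of "\<bar>C\<bar>" n0 0]) (auto intro: order_trans)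
qed

text \<open>The derivative of \<open>n powr (-1/3)\<close> is \<open>- h ^ 4 / 3\<close>. The shifts
  are those of the recurrence: passing to \<open>(K, M - 1)\<close> or \<open>(K - 1, M + 1)\<close>
  lowers \<open>2 * K + M - 1\<close> by 1, passing to \<open>(K - 1, M - 1)\<close> lowers it by
  3.\<close>

lemma sm_hh_shift: "sm 7 (\<lambda>n M. hh (n - i) - hh n - real i / 3 * hh n ^ 4)"
  if "i = 1 \<or> i = 3"
proof -
  have "(\<lambda>n::nat. (real n - 1) powr (-1/3) - real n powr (-1/3) - 1 / 3 * (real n powr (-1/3)) ^ 4)
      \<in> O(\<lambda>n. (real n powr (-1/3)) ^ 7)" by real_asymp
  moreover have "(\<lambda>n::nat. (real n - 3) powr (-1/3) - real n powr (-1/3) - 3 / 3 * (real n powr (-1/3)) ^ 4)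
      \<in> O(\<lambda>n. (real n powr (-1/3)) ^ 7)" by real_asymp
  ultimately have "(\<lambda>n::nat. (real n - real i) powr (-1/3) - real n powr (-1/3) - real i / 3 * (real n powr (-1/3)) ^ 4)
      \<in> O(\<lambda>n. (real n powr (-1/3)) ^ 7)" using that by auto
  then obtain C where C: "\<forall>\<^sub>F n in sequentially. norm ((real n - real i) powr (-1/3) - real n powr (-1/3) - real i / 3 * (real n powr (-1/3)) ^ 4)
      \<le> C * norm ((real n powr (-1/3)) ^ 7)" by (elim landau_o.bigE)
  have "\<forall>\<^sub>F n in sequentially. \<bar>hh (n - i) - hh n - real i / 3 * hh n ^ 4\<bar> \<le> C * hh n ^ 7"
    using C eventually_ge_at_top[of i] by eventually_elim (simp add: hh_def of_nat_diff)
  then show ?thesis by (rule eventually_swI)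
qed

lemma sm_inverse_shift: "sm 6 (\<lambda>n M. 1 / real (n - i) - hh n ^ 3)" if "i = 1 \<or> i = 3"
proof -
  have "(\<lambda>n::nat. 1 / (real n - 1) - (real n powr (-1/3)) ^ 3) \<in> O(\<lambda>n. (real n powr (-1/3)) ^ 6)"
    by real_asymp
  moreover have "(\<lambda>n::nat. 1 / (real n - 3) - (real n powr (-1/3)) ^ 3) \<in> O(\<lambda>n. (real n powr (-1/3)) ^ 6)"
    by real_asymp
  ultimately have "(\<lambda>n::nat. 1 / (real n - real i) - (real n powr (-1/3)) ^ 3) \<in> O(\<lambda>n. (real n powr (-1/3)) ^ 6)"
    using that by auto
  then obtain C where C: "\<forall>\<^sub>F n in sequentially. norm (1 / (real n - real i) - (real n powr (-1/3)) ^ 3)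
      \<le> C * norm ((real n powr (-1/3)) ^ 6)" by (elim landau_o.bigE)
  have "\<forall>\<^sub>F n in sequentially. \<bar>1 / real (n - i) - hh n ^ 3\<bar> \<le> C * hh n ^ 6"
    using C eventually_ge_at_top[of i] by eventually_elim (simp add: hh_def of_nat_diff)
  then show ?thesis by (rule eventually_swI)
qed

section \<open>The defect of the Airy approximation\<close>

context airy_pos
begin

definition cc :: real where "cc = root 3 2"

lemma cc: "cc > 0" "cc ^ 3 = 2" "cc \<le> 2" "cc \<ge> 1"
proof -
  show c: "cc > 0" "cc ^ 3 = 2" by (auto simp: cc_def)
  show "cc \<le> 2" "cc \<ge> 1" using power_mono_iff[of cc 2 3] power_mono_iff[of 1 cc 3] c by auto
qed

text \<open>\<open>Y b\<close> is the ansatz for the solution; \<open>pf\<close>, \<open>tf\<close>, \<open>uf\<close>, \<open>Pf\<close>, \<open>Qf\<close> describe its shifts, where \<open>Pf\<close> and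
  \<open>Qf\<close> are the Taylor coefficients of \<open>F\<close> and \<open>F'\<close> obtained from \<open>F'' = z * F\<close>. The letters \<open>ph\<close>, \<open>th\<close>, \<open>uh\<close>, \<open>Ph\<close>, \<open>Qh\<close>
  stand for their truncated expansions in \<open>h\<close>.\<close>

definition Y :: "real \<Rightarrow> nat \<Rightarrow> real \<Rightarrow> real" where
  "Y b n m = (1 - 2/3 * m\<^sup>2 / real n + b * m / real n) * F (a1 + cc * m * hh n)"

definition pf :: "real \<Rightarrow> nat \<Rightarrow> real \<Rightarrow> nat \<Rightarrow> nat \<Rightarrow> real" where
  "pf b i j n M = 1 - 2/3 * (real M + j)\<^sup>2 / real (n - i) + b * (real M + j) / real (n - i)"

definition tf :: "nat \<Rightarrow> real \<Rightarrow> nat \<Rightarrow> nat \<Rightarrow> real" where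
  "tf i j n M = cc * ((real M + j) * hh (n - i) - real M * hh n)"

definition zf :: "nat \<Rightarrow> nat \<Rightarrow> real" where "zf n M = a1 + cc * xx n M"

definition uf :: "nat \<Rightarrow> nat \<Rightarrow> real" where
  "uf n M = real (n + 3 - M) / real (n + M - 1)"

definition Pf :: "nat \<Rightarrow> real \<Rightarrow> nat \<Rightarrow> nat \<Rightarrow> real" where
  "Pf i j n M = 1 + zf n M * (tf i j n M)\<^sup>2 / 2 + tf i j n M ^ 3 / 6"

definition Qf :: "nat \<Rightarrow> real \<Rightarrow> nat \<Rightarrow> nat \<Rightarrow> real" where
  "Qf i j n M = tf i j n M + zf n M * tf i j n M ^ 3 / 6 + tf i j n M ^ 4 / 12"

definition ph where "ph b j n M = 1 - 2/3 * xx n M ^ 2 * hh n + (b - 4/3 * j) * xx n M * hh n ^ 2 + (b * j - 2/3) * hh n ^ 3"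
definition th where "th i j n M = cc * (j * hh n + real i * (1/3) * xx n M * hh n ^ 3 + real i * (1/3) * j * hh n ^ 4)"
definition uh where "uh n M = 1 - 2 * xx n M * hh n ^ 2 + 4 * hh n ^ 3"
definition Ph where "Ph j n M = 1 + (cc ^ 2 * a1 * (1/2) + xx n M) * hh n ^ 2 + j * (1/3) * hh n ^ 3"
definition Qh where "Qh i j n M = th i j n M + zf n M * (j * (1/3)) * hh n ^ 3 + cc * (1/6) * hh n ^ 4"

lemma Y_shift: "Y b (n - i) (real M + j) = pf b i j n M * F (zf n M + tf i j n M)"
  by (simp add: Y_def pf_def zf_def tf_def xx_def algebra_simps)

lemma Y_0: "Y b n 0 = 0" by (simp add: Y_def F_root)

lemma sm_ph: "sm 0 (ph b j)"
  unfolding ph_def[abs_def] by (intro sm0_intros)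
lemma sm_uh: "sm 0 uh"
  unfolding uh_def[abs_def] by (intro sm0_intros)
lemma sm_Ph: "sm 0 (Ph j)"
  unfolding Ph_def[abs_def] by (intro sm0_intros)
lemma sm_zf: "sm 0 zf"
  unfolding zf_def[abs_def] by (intro sm0_intros)

lemma sm_th: "sm 1 (th i j)"
proof -
  have "sm (1 + 0) (\<lambda>n M. hh n * (cc * (j + real i * (1/3) * xx n M * hh n ^ 2 + real i * (1/3) * j * hh n ^ 3)))"
    by (intro sm_mult sm_h sm0_intros)
  then show ?thesis
    by (auto intro: sw_cong[where ?n1.0 = 0 and E = 0] simp: th_def algebra_simps eval_nat_numeral)
qed

text \<open>Replacing \<open>1 / (n - i)\<close> by \<open>h ^ 3\<close> costs \<open>h ^ 6\<close>,
  and the factor \<open>(M + j) ^ 2 = (x + j h) ^ 2 / h ^ 2\<close> gives two orders back.\<close>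

lemma sm_pf:
  assumes "i = 1 \<or> i = 3" "j = 1 \<or> j = - 1"
  shows "sm 4 (\<lambda>n M. pf b i j n M - ph b j n M)"
proof -
  have "sm 4 (\<lambda>n M. (1 / real (n - i) - hh n ^ 3) / hh n ^ 2)"
    by (rule sm_div_h) (use sm_inverse_shift[OF assms(1)] in simp)
  then have "sm (4 + 0) (\<lambda>n M. (1 / real (n - i) - hh n ^ 3) / hh n ^ 2 *
     ((- 2/3) * (xx n M + j * hh n) ^ 2 + b * (xx n M + j * hh n) * hh n))"
    by (intro sm_mult sm0_intros)
  then have "sm 4 (\<lambda>n M. (1 / real (n - i) - hh n ^ 3) / hh n ^ 2 *
     ((- 2/3) * (xx n M + j * hh n) ^ 2 + b * (xx n M + j * hh n) * hh n))" by simp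
  then show ?thesis
  proof (rule sw_cong[where ?n1.0 = 1 and E = 0])
    fix n M :: nat assume "1 \<le> n"
    then have h: "hh n \<noteq> 0" using hh_pos by force
    have j2: "j ^ 2 = 1" using assms(2) by auto
    have "(1 / real (n - i) - hh n ^ 3) / hh n ^ 2 *
         ((- 2/3) * (xx n M + j * hh n) ^ 2 + b * (xx n M + j * hh n) * hh n)
       = (1 / real (n - i) - hh n ^ 3) * ((- 2/3) * (real M + j) ^ 2 + b * (real M + j))"
      using h by (simp add: xx_def field_simps power2_eq_square)
    also have "\<dots> = (pf b i j n M - 1) - ((- 2/3) * (real M + j) ^ 2 + b * (real M + j)) * hh n ^ 3"
    proof -
      have "pf b i j n M = 1 - 2/3 * (real M + j)\<^sup>2 * (1 / real (n - i)) + b * (real M + j) * (1 / real (n - i))"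
        by (simp add: pf_def)
      then show ?thesis by algebra
    qed
    also have "((- 2/3) * (real M + j) ^ 2 + b * (real M + j)) * hh n ^ 3
        = (- 2/3) * (xx n M ^ 2 * hh n + 2 * j * xx n M * hh n ^ 2 + j ^ 2 * hh n ^ 3) + b * (xx n M * hh n ^ 2 + j * hh n ^ 3)"
      unfolding xx_def by algebra
    also have "(pf b i j n M - 1) - \<dots> = pf b i j n M - ph b j n M"
      unfolding j2 ph_def by algebra
    finally show "pf b i j n M - ph b j n M = (1 / real (n - i) - hh n ^ 3) / hh n ^ 2 *
     ((- 2/3) * (xx n M + j * hh n) ^ 2 + b * (xx n M + j * hh n) * hh n)" ..
  qed
qed

text \<open>The error of order \<open>h ^ 7\<close> in \<open>hh (n - i)\<close> is multiplied by
  \<open>M + j = (x + j h) / h\<close>.\<close>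

lemma sm_tf:
  assumes "i = 1 \<or> i = 3"
  shows "sm 5 (\<lambda>n M. tf i j n M - th i j n M)"
proof -
  have "sm 6 (\<lambda>n M. (hh (n - i) - hh n - real i / 3 * hh n ^ 4) / hh n ^ 1)"
    by (rule sm_div_h) (use sm_hh_shift[OF assms] in simp)
  then have "sm (6 + 0) (\<lambda>n M. (hh (n - i) - hh n - real i / 3 * hh n ^ 4) / hh n ^ 1 * (cc * (xx n M + j * hh n)))"
    by (intro sm_mult sm0_intros)
  then have "sm 5 (\<lambda>n M. (hh (n - i) - hh n - real i / 3 * hh n ^ 4) / hh n ^ 1 * (cc * (xx n M + j * hh n)))"
    by (rule sw_mono) simp
  then show ?thesis
  proof (rule sw_cong[where ?n1.0 = 1 and E = 0])
    fix n M :: nat assume "1 \<le> n"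
    then have h: "hh n \<noteq> 0" using hh_pos by force
    have "(hh (n - i) - hh n - real i / 3 * hh n ^ 4) / hh n ^ 1 * (cc * (xx n M + j * hh n))
      = (hh (n - i) - hh n - real i / 3 * hh n ^ 4) * (cc * (real M + j))"
      using h by (simp add: xx_def field_simps)
    also have "\<dots> = tf i j n M - th i j n M"
      by (simp add: tf_def th_def xx_def algebra_simps eval_nat_numeral)
    finally show "tf i j n M - th i j n M = (hh (n - i) - hh n - real i / 3 * hh n ^ 4) / hh n ^ 1 * (cc * (xx n M + j * hh n))" ..
  qed
qed

lemma sm_uf: "sm 4 (\<lambda>n M. uf n M - uh n M)"
proof -
  have "sm (4 + 0) (\<lambda>n M. hh n ^ 4 * ((2 * xx n M - 4 * hh n) * (xx n M - hh n)))"
    by (intro sm_mult sm_hpow sm0_intros)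
  then have "sm 4 (\<lambda>n M. hh n ^ 4 * ((2 * xx n M - 4 * hh n) * (xx n M - hh n)))" by simp
  then show ?thesis
  proof (rule sw_bound[where ?n1.0 = 1 and E = 3])
    fix n M :: nat assume n: "1 \<le> n" and r: "rg 3 n M"
    define h x where "h = hh n" and "x = xx n M"
    have h: "h > 0" "h \<le> 1" using hh_pos hh_le_1 n by (auto simp: h_def)
    have x0: "x \<ge> 0" by (simp add: x_def xx_nonneg)
    have h3: "h ^ 3 * real n = 1" using hh_cube[OF n] n by (simp add: h_def)
    have M1: "M \<ge> 1" using r by (simp add: rg_def)
    have Mx: "real M * h = x" by (simp add: x_def xx_def h_def)
    have "x * h \<le> 1"
    proof -
      have "x * 1 \<le> (1 + x) ^ 3" using x0 by (simp add: power3_eq_cube algebra_simps)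
      then have "x * h \<le> (1 + x) ^ 3 * h" using h by simp
      then show ?thesis using r by (simp add: rg_def x_def h_def)
    qed
    \<comment> \<open>This keeps the natural-number subtraction in \<open>uf\<close> from being
      truncated.\<close>
    have "M \<le> n"
    proof -
      have "real M * h ^ 3 = x * h * h" using Mx by (simp add: power3_eq_cube)
      also have "\<dots> \<le> 1 * 1" using \<open>x * h \<le> 1\<close> h x0 by (intro mult_mono) auto
      finally have "real M * h ^ 3 \<le> real n * h ^ 3" using h3 by (simp add: mult.commute)
      then show ?thesis using h by simp
    qed
    define w where "w = x * h ^ 2 - h ^ 3"
    have w: "w = (real M - 1) * h ^ 3" using Mx by (simp add: w_def algebra_simps eval_nat_numeral)
    then have w0: "w \<ge> 0" using M1 h by simp
    have "uf n M = (real n + 3 - real M) / (real n + real M - 1)"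
      using M1 n \<open>M \<le> n\<close> by (simp add: uf_def of_nat_diff)
    also have "\<dots> = ((real n + 3 - real M) * h ^ 3) / ((real n + real M - 1) * h ^ 3)" using h by simp
    also have "(real n + 3 - real M) * h ^ 3 = 1 - x * h ^ 2 + 3 * h ^ 3"
      using h3 Mx by (simp add: algebra_simps eval_nat_numeral)
    also have "(real n + real M - 1) * h ^ 3 = 1 + w"
      using h3 Mx by (simp add: w_def algebra_simps eval_nat_numeral)
    finally have u: "uf n M = (1 - x * h ^ 2 + 3 * h ^ 3) / (1 + w)" .
    have "uf n M - uh n M = (1 - x * h ^ 2 + 3 * h ^ 3 - (1 - 2 * x * h ^ 2 + 4 * h ^ 3) * (1 + w)) / (1 + w)"
      using w0 unfolding u uh_def x_def[symmetric] h_def[symmetric] by (simp add: field_simps)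
    also have "1 - x * h ^ 2 + 3 * h ^ 3 - (1 - 2 * x * h ^ 2 + 4 * h ^ 3) * (1 + w) = h ^ 4 * ((2 * x - 4 * h) * (x - h))"
      by (simp add: w_def algebra_simps eval_nat_numeral)
    finally have "\<bar>uf n M - uh n M\<bar> = \<bar>h ^ 4 * ((2 * x - 4 * h) * (x - h))\<bar> / (1 + w)"
      using w0 by (simp add: abs_divide)
    also have "\<dots> \<le> \<bar>h ^ 4 * ((2 * x - 4 * h) * (x - h))\<bar> / 1" using w0 by (intro divide_left_mono) auto
    finally show "\<bar>uf n M - uh n M\<bar> \<le> \<bar>hh n ^ 4 * ((2 * xx n M - 4 * hh n) * (xx n M - hh n))\<bar>"
      by (simp add: h_def x_def)
  qed
qed

context
  fixes i :: nat and j :: real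
  assumes i: "i = 1 \<or> i = 3" and j: "j = 1 \<or> j = - 1"
begin

lemma sm_t1: "sm 1 (tf i j)"
  using sm_of_approx[OF sm_tf[OF i] sm_th[of i j]] by simp

lemma sm_te: "sm 3 (\<lambda>n M. tf i j n M - cc * j * hh n)"
proof -
  have "sm (3 + 0) (\<lambda>n M. hh n ^ 3 * (cc * (real i * (1/3) * xx n M + real i * (1/3) * j * hh n)))"
    by (intro sm_mult sm_hpow sm0_intros)
  then have "sm 3 (\<lambda>n M. (tf i j n M - th i j n M) + hh n ^ 3 * (cc * (real i * (1/3) * xx n M + real i * (1/3) * j * hh n)))"
    using sw_mono[OF sm_tf[OF i], of 3] by (intro sw_add) auto
  then show ?thesis
    by (rule sw_cong[where ?n1.0 = 0 and E = 0]) (simp add: th_def algebra_simps eval_nat_numeral)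
qed

lemma sm_ch: "sm 1 (\<lambda>n M. cc * j * hh n)"
  using sm_mult[OF sm_const[of "cc * j"] sm_h] by simp

lemma sm_t2: "sm 4 (\<lambda>n M. (tf i j n M)\<^sup>2 - cc\<^sup>2 * (hh n)\<^sup>2)"
proof -
  have "sm (3 + 1) (\<lambda>n M. (tf i j n M - cc * j * hh n) * (tf i j n M + cc * j * hh n))"
    by (intro sm_mult sm_te sw_add sm_t1 sm_ch)
  then have "sm 4 (\<lambda>n M. (tf i j n M - cc * j * hh n) * (tf i j n M + cc * j * hh n))" by simp
  then show ?thesis
    by (rule sw_cong[where ?n1.0 = 0 and E = 0]) (use j in \<open>auto simp: algebra_simps power2_eq_square\<close>)
qed

lemma sm_t3: "sm 5 (\<lambda>n M. tf i j n M ^ 3 - 2 * j * hh n ^ 3)"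
proof -
  have "sm (3 + (1 + 1)) (\<lambda>n M. (tf i j n M - cc * j * hh n) *
     (tf i j n M * tf i j n M + tf i j n M * (cc * j * hh n) + (cc * j * hh n) * (cc * j * hh n)))"
    by (intro sm_mult[of 3] sw_add sm_mult[of 1 _ 1] sm_te sm_t1 sm_ch)
  then have "sm 5 (\<lambda>n M. (tf i j n M - cc * j * hh n) *
     (tf i j n M * tf i j n M + tf i j n M * (cc * j * hh n) + (cc * j * hh n) * (cc * j * hh n)))" by simp
  then show ?thesis
  proof (rule sw_cong[where ?n1.0 = 0 and E = 0])
    fix n M
    have "(tf i j n M - cc * j * hh n) *
     (tf i j n M * tf i j n M + tf i j n M * (cc * j * hh n) + (cc * j * hh n) * (cc * j * hh n))
      = tf i j n M ^ 3 - cc ^ 3 * j ^ 3 * hh n ^ 3"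
      by (simp add: algebra_simps eval_nat_numeral)
    also have "j ^ 3 = j" using j by auto
    finally show "tf i j n M ^ 3 - 2 * j * hh n ^ 3 = (tf i j n M - cc * j * hh n) *
     (tf i j n M * tf i j n M + tf i j n M * (cc * j * hh n) + (cc * j * hh n) * (cc * j * hh n))"
      using cc by simp
  qed
qed

lemma sm_t4: "sm 6 (\<lambda>n M. tf i j n M ^ 4 - 2 * cc * hh n ^ 4)"
proof -
  have "sm (4 + (2 + 0)) (\<lambda>n M. ((tf i j n M)\<^sup>2 - cc\<^sup>2 * (hh n)\<^sup>2) * ((tf i j n M)\<^sup>2 + (hh n)\<^sup>2 * cc\<^sup>2))"
    using sm_pow[OF sm_t1, of 2] sm_mult[OF sm_hpow[of 2] sm_const[of "cc\<^sup>2"]]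
    by (intro sm_mult[of 4] sm_t2 sw_add) auto
  then have "sm 6 (\<lambda>n M. ((tf i j n M)\<^sup>2 - cc\<^sup>2 * (hh n)\<^sup>2) * ((tf i j n M)\<^sup>2 + (hh n)\<^sup>2 * cc\<^sup>2))" by simp
  then show ?thesis
  proof (rule sw_cong[where ?n1.0 = 0 and E = 0])
    fix n M
    have "((tf i j n M)\<^sup>2 - cc\<^sup>2 * (hh n)\<^sup>2) * ((tf i j n M)\<^sup>2 + (hh n)\<^sup>2 * cc\<^sup>2)
      = tf i j n M ^ 4 - cc ^ 3 * cc * hh n ^ 4"
      by (simp add: algebra_simps eval_nat_numeral)
    then show "tf i j n M ^ 4 - 2 * cc * hh n ^ 4
       = ((tf i j n M)\<^sup>2 - cc\<^sup>2 * (hh n)\<^sup>2) * ((tf i j n M)\<^sup>2 + (hh n)\<^sup>2 * cc\<^sup>2)"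
      using cc by simp
  qed
qed

lemma sm_Pf: "sm 4 (\<lambda>n M. Pf i j n M - Ph j n M)"
proof -
  have "sm 4 (\<lambda>n M. ((tf i j n M)\<^sup>2 - cc\<^sup>2 * (hh n)\<^sup>2) * ((1/2) * zf n M) + (tf i j n M ^ 3 - 2 * j * hh n ^ 3) * (1/6))"
    using sm_mult[OF sm_t2 sm0_mult[OF sm_const[of "1/2"] sm_zf]]
      sw_mono[OF sm_mult[OF sm_t3 sm_const[of "1/6"]], of 4]
    by (intro sw_add) auto
  then show ?thesis
  proof (rule sw_cong[where ?n1.0 = 0 and E = 0])
    fix n M
    have "cc\<^sup>2 * zf n M = cc\<^sup>2 * a1 + cc ^ 3 * xx n M" by (simp add: zf_def algebra_simps eval_nat_numeral)
    then have z: "cc\<^sup>2 * zf n M = cc\<^sup>2 * a1 + 2 * xx n M" using cc by simp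
    have "Ph j n M = 1 + (cc\<^sup>2 * zf n M) * (1/2) * hh n ^ 2 + j * (1/3) * hh n ^ 3"
      unfolding z Ph_def by (simp add: algebra_simps)
    then show "Pf i j n M - Ph j n M = ((tf i j n M)\<^sup>2 - cc\<^sup>2 * (hh n)\<^sup>2) * ((1/2) * zf n M) + (tf i j n M ^ 3 - 2 * j * hh n ^ 3) * (1/6)"
      by (simp add: Pf_def algebra_simps)
  qed
qed

lemma sm_Qf: "sm 5 (\<lambda>n M. Qf i j n M - Qh i j n M)"
proof -
  have "sm 5 (\<lambda>n M. (tf i j n M - th i j n M) + (tf i j n M ^ 3 - 2 * j * hh n ^ 3) * ((1/6) * zf n M)
      + (tf i j n M ^ 4 - 2 * cc * hh n ^ 4) * (1/12))"
    using sm_tf[OF i] sm_mult[OF sm_t3 sm0_mult[OF sm_const[of "1/6"] sm_zf]]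
      sw_mono[OF sm_mult[OF sm_t4 sm_const[of "1/12"]], of 5]
    by (intro sw_add) auto
  then show ?thesis
    by (rule sw_cong[where ?n1.0 = 0 and E = 0]) (simp add: Qf_def Qh_def algebra_simps)
qed

lemma sm_Qf1: "sm 1 (Qf i j)"
proof -
  have "sm 1 (\<lambda>n M. tf i j n M + tf i j n M ^ 3 * ((1/6) * zf n M) + tf i j n M ^ 4 * (1/12))"
    using sm_t1 sw_mono[OF sm_mult[OF sm_pow[OF sm_t1, of 3] sm0_mult[OF sm_const[of "1/6"] sm_zf]], of 1]
      sw_mono[OF sm_mult[OF sm_pow[OF sm_t1, of 4] sm_const[of "1/12"]], of 1]
    by (intro sw_add) auto
  then show ?thesis by (rule sw_cong[where ?n1.0 = 0 and E = 0]) (simp add: Qf_def algebra_simps)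
qed

lemma sm_pf0: "sm 0 (pf b i j)"
  using sm_of_approx[OF sm_pf[OF i j] sm_ph] by simp

lemma sm_Pf0: "sm 0 (Pf i j)"
  using sm_of_approx[OF sm_Pf sm_Ph] by simp

lemma sm_pP: "sm 4 (\<lambda>n M. pf b i j n M * Pf i j n M - ph b j n M * Ph j n M)"
  by (rule sm_approx_mult[OF sm_pf[OF i j] sm_Pf0 sm_Pf sm_ph]) auto

lemma sm_pQ: "sm 5 (\<lambda>n M. pf b i j n M * Qf i j n M - ph b j n M * Qh i j n M)"
  by (rule sm_approx_mult[OF sm_pf[OF i j] sm_Qf1 sm_Qf sm_ph]) auto

end

lemma sm_uf0: "sm 0 uf"
  using sm_of_approx[OF sm_uf sm_uh] by simp

section \<open>Orders relative to \<open>F\<close>, the Taylor remainder, and cancellation in the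
  recurrence\<close>

abbreviation sF :: "nat \<Rightarrow> (nat \<Rightarrow> nat \<Rightarrow> real) \<Rightarrow> bool" where
  "sF \<equiv> sw (\<lambda>n M. F (zf n M))"

lemma zf_ge: "zf n M \<ge> a1" using cc xx_nonneg by (simp add: zf_def)
lemma Fz_nonneg: "F (zf n M) \<ge> 0" by (rule F_nonneg[OF zf_ge])

lemma sF_F: "sF 0 (\<lambda>n M. F (zf n M))"
  by (rule swI[of 1 0 0]) auto

text \<open>At \<open>a1\<close> the function \<open>F\<close> vanishes but \<open>F'\<close> does
  not. So \<open>F'\<close> can be compared with \<open>F\<close> only together with a factor
  \<open>x\<close>, or with \<open>h\<close>, which is at most \<open>x\<close> when
  \<open>M >= 1\<close>.\<close>

lemma sF_xF': "sF 0 (\<lambda>n M. xx n M * F' (zf n M))"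
proof -
  obtain C where C: "C > 0" "\<And>y. y \<ge> 0 \<Longrightarrow> y * \<bar>F' (a1 + y)\<bar> \<le> C * (1 + y)\<^sup>2 * F (a1 + y)"
    using F'_bound by blast
  show ?thesis
  proof (rule swI[of "4 * C" 0 2])
    fix n M
    define x where "x = xx n M"
    have x: "x \<ge> 0" by (simp add: x_def xx_nonneg)
    have "\<bar>x * F' (zf n M)\<bar> = x * \<bar>F' (zf n M)\<bar>" using x by (simp add: abs_mult)
    also have "\<dots> \<le> (cc * x) * \<bar>F' (zf n M)\<bar>"
      using mult_right_mono[OF cc(4) x] by (intro mult_right_mono) auto
    also have "\<dots> \<le> C * (1 + cc * x)\<^sup>2 * F (zf n M)"
      using C(2)[of "cc * x"] x cc by (simp add: zf_def x_def)
    also have "\<dots> \<le> C * (2 * (1 + x))\<^sup>2 * F (zf n M)"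
    proof -
      have "cc * x \<le> 2 * x" using cc x by (intro mult_right_mono) auto
      then have "(1 + cc * x)\<^sup>2 \<le> (2 * (1 + x))\<^sup>2" using x cc by (intro power_mono) auto
      then show ?thesis using C Fz_nonneg by (intro mult_right_mono mult_left_mono) auto
    qed
    finally show "\<bar>xx n M * F' (zf n M)\<bar> \<le> 4 * C * hh n ^ 0 * (1 + xx n M) ^ 2 * \<bar>F (zf n M)\<bar>"
      using Fz_nonneg by (simp add: x_def power2_eq_square algebra_simps)
  qed (use C in auto)
qed

lemma sF_hF': "sF 0 (\<lambda>n M. hh n * F' (zf n M))"
proof (rule sw_bound[OF sF_xF', of 0 0])
  fix n M assume "rg 0 n M"
  then have "1 * hh n \<le> real M * hh n" using hh_nonneg by (intro mult_right_mono) (auto simp: rg_def)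
  then show "\<bar>hh n * F' (zf n M)\<bar> \<le> \<bar>xx n M * F' (zf n M)\<bar>"
    using hh_nonneg unfolding abs_mult xx_def by (intro mult_right_mono) auto
qed

definition rem where "rem i j n M = F (zf n M + tf i j n M) - Pf i j n M * F (zf n M) - Qf i j n M * F' (zf n M)"

text \<open>The shift \<open>t\<close> has order \<open>h\<close>. The error term
  \<open>|t| ^ 5 |F'|\<close> of \<open>F_taylor\<close> is read as
  \<open>|t / h| ^ 5 h ^ 4 |h F'|\<close>, whose last factor is dominated by
  \<open>F\<close>.\<close>

lemma sF_rem:
  assumes i: "i = 1 \<or> i = 3" and j: "j = 1 \<or> j = - 1"
  shows "sF 4 (rem i j)"
proof -
  have "sm (1 + 0) (\<lambda>n M. tf i j n M * (2 + \<bar>zf n M\<bar>))"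
  proof (rule sm_mult[OF sm_t1[OF i j]])
    have "sm 0 (\<lambda>n M. \<bar>zf n M\<bar>)" by (rule sw_bound[OF sm_zf, of 0 0]) simp
    then show "sm 0 (\<lambda>n M. 2 + \<bar>zf n M\<bar>)" by (intro sw_add sm_const)
  qed
  then have s1: "sm 1 (\<lambda>n M. tf i j n M * (2 + \<bar>zf n M\<bar>))" by simp
  obtain D n0 where D: "\<And>n M. n \<ge> n0 \<Longrightarrow> rg D n M \<Longrightarrow> \<bar>tf i j n M * (2 + \<bar>zf n M\<bar>)\<bar> \<le> 1"
    by (rule sm_small[OF s1 zero_less_one], blast)
  have "sm 0 (\<lambda>n M. tf i j n M / hh n ^ 1)" by (rule sm_div_h) (use sm_t1[OF i j] in simp)
  then have \<tau>: "sm 0 (\<lambda>n M. \<bar>tf i j n M / hh n\<bar>)" by (rule sw_bound[of _ _ _ 0 0]) simp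
  have w: "sm 0 (\<lambda>n M. 1 + \<bar>zf n M\<bar>)"
  proof -
    have "sm 0 (\<lambda>n M. \<bar>zf n M\<bar>)" by (rule sw_bound[OF sm_zf, of 0 0]) simp
    then show ?thesis by (intro sw_add sm_const)
  qed
  have "sF (4 + 0) (\<lambda>n M. (1 + \<bar>zf n M\<bar>)\<^sup>2 * tf i j n M ^ 4 * F (zf n M))"
  proof (rule sm_sw_mult[OF _ sF_F])
    show "sm 4 (\<lambda>n M. (1 + \<bar>zf n M\<bar>)\<^sup>2 * tf i j n M ^ 4)"
      using sm_mult[OF sm0_pow[OF w, of 2] sm_pow[OF sm_t1[OF i j], of 4]] by simp
  qed
  moreover have "sF (4 + 0) (\<lambda>n M. (1 + \<bar>zf n M\<bar>)\<^sup>2 * \<bar>tf i j n M / hh n\<bar> ^ 5 * hh n ^ 4 * \<bar>hh n * F' (zf n M)\<bar>)"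
  proof (rule sm_sw_mult)
    show "sm 4 (\<lambda>n M. (1 + \<bar>zf n M\<bar>)\<^sup>2 * \<bar>tf i j n M / hh n\<bar> ^ 5 * hh n ^ 4)"
      using sm_mult[OF sm0_mult[OF sm0_pow[OF w, of 2] sm0_pow[OF \<tau>, of 5]] sm_hpow[of 4]] by simp
    show "sF 0 (\<lambda>n M. \<bar>hh n * F' (zf n M)\<bar>)" by (rule sw_bound[OF sF_hF', of 0 0]) simp
  qed
  ultimately have "sF 4 (\<lambda>n M. (1 + \<bar>zf n M\<bar>)\<^sup>2 * tf i j n M ^ 4 * F (zf n M)
      + (1 + \<bar>zf n M\<bar>)\<^sup>2 * \<bar>tf i j n M / hh n\<bar> ^ 5 * hh n ^ 4 * \<bar>hh n * F' (zf n M)\<bar>)"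
    by (intro sw_add) auto
  then show ?thesis
  proof (rule sw_bound[of _ _ _ "max n0 1" D])
    fix n M assume a: "max n0 1 \<le> n" "rg D n M"
    define z t where "z = zf n M" and "t = tf i j n M"
    have h: "hh n > 0" using hh_pos a by simp
    have "\<bar>t\<bar> * (2 + \<bar>z\<bar>) \<le> 1" using D[of n M] a by (simp add: abs_mult z_def t_def)
    then have "\<bar>rem i j n M\<bar> \<le> (1 + \<bar>z\<bar>)\<^sup>2 * (t ^ 4 * F z + \<bar>t\<bar> ^ 5 * \<bar>F' z\<bar>)"
      using F_taylor[of z t] zf_ge[of n M] unfolding rem_def Pf_def Qf_def z_def t_def by simp
    also have "\<bar>t\<bar> ^ 5 * \<bar>F' z\<bar> = \<bar>t / hh n\<bar> ^ 5 * hh n ^ 4 * \<bar>hh n * F' z\<bar>"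
      using h by (simp add: abs_mult power_divide field_simps eval_nat_numeral)
    also have "(1 + \<bar>z\<bar>)\<^sup>2 * (t ^ 4 * F z + \<bar>t / hh n\<bar> ^ 5 * hh n ^ 4 * \<bar>hh n * F' z\<bar>)
       = (1 + \<bar>z\<bar>)\<^sup>2 * t ^ 4 * F z + (1 + \<bar>z\<bar>)\<^sup>2 * \<bar>t / hh n\<bar> ^ 5 * hh n ^ 4 * \<bar>hh n * F' z\<bar>"
      by (simp add: algebra_simps)
    finally show "\<bar>rem i j n M\<bar> \<le> \<bar>(1 + \<bar>zf n M\<bar>)\<^sup>2 * tf i j n M ^ 4 * F (zf n M)
      + (1 + \<bar>zf n M\<bar>)\<^sup>2 * \<bar>tf i j n M / hh n\<bar> ^ 5 * hh n ^ 4 * \<bar>hh n * F' (zf n M)\<bar>\<bar>"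
      unfolding z_def t_def by linarith
  qed
qed

definition p0 where "p0 b n M = 1 - 2/3 * xx n M ^ 2 * hh n + b * xx n M * hh n ^ 2"
text \<open>The growth rate per unit of time that the quotients of \<open>gf\<close> follow up to
  order \<open>ef\<close>. Its coefficient of \<open>h ^ 2\<close> comes from
  \<open>F'' = z F\<close> at \<open>z = a1\<close>.\<close>

definition s0 where "s0 \<sigma> n = 2 + cc ^ 2 * a1 * hh n ^ 2 + \<sigma> * hh n ^ 3"

text \<open>\<open>kp\<close> is the coefficient of the negative term after division by the growth
  factor. Relaxed trees are the case \<open>\<theta> = 0\<close>, compacted trees the case
  \<open>\<theta> = 1\<close>.\<close>

context
  fixes \<theta> b \<sigma> :: real and kp :: "nat \<Rightarrow> nat \<Rightarrow> real"
  assumes kp: "sm 5 (\<lambda>n M. kp n M - \<theta> * (1/2) * hh n ^ 3)"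
    and b: "b = 11/6 - \<theta> * (1/4)" and \<sigma>: "\<sigma> = 8/3 - \<theta> * (1/2)"
begin

lemma sm_kph: "sm 3 (\<lambda>n M. \<theta> * (1/2) * hh n ^ 3)"
  using sm_mult[OF sm_const[of "\<theta> * (1/2)"] sm_hpow[of 3]] by simp

lemma sm_kp: "sm 3 kp"
  using sm_of_approx[OF kp sm_kph] by simp

lemma F_coeff:
  "sm 4 (\<lambda>n M. uf n M * (pf b 1 (-1) n M * Pf 1 (-1) n M) + pf b 1 1 n M * Pf 1 1 n M
      - kp n M * (pf b 3 (-1) n M * Pf 3 (-1) n M) - s0 \<sigma> n * p0 b n M)"
proof -
  have 1: "sm 4 (\<lambda>n M. uf n M * (pf b 1 (-1) n M * Pf 1 (-1) n M) - uh n M * (ph b (-1) n M * Ph (-1) n M))"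
    by (rule sm_approx_mult[OF sm_uf _ sm_pP sm_uh]) (auto intro!: sm0_mult sm_pf0 sm_Pf0)
  have 2: "sm 4 (\<lambda>n M. pf b 1 1 n M * Pf 1 1 n M - ph b 1 n M * Ph 1 n M)"
    by (rule sm_pP) auto
  have 3: "sm 4 (\<lambda>n M. kp n M * (pf b 3 (-1) n M * Pf 3 (-1) n M) - \<theta> * (1/2) * hh n ^ 3 * (ph b (-1) n M * Ph (-1) n M))"
    by (rule sm_approx_mult[OF kp sm0_mult[OF sm_pf0 sm_Pf0] sm_pP sm_kph]) auto
  have 4: "sm 4 (\<lambda>n M. uh n M * (ph b (-1) n M * Ph (-1) n M) + ph b 1 n M * Ph 1 n M
      - \<theta> * (1/2) * hh n ^ 3 * (ph b (-1) n M * Ph (-1) n M) - s0 \<sigma> n * p0 b n M)"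
  proof -
    define q where "q = cc ^ 2 * a1"
    \<comment> \<open>\<open>?P\<close> is what remains of the expansion after division by
      \<open>h ^ 4\<close>; it enters only through being polynomial in \<open>x\<close> and
      \<open>h\<close>. The content of the identity is that all lower orders cancel. At order
      \<open>h ^ 3\<close> and \<open>x = 0\<close>, \<open>uh\<close> gives 4, the two factors
      \<open>ph\<close> give \<open>-4/3\<close>, and the negative term gives
      \<open>- \<theta> / 2\<close>, whence \<open>\<sigma>\<close>.\<close>
    let ?P = "\<lambda>n M. (-1) * xx n M * q + (-50/9) * xx n M^2 + (4/3) * hh n * q + (-1/4) * hh n * q * \<theta> + (137/9) * hh n * xx n M + (-2) * hh n * xx n M * \<theta> + (2/3) * hh n * xx n M^3 * q + (4/3) * hh n * xx n M^4 + (-91/9) * hh n^2 + (9/4) * hh n^2 * \<theta> + (-1/8) * hh n^2 * \<theta>^2 + (-9/2) * hh n^2 * xx n M^2 * q + (5/12) * hh n^2 * xx n M^2 * q * \<theta> + (-85/9) * hh n^2 * xx n M^3 + (5/6) * hh n^2 * xx n M^3 * \<theta> + (53/6) * hh n^3 * xx n M * q + (-37/24) * hh n^3 * xx n M * q * \<theta> + (1/16) * hh n^3 * xx n M * q * \<theta>^2 + (62/3) * hh n^3 * xx n M^2 + (-121/36) * hh n^3 * xx n M^2 * \<theta> + (1/8) * hh n^3 * xx n M^2 * \<theta>^2 + (-5) * hh n^4 * q + (9/8) * hh n^4 * q * \<theta> + (-1/16) * hh n^4 * q * \<theta>^2 + (-143/9) * hh n^4 * xx n M + (59/18) * hh n^4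 * xx n M * \<theta> + (-1/6) * hh n^4 * xx n M * \<theta>^2 + (10/3) * hh n^5 + (-3/4) * hh n^5 * \<theta> + (1/24) * hh n^5 * \<theta>^2"
    have "sm (4 + 0) (\<lambda>n M. hh n ^ 4 * ?P n M)"
      by (intro sm_mult sm_hpow sm0_intros)
    then have "sm 4 (\<lambda>n M. hh n ^ 4 * ?P n M)" by simp
    then show ?thesis
    proof (rule sw_cong[where ?n1.0 = 0 and E = 0])
      fix n M
      show "uh n M * (ph b (-1) n M * Ph (-1) n M) + ph b 1 n M * Ph 1 n M
        - \<theta> * (1/2) * hh n ^ 3 * (ph b (-1) n M * Ph (-1) n M) - s0 \<sigma> n * p0 b n M =
        hh n ^ 4 * ?P n M"
        unfolding uh_def ph_def Ph_def s0_def p0_def q_def[symmetric]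
        unfolding b \<sigma>
        by algebra
    qed
  qed
  have "sm 4 (\<lambda>n M. (uf n M * (pf b 1 (-1) n M * Pf 1 (-1) n M) - uh n M * (ph b (-1) n M * Ph (-1) n M))
     + (pf b 1 1 n M * Pf 1 1 n M - ph b 1 n M * Ph 1 n M)
     - (kp n M * (pf b 3 (-1) n M * Pf 3 (-1) n M) - \<theta> * (1/2) * hh n ^ 3 * (ph b (-1) n M * Ph (-1) n M))
     + (uh n M * (ph b (-1) n M * Ph (-1) n M) + ph b 1 n M * Ph 1 n M
      - \<theta> * (1/2) * hh n ^ 3 * (ph b (-1) n M * Ph (-1) n M) - s0 \<sigma> n * p0 b n M))"
    by (intro sw_add sw_diff 1 2 3 4)
  then show ?thesis by (rule sw_cong[where ?n1.0 = 0 and E = 0]) simp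
qed

text \<open>At order \<open>x h ^ 3\<close> the drift of \<open>uh\<close> contributes
  \<open>2 cc\<close>, the motion of \<open>h\<close> in time \<open>2/3 cc\<close>, and the factor
  \<open>1 - 2/3 M^2 / n\<close> of the ansatz \<open>-8/3 cc\<close>; this is the origin of
  \<open>2/3\<close>. At \<open>x = 0\<close> the coefficient of \<open>cc h ^ 4\<close> is
  \<open>2 b - 4 + 1/3 + \<theta> / 2\<close>, which determines \<open>b\<close>. The rest of order
  \<open>h ^ 4\<close> has a factor \<open>x\<close>, as comparison with \<open>F\<close>
  requires.\<close>

lemma F'_coeff:
  "\<exists>R. sm 0 R \<and> sm 5 (\<lambda>n M. uf n M * (pf b 1 (-1) n M * Qf 1 (-1) n M) + pf b 1 1 n M * Qf 1 1 n M
      - kp n M * (pf b 3 (-1) n M * Qf 3 (-1) n M) - hh n ^ 4 * xx n M * R n M)"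
proof -
  let ?R = "\<lambda>n M. (-16/9) * xx n M^2 * cc"
  have 1: "sm 5 (\<lambda>n M. uf n M * (pf b 1 (-1) n M * Qf 1 (-1) n M) - uh n M * (ph b (-1) n M * Qh 1 (-1) n M))"
    by (rule sm_approx_mult[OF sm_uf sm_mult[OF sm_pf0 sm_Qf1] sm_pQ sm_uh]) auto
  have 2: "sm 5 (\<lambda>n M. pf b 1 1 n M * Qf 1 1 n M - ph b 1 n M * Qh 1 1 n M)"
    by (rule sm_pQ) auto
  have 3: "sm 5 (\<lambda>n M. kp n M * (pf b 3 (-1) n M * Qf 3 (-1) n M) - \<theta> * (1/2) * hh n ^ 3 * (ph b (-1) n M * Qh 3 (-1) n M))"
    by (rule sm_approx_mult[OF kp sm_mult[OF sm_pf0 sm_Qf1] sm_pQ sm_kph]) auto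
  have 4: "sm 5 (\<lambda>n M. uh n M * (ph b (-1) n M * Qh 1 (-1) n M) + ph b 1 n M * Qh 1 1 n M
      - \<theta> * (1/2) * hh n ^ 3 * (ph b (-1) n M * Qh 3 (-1) n M) - hh n ^ 4 * xx n M * ?R n M)"
  proof -
    let ?P = "\<lambda>n M. (-2/9) * xx n M * a1 + (82/9) * xx n M^2 * cc + (-1) * xx n M^2 * \<theta> * cc + (-1/9) * hh n * a1 + (-101/6) * hh n * xx n M * cc + (5/2) * hh n * xx n M * \<theta> * cc + (-1/8) * hh n * xx n M * \<theta>^2 * cc + (-4/9) * hh n * xx n M^3 * a1 + (31/3) * hh n^2 * cc + (-2) * hh n^2 * \<theta> * cc + (1/8) * hh n^2 * \<theta>^2 * cc + 3 * hh n^2 * xx n M^2 * a1 + (-5/18) * hh n^2 * xx n M^2 * \<theta> * a1 + (-2/9) * hh n^2 * xx n M^3 * cc + (2/9) * hh n^2 * xx n M^3 * \<theta> * cc + (-53/9) * hh n^3 * xx n M * a1 + (37/36) * hh n^3 * xx n M * \<theta> * a1 + (-1/24) * hh n^3 * xx n M * \<theta>^2 * a1 + (3/2) * hh n^3 * xx n M^2 * cc + (-17/12) * hh n^3 * xx n M^2 * \<theta> * cc + (1/12) * hh n^3 * xx n M^2 * \<theta>^2 * cc + (10/3) * hh n^4 * a1 + (-3/4) * hh n^4 * \<theta> * a1 + (1/24) * hh n^4 * \<theta>^2 * a1 + (-53/18) * hh n^4 * xx n M * cc + (173/72) * hh n^4 * xx n M * \<theta> * cc + (-3/16) * hh n^4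 * xx n M * \<theta>^2 * cc + (5/3) * hh n^5 * cc + (-29/24) * hh n^5 * \<theta> * cc + (5/48) * hh n^5 * \<theta>^2 * cc"
    have "sm (5 + 0) (\<lambda>n M. hh n ^ 5 * ?P n M)"
      by (intro sm_mult sm_hpow sm0_intros)
    then have "sm 5 (\<lambda>n M. hh n ^ 5 * ?P n M)" by simp
    then show ?thesis
    proof (rule sw_cong[where ?n1.0 = 0 and E = 0])
      fix n M
      show "uh n M * (ph b (-1) n M * Qh 1 (-1) n M) + ph b 1 n M * Qh 1 1 n M
      - \<theta> * (1/2) * hh n ^ 3 * (ph b (-1) n M * Qh 3 (-1) n M) - hh n ^ 4 * xx n M * ?R n M =
        hh n ^ 5 * ?P n M"
        unfolding uh_def ph_def Qh_def th_def zf_def b of_nat_1 of_nat_numeral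
        by algebra
    qed
  qed
  have "sm 5 (\<lambda>n M. (uf n M * (pf b 1 (-1) n M * Qf 1 (-1) n M) - uh n M * (ph b (-1) n M * Qh 1 (-1) n M))
     + (pf b 1 1 n M * Qf 1 1 n M - ph b 1 n M * Qh 1 1 n M)
     - (kp n M * (pf b 3 (-1) n M * Qf 3 (-1) n M) - \<theta> * (1/2) * hh n ^ 3 * (ph b (-1) n M * Qh 3 (-1) n M))
     + (uh n M * (ph b (-1) n M * Qh 1 (-1) n M) + ph b 1 n M * Qh 1 1 n M
      - \<theta> * (1/2) * hh n ^ 3 * (ph b (-1) n M * Qh 3 (-1) n M) - hh n ^ 4 * xx n M * ?R n M))"
    by (intro sw_add sw_diff 1 2 3 4)
  then have "sm 5 (\<lambda>n M. uf n M * (pf b 1 (-1) n M * Qf 1 (-1) n M) + pf b 1 1 n M * Qf 1 1 n M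
      - kp n M * (pf b 3 (-1) n M * Qf 3 (-1) n M) - hh n ^ 4 * xx n M * ?R n M)"
    by (rule sw_cong[where ?n1.0 = 0 and E = 0]) simp
  moreover have "sm 0 ?R" by (intro sm0_intros)
  ultimately show ?thesis by blast
qed

text \<open>The choices of \<open>b\<close> and \<open>\<sigma>\<close> cancel the terms of order \<open>h ^ 3 * F\<close> and, at \<open>x = 0\<close>,
  \<open>h ^ 4 * F'\<close>; the latter would not be dominated by \<open>F\<close>, which vanishes there.\<close>

lemma defect:
  "sF 4 (\<lambda>n M. uf n M * Y b (n - 1) (real M - 1) + Y b (n - 1) (real M + 1)
      - kp n M * Y b (n - 3) (real M - 1) - s0 \<sigma> n * Y b n (real M))"
proof -
  define A where "A n M = uf n M * (pf b 1 (-1) n M * Pf 1 (-1) n M) + pf b 1 1 n M * Pf 1 1 n M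
      - kp n M * (pf b 3 (-1) n M * Pf 3 (-1) n M) - s0 \<sigma> n * p0 b n M" for n M
  define B where "B n M = uf n M * (pf b 1 (-1) n M * Qf 1 (-1) n M) + pf b 1 1 n M * Qf 1 1 n M
      - kp n M * (pf b 3 (-1) n M * Qf 3 (-1) n M)" for n M
  obtain R where R: "sm 0 R" "sm 5 (\<lambda>n M. B n M - hh n ^ 4 * xx n M * R n M)"
    using F'_coeff unfolding B_def by blast
  have 1: "sF 4 (\<lambda>n M. A n M * F (zf n M))"
    using sm_sw_mult[OF F_coeff sF_F] unfolding A_def by simp
  have 2: "sF 4 (\<lambda>n M. B n M * F' (zf n M))"
  proof -
    have "sm 4 (\<lambda>n M. (B n M - hh n ^ 4 * xx n M * R n M) / hh n ^ 1)"
      by (rule sm_div_h) (use R in simp)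
    then have "sF (4 + 0) (\<lambda>n M. (B n M - hh n ^ 4 * xx n M * R n M) / hh n ^ 1 * (hh n * F' (zf n M)))"
      by (intro sm_sw_mult sF_hF')
    moreover have "sF (4 + 0) (\<lambda>n M. hh n ^ 4 * R n M * (xx n M * F' (zf n M)))"
      using sm_mult[OF sm_hpow[of 4] R(1)] by (intro sm_sw_mult sF_xF') simp
    ultimately have "sF 4 (\<lambda>n M. (B n M - hh n ^ 4 * xx n M * R n M) / hh n ^ 1 * (hh n * F' (zf n M))
        + hh n ^ 4 * R n M * (xx n M * F' (zf n M)))" by (intro sw_add) auto
    then show ?thesis
    proof (rule sw_cong[where ?n1.0 = 1 and E = 0])
      fix n M :: nat assume "1 \<le> n"
      then show "B n M * F' (zf n M) = (B n M - hh n ^ 4 * xx n M * R n M) / hh n ^ 1 * (hh n * F' (zf n M))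
        + hh n ^ 4 * R n M * (xx n M * F' (zf n M))"
        using hh_pos[of n] by (simp add: field_simps)
    qed
  qed
  have r: "sF 4 (\<lambda>n M. f n M * (pf b i j n M * rem i j n M))"
    if "i = 1 \<or> i = 3" "j = 1 \<or> j = - 1" "sm 0 f" for f i j
    using sm_sw_mult[OF sm0_mult[OF that(3) sm_pf0[OF that(1,2)]] sF_rem[OF that(1,2)]]
    by (simp add: mult.assoc)
  have 3: "sF 4 (\<lambda>n M. uf n M * (pf b 1 (-1) n M * rem 1 (-1) n M))"
    "sF 4 (\<lambda>n M. 1 * (pf b 1 1 n M * rem 1 1 n M))"
    "sF 4 (\<lambda>n M. kp n M * (pf b 3 (-1) n M * rem 3 (-1) n M))"
    using sw_mono[OF sm_kp] by (intro r sm_uf0 sm_const; simp)+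
  have "sF 4 (\<lambda>n M. A n M * F (zf n M) + B n M * F' (zf n M) + uf n M * (pf b 1 (-1) n M * rem 1 (-1) n M)
      + 1 * (pf b 1 1 n M * rem 1 1 n M) - kp n M * (pf b 3 (-1) n M * rem 3 (-1) n M))"
    by (intro sw_add sw_diff 1 2 3)
  then show ?thesis
  proof (rule sw_cong[where ?n1.0 = 1 and E = 0])
    fix n M :: nat assume n: "1 \<le> n"
    have y: "Y b (n - i) (real M + j) = pf b i j n M * (Pf i j n M * F (zf n M) + Qf i j n M * F' (zf n M) + rem i j n M)" for i j
      unfolding Y_shift rem_def by simp
    have inv: "a / real n = a * hh n ^ 3" for a using hh_cube[OF n] by simp
    have y0: "Y b n (real M) = p0 b n M * F (zf n M)"
      unfolding Y_def inv p0_def zf_def xx_def by (simp add: power2_eq_square power3_eq_cube algebra_simps)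
    have y1: "Y b (n - 1) (real M - 1) = pf b 1 (-1) n M * (Pf 1 (-1) n M * F (zf n M) + Qf 1 (-1) n M * F' (zf n M) + rem 1 (-1) n M)"
      and y2: "Y b (n - 3) (real M - 1) = pf b 3 (-1) n M * (Pf 3 (-1) n M * F (zf n M) + Qf 3 (-1) n M * F' (zf n M) + rem 3 (-1) n M)"
      using y[of 1 "-1"] y[of 3 "-1"] by simp_all
    show "uf n M * Y b (n - 1) (real M - 1) + Y b (n - 1) (real M + 1)
      - kp n M * Y b (n - 3) (real M - 1) - s0 \<sigma> n * Y b n (real M)
      = A n M * F (zf n M) + B n M * F' (zf n M) + uf n M * (pf b 1 (-1) n M * rem 1 (-1) n M)
      + 1 * (pf b 1 1 n M * rem 1 1 n M) - kp n M * (pf b 3 (-1) n M * rem 3 (-1) n M)"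
      unfolding y1 y2 y[of 1 1] y0 A_def B_def by algebra
  qed
qed

end

end

section \<open>Sub- and supersolutions\<close>

lemma one_plus_power_le_exp:
  assumes "y \<ge> 0"
  shows "(1 + y) ^ K \<le> real K ^ K * exp y" 
proof (cases "K = 0")
  case False
  have "(1 + y) ^ K \<le> (real K * (1 + y / real K)) ^ K"
    using assms False by (intro power_mono) (auto simp: field_simps)
  also have "\<dots> = real K ^ K * (1 + y / real K) ^ K" by (simp add: power_mult_distrib)
  also have "\<dots> \<le> real K ^ K * exp y"
    using exp_ge_one_plus_x_over_n_power_n[of K y] assms False by (intro mult_left_mono) auto
  finally show ?thesis .
qed (use assms in simp)

lemma abs_combo:
  fixes a b c d e :: real
  assumes "\<bar>a\<bar> \<le> A" "\<bar>b\<bar> \<le> B" "\<bar>c\<bar> \<le> C" "\<bar>d\<bar> \<le> D" "\<bar>e\<bar> \<le> E"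
  shows "\<bar>a + b - c - d\<bar> - e \<le> A + B + C + D + E"
  using assms by linarith

text \<open>A function constant in \<open>M\<close> is multiplied by \<open>uf + 1\<close> in one
  step, which for \<open>x >= X\<close> is at most \<open>2 - X h ^ 2 + 4 h ^ 3\<close>, below
  \<open>s0\<close> once \<open>X\<close> is large. The size \<open>h ^ 6\<close> lies far below
  \<open>F\<close> at \<open>M = 1\<close>, which has order \<open>h\<close>, and above the tail of
  \<open>Y\<close> for very large \<open>x\<close>.\<close>

definition Zf :: "nat \<Rightarrow> real" where "Zf n = 1 / (real n)\<^sup>2"
text \<open>This is \<open>n powr (-13/12)\<close>: larger than the defect order
  \<open>h ^ 4\<close>, yet summable, so that the factor \<open>exp (\<zeta> n powr (-1/12))\<close>
  realising it in \<open>gf\<close> stays bounded.\<close>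

definition ef :: "nat \<Rightarrow> real" where "ef n = hh n ^ 3 * sqrt (sqrt (hh n))"

lemma Zf_eq: "n \<ge> 1 \<Longrightarrow> Zf n = hh n ^ 6"
proof -
  assume "n \<ge> 1"
  then have "(hh n ^ 3) ^ 2 = (1 / real n) ^ 2" by (simp add: hh_cube)
  then show ?thesis by (simp add: Zf_def power_one_over flip: power_mult)
qed

lemma ef_nonneg: "ef n \<ge> 0" by (simp add: ef_def hh_nonneg)
lemma Zf_nonneg: "Zf n \<ge> 0" by (simp add: Zf_def)

lemma hh_antimono: "1 \<le> m \<Longrightarrow> m \<le> n \<Longrightarrow> hh n \<le> hh m"
  by (simp add: hh_def powr_mono2')

lemma hh_eventually_le: "\<epsilon> > 0 \<Longrightarrow> \<forall>\<^sub>F n in sequentially. C * hh n \<le> \<epsilon>"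
proof -
  assume "\<epsilon> > 0"
  moreover have "(\<lambda>n. C * hh n) \<longlonglongrightarrow> C * 0" using hh_lim by (intro tendsto_intros)
  ultimately have "\<forall>\<^sub>F n in sequentially. C * hh n < \<epsilon>" by (intro order_tendstoD(2)) auto
  then show ?thesis by (rule eventually_mono) simp
qed

lemma hh4_eventually_le: "\<epsilon> > 0 \<Longrightarrow> \<forall>\<^sub>F n in sequentially. C * sqrt (sqrt (hh n)) \<le> \<epsilon>"
proof -
  assume "\<epsilon> > 0"
  moreover have "(\<lambda>n. C * sqrt (sqrt (hh n))) \<longlonglongrightarrow> C * sqrt (sqrt 0)" using hh_lim by (intro tendsto_intros)
  ultimately have "\<forall>\<^sub>F n in sequentially. C * sqrt (sqrt (hh n)) < \<epsilon>" by (intro order_tendstoD(2)) auto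
  then show ?thesis by (rule eventually_mono) simp
qed

text \<open>The relative change of \<open>Zf\<close> in one time step is only of order
  \<open>h ^ 3\<close>, so at order \<open>h ^ 2\<close> the gain is that of the rate,
  \<open>q\<close>, plus that of the drift, \<open>X\<close>.\<close>

lemma slack_lim:
  fixes q \<sigma> X :: real
  shows "(\<lambda>n. ((2 + q * hh n ^ 2 + \<sigma> * hh n ^ 3 - 3 * ef n) * Zf n - (2 - X * hh n ^ 2 + 4 * hh n ^ 3) * Zf (n - 1)) / (Zf n * hh n ^ 2)) \<longlonglongrightarrow> q + X"
proof -
  have "(\<lambda>n::nat. ((2 + q * (real n powr (-1/3)) ^ 2 + \<sigma> * (real n powr (-1/3)) ^ 3
        - 3 * ((real n powr (-1/3)) ^ 3 * sqrt (sqrt (real n powr (-1/3))))) * (1 / (real n)\<^sup>2)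
      - (2 - X * (real n powr (-1/3)) ^ 2 + 4 * (real n powr (-1/3)) ^ 3) * (1 / (real n - 1)\<^sup>2)) / (1 / (real n)\<^sup>2 * (real n powr (-1/3)) ^ 2))
      \<longlonglongrightarrow> q + X"
    by real_asymp
  moreover have "\<forall>\<^sub>F n in sequentially. ((2 + q * (real n powr (-1/3)) ^ 2 + \<sigma> * (real n powr (-1/3)) ^ 3
        - 3 * ((real n powr (-1/3)) ^ 3 * sqrt (sqrt (real n powr (-1/3))))) * (1 / (real n)\<^sup>2)
      - (2 - X * (real n powr (-1/3)) ^ 2 + 4 * (real n powr (-1/3)) ^ 3) * (1 / (real n - 1)\<^sup>2)) / (1 / (real n)\<^sup>2 * (real n powr (-1/3)) ^ 2)
     = ((2 + q * hh n ^ 2 + \<sigma> * hh n ^ 3 - 3 * ef n) * Zf n - (2 - X * hh n ^ 2 + 4 * hh n ^ 3) * Zf (n - 1)) / (Zf n * hh n ^ 2)"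
    using eventually_ge_at_top[of 1]
    by eventually_elim (simp add: hh_def ef_def Zf_def of_nat_diff)
  ultimately show ?thesis by (rule Lim_transform_eventually)
qed

context airy_pos
begin

lemma uf_nonneg: "uf n M \<ge> 0" by (simp add: uf_def)

lemma uf_le:
  assumes n: "n \<ge> 1" and M: "M \<ge> 1" and X: "X \<le> xx n M" "X * hh n ^ 2 \<le> 1"
  shows "uf n M \<le> 1 - X * hh n ^ 2 + 4 * hh n ^ 3"
proof (cases "M \<le> n + 1")
  case True
  have h: "hh n > 0" using hh_pos n by simp
  have h3: "hh n ^ 3 = 1 / real n" using hh_cube n by simp
  have "X * hh n ^ 2 \<le> xx n M * hh n ^ 2" using X by (intro mult_right_mono) auto
  also have "\<dots> = real M * hh n ^ 3" by (simp add: xx_def eval_nat_numeral)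
  finally have X': "X * hh n ^ 2 \<le> real M / real n" by (simp add: h3)
  have "(real M - 4) * (real n + real M - 1) \<le> (2 * real M - 4) * real n"
  proof -
    have "real M * 4 \<le> real M * (real n + 5 - real M)" using True by (intro mult_left_mono) auto
    then have "0 \<le> real M * (real n + 5 - real M) - 4" using M by linarith
    also have "\<dots> = (2 * real M - 4) * real n - (real M - 4) * (real n + real M - 1)" by (simp add: algebra_simps)
    finally show ?thesis by simp
  qed
  then have "(real M - 4) / real n \<le> (2 * real M - 4) / (real n + real M - 1)"
    using n M by (simp add: field_simps)
  moreover have "uf n M = 1 - (2 * real M - 4) / (real n + real M - 1)"
    using True M n by (simp add: uf_def of_nat_diff field_simps)
  ultimately have "uf n M \<le> 1 - (real M - 4) / real n" by simp
  also have "\<dots> = 1 - real M / real n + 4 * hh n ^ 3" by (simp add: h3 diff_divide_distrib)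
  finally show ?thesis using X' by linarith
next
  case False
  \<comment> \<open>Here the numerator \<open>n + 3 - M\<close> is 0 or 1.\<close>
  have "uf n M \<le> 1 / real n"
    unfolding uf_def using False n by (intro frac_le) auto
  also have "\<dots> \<le> 4 * hh n ^ 3" using hh_cube[of n] n by (simp add: divide_right_mono)
  finally show ?thesis using X by linarith
qed

text \<open>The exponential decay of \<open>F\<close> beats \<open>K + 2\<close> powers of
  \<open>1 + m h\<close>, two of which come from the polynomial factor of \<open>Y\<close>.\<close>

lemma Y_bound: "\<exists>C\<ge>0. \<forall>n\<ge>1. \<forall>m\<ge>0. \<bar>Y b n m\<bar> * (1 + m * hh n) ^ K \<le> C"
proof -
  obtain C where C: "C > 0" "\<And>y. y \<ge> 0 \<Longrightarrow> F (a1 + y) \<le> C * exp (- y)" using F_exp_decay by blast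
  define A where "A = (1 + \<bar>b\<bar>) * C * real (K + 2) ^ (K + 2)"
  have "\<bar>Y b n m\<bar> * (1 + m * hh n) ^ K \<le> A" if n: "n \<ge> 1" and m: "m \<ge> 0" for n m
  proof -
    define y where "y = m * hh n"
    have h: "hh n > 0" "hh n \<le> 1" using hh_pos hh_le_1 n by auto
    have y: "y \<ge> 0" using m h by (simp add: y_def)
    have inv: "a / real n = a * hh n ^ 3" for a using hh_cube[OF n] by simp
    have "1 - 2/3 * m\<^sup>2 / real n + b * m / real n = 1 - 2/3 * (y\<^sup>2 * hh n) + b * (y * hh n ^ 2)"
      unfolding inv y_def by (simp add: power2_eq_square power3_eq_cube algebra_simps)
    also have "\<bar>\<dots>\<bar> \<le> 1 + y\<^sup>2 + \<bar>b\<bar> * y"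
    proof -
      have "y\<^sup>2 * hh n \<le> y\<^sup>2 * 1" using h by (intro mult_left_mono) auto
      moreover have "hh n ^ 2 \<le> 1" using h by (simp add: power_le_one)
      then have "y * hh n ^ 2 \<le> y * 1" using y by (intro mult_left_mono) auto
      then have "\<bar>b * (y * hh n ^ 2)\<bar> \<le> \<bar>b\<bar> * y" using y h unfolding abs_mult by (intro mult_left_mono) auto
      moreover have "y\<^sup>2 * hh n \<ge> 0" using h by simp
      ultimately show ?thesis by linarith
    qed
    also have "\<dots> \<le> (1 + \<bar>b\<bar>) * (1 + y)\<^sup>2"
    proof -
      have "(1 + \<bar>b\<bar>) * (1 + y)\<^sup>2 = 1 + y\<^sup>2 + \<bar>b\<bar> * y + (2 * y + \<bar>b\<bar> * (1 + y + y\<^sup>2))"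
        by (simp add: power2_eq_square algebra_simps)
      moreover have "0 \<le> 2 * y + \<bar>b\<bar> * (1 + y + y\<^sup>2)" using y by (intro add_nonneg_nonneg mult_nonneg_nonneg) auto
      ultimately show ?thesis by linarith
    qed
    finally have 1: "\<bar>1 - 2/3 * m\<^sup>2 / real n + b * m / real n\<bar> \<le> (1 + \<bar>b\<bar>) * (1 + y)\<^sup>2" .
    have 2: "F (a1 + cc * m * hh n) \<le> C * exp (- y)"
    proof -
      have "F (a1 + cc * y) \<le> C * exp (- (cc * y))" using cc y by (intro C) auto
      also have "\<dots> \<le> C * exp (- y)" using mult_right_mono[OF cc(4) y] C by (intro mult_left_mono) auto
      finally show ?thesis by (simp add: y_def mult.assoc)
    qed
    have F0: "F (a1 + cc * m * hh n) \<ge> 0" using cc m h by (intro F_nonneg) auto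
    have "\<bar>Y b n m\<bar> * (1 + y) ^ K \<le> ((1 + \<bar>b\<bar>) * (1 + y)\<^sup>2 * (C * exp (- y))) * (1 + y) ^ K"
      unfolding Y_def abs_mult using 1 2 F0 y by (intro mult_right_mono mult_mono) auto
    also have "\<dots> = (1 + \<bar>b\<bar>) * C * exp (- y) * (1 + y) ^ (K + 2)"
      by (simp only: power_add mult_ac)
    also have "\<dots> \<le> (1 + \<bar>b\<bar>) * C * exp (- y) * (real (K + 2) ^ (K + 2) * exp y)"
      using one_plus_power_le_exp[OF y, of "K + 2"] C by (intro mult_left_mono) auto
    also have "\<dots> = A * (exp (- y) * exp y)" by (simp add: A_def mult_ac)
    finally show ?thesis by (simp add: y_def flip: exp_add)
  qed
  moreover have "A \<ge> 0" using C by (simp add: A_def)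
  ultimately show ?thesis by blast
qed

lemma Y_p0:
  assumes "n \<ge> 1"
  shows "Y b n (real M) = p0 b n M * F (zf n M)"
proof -
  have inv: "a / real n = a * hh n ^ 3" for a using hh_cube[OF assms] by simp
  show ?thesis
    unfolding Y_def inv p0_def zf_def xx_def by (simp add: power2_eq_square power3_eq_cube algebra_simps)
qed

lemma sm_p0: "sm 1 (\<lambda>n M. p0 b n M - 1)"
proof -
  have "sm (1 + 0) (\<lambda>n M. hh n * ((- 2/3) * xx n M ^ 2 + b * xx n M * hh n))"
    by (intro sm_mult sm_h sm0_intros)
  then have "sm 1 (\<lambda>n M. hh n * ((- 2/3) * xx n M ^ 2 + b * xx n M * hh n))" by simp
  then show ?thesis
    by (rule sw_cong[where ?n1.0 = 0 and E = 0]) (simp add: p0_def algebra_simps power2_eq_square)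
qed

definition DF where
  "DF b \<sigma> kp n M = uf n M * Y b (n - 1) (real M - 1) + Y b (n - 1) (real M + 1)
      - kp n M * Y b (n - 3) (real M - 1) - s0 \<sigma> n * Y b n (real M)"

text \<open>Near \<open>x = 0\<close> the positive term \<open>e * Y\<close> absorbs the defect; for large \<open>x\<close>, where \<open>Y\<close> decays
  faster than any power of \<open>n\<close>, the constant-in-\<open>M\<close> function \<open>Zf\<close> does.\<close>

lemma barrier:
  assumes kp: "sm 5 (\<lambda>n M. kp n M - \<theta> * (1/2) * hh n ^ 3)"
    and b: "b = 11/6 - \<theta> * (1/4)" and \<sigma>: "\<sigma> = 8/3 - \<theta> * (1/2)"
    and kp1: "\<forall>\<^sub>F n in sequentially. \<forall>M. \<bar>kp n M\<bar> \<le> 1"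
  shows "\<forall>\<^sub>F n in sequentially. \<forall>M e. M \<ge> 1 \<longrightarrow> ef n \<le> e \<longrightarrow> e \<le> 3 * ef n \<longrightarrow>
    \<bar>DF b \<sigma> kp n M\<bar> \<le> e * Y b n (real M) + ((s0 \<sigma> n - 3 * ef n) * Zf n - (uf n M + 1) * Zf (n - 1))"
proof -
  define q where "q = cc ^ 2 * a1"
  \<comment> \<open>Then \<open>q + X >= 4\<close>, so by \<open>slack_lim\<close> the slack of
    \<open>Zf\<close> exceeds \<open>Zf n h ^ 2 = h ^ 8\<close> for \<open>x >= X\<close> and large
    \<open>n\<close>.\<close>
  define X where "X = \<bar>q\<bar> + 4"
  obtain C D n0 where C: "C \<ge> 0" "n0 \<ge> 1" "\<And>n M D'. n \<ge> n0 \<Longrightarrow> D' \<ge> D \<Longrightarrow> rg D' n M \<Longrightarrow>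
     \<bar>DF b \<sigma> kp n M\<bar> \<le> C * hh n ^ 4 * (1 + xx n M) ^ D' * \<bar>F (zf n M)\<bar>"
    using swE[OF defect[OF kp b \<sigma>]] unfolding DF_def by metis
  obtain Dp n1 where Dp: "\<And>n M. n \<ge> n1 \<Longrightarrow> rg Dp n M \<Longrightarrow> \<bar>p0 b n M - 1\<bar> \<le> 1/2"
    by (rule sm_small[OF sm_p0[of b], of "1/2"]) (simp, blast)
  \<comment> \<open>The doubled \<open>D\<close> allows \<open>rg_half\<close>; it turns the defect
    into \<open>h ^ (7/2) F\<close>, smaller than \<open>ef n F\<close> by \<open>h ^ (1/4)\<close>.
    Outside the region \<open>rg D1\<close>, the ninth power gives
    \<open>(1 + x) ^ K >= h ^ (-9)\<close>, so that \<open>Y\<close> is of order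
    \<open>h ^ 9\<close>, one order below the slack \<open>h ^ 8\<close>.\<close>
  define D1 where "D1 = 2 * D + Dp"
  define K where "K = 9 * D1"
  obtain CY where CY: "CY \<ge> 0" "\<And>n m. n \<ge> 1 \<Longrightarrow> m \<ge> 0 \<Longrightarrow> \<bar>Y b n m\<bar> * (1 + m * hh n) ^ K \<le> CY"
    using Y_bound[of b K] by blast
  obtain c0 where c0: "c0 > 0" "\<And>y. 0 \<le> y \<Longrightarrow> y \<le> 2 * X \<Longrightarrow> c0 * y \<le> F (a1 + y)"
    using F_lower[of "2 * X"] by blast
  \<comment> \<open>The sum \<open>12 + |q| + |\<sigma>|\<close> adds the factors \<open>5\<close>,
    \<open>1\<close>, \<open>1\<close>, \<open>2 + |q| + |\<sigma>|\<close> and \<open>3\<close> of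
    the five terms estimated in the tail.\<close>
  define B where "B = (12 + \<bar>q\<bar> + \<bar>\<sigma>\<bar>) * CY * 2 ^ K"
  have ev_slack: "\<forall>\<^sub>F n in sequentially. (s0 \<sigma> n - 3 * ef n) * Zf n - (2 - X' * hh n ^ 2 + 4 * hh n ^ 3) * Zf (n - 1) \<ge> w * (Zf n * hh n ^ 2)"
    if "w < q + X'" for w X'
  proof -
    have "\<forall>\<^sub>F n in sequentially. w < ((2 + q * hh n ^ 2 + \<sigma> * hh n ^ 3 - 3 * ef n) * Zf n - (2 - X' * hh n ^ 2 + 4 * hh n ^ 3) * Zf (n - 1)) / (Zf n * hh n ^ 2)"
      using order_tendstoD(1)[OF slack_lim that] .
    then show ?thesis using eventually_ge_at_top[of 1]
    proof eventually_elim
      case (elim n)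
      have "Zf n * hh n ^ 2 > 0" using hh_pos[of n] elim by (simp add: Zf_def)
      then show ?case using elim by (simp add: s0_def q_def less_divide_eq less_imp_le)
    qed
  qed
  have s1: "\<forall>\<^sub>F n in sequentially. (s0 \<sigma> n - 3 * ef n) * Zf n - (2 - X * hh n ^ 2 + 4 * hh n ^ 3) * Zf (n - 1) \<ge> 1 * (Zf n * hh n ^ 2)"
    by (rule ev_slack) (simp add: X_def)
  have s2: "\<forall>\<^sub>F n in sequentially. (s0 \<sigma> n - 3 * ef n) * Zf n - (2 - 0 * hh n ^ 2 + 4 * hh n ^ 3) * Zf (n - 1) \<ge> (- \<bar>q\<bar> - 1) * (Zf n * hh n ^ 2)"
    by (rule ev_slack) auto
  have s3: "\<forall>\<^sub>F n in sequentially. C * sqrt (sqrt (hh n)) \<le> 1/8"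
    by (rule hh4_eventually_le) simp
  have s4: "\<forall>\<^sub>F n in sequentially. (\<bar>q\<bar> + 1) * hh n \<le> 3/8 * c0" by (rule hh_eventually_le) (use c0 in simp)
  have s5: "\<forall>\<^sub>F n in sequentially. X * hh n \<le> 1" "\<forall>\<^sub>F n in sequentially. (1 + X) ^ D1 * hh n \<le> 1"
    "\<forall>\<^sub>F n in sequentially. B * hh n \<le> 1" by (rule hh_eventually_le, simp)+
  show ?thesis
    using s1 s2 eventually_ge_at_top[of "max (max n0 n1) 4"] kp1 s3 s4 s5
  proof eventually_elim
    case (elim n)
    note S1 = elim(1) and S2 = elim(2) and n = elim(3) and kp1 = elim(4)
      and Ch = elim(5) and qh = elim(6) and Xh = elim(7) and XD = elim(8) and Bh = elim(9)
    show ?case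
    proof (intro allI impI)
    fix M :: nat and e :: real
    assume M: "1 \<le> M" and e: "ef n \<le> e" "e \<le> 3 * ef n"
    define h x where "h = hh n" and "x = xx n M"
    have n1: "n \<ge> 1" "n \<ge> 4" "n \<ge> n0" "n \<ge> n1" using n by auto
    have h: "h > 0" "h \<le> 1" using hh_pos hh_le_1 n1 by (auto simp: h_def)
    have x0: "x \<ge> 0" by (simp add: x_def xx_nonneg)
    have Z: "Zf n = h ^ 6" using Zf_eq n1 by (simp add: h_def)
    have Zp: "Zf (n - 1) \<ge> 0" by (rule Zf_nonneg)
    have e0: "e \<ge> 0" using e ef_nonneg[of n] by linarith
    define SL where "SL = (s0 \<sigma> n - 3 * ef n) * Zf n - (uf n M + 1) * Zf (n - 1)"
    have SL_ge: "(s0 \<sigma> n - 3 * ef n) * Zf n - (2 - X' * hh n ^ 2 + 4 * hh n ^ 3) * Zf (n - 1) \<le> SL"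
      if "X' \<le> x" "X' * hh n ^ 2 \<le> 1" for X'
    proof -
      have "(uf n M + 1) * Zf (n - 1) \<le> (2 - X' * hh n ^ 2 + 4 * hh n ^ 3) * Zf (n - 1)"
        using uf_le[OF n1(1) M, of X'] that Zp by (intro mult_right_mono) (auto simp: x_def)
      then show ?thesis by (simp add: SL_def)
    qed
    have Xh2: "X * hh n ^ 2 \<le> 1"
    proof -
      have "X * hh n ^ 2 = (X * h) * h" by (simp add: h_def power2_eq_square)
      also have "\<dots> \<le> 1 * 1" using Xh h by (intro mult_mono) (auto simp: h_def X_def)
      finally show ?thesis by simp
    qed
    have SL_X: "h ^ 8 \<le> SL" if "X \<le> x"
      using SL_ge[OF that Xh2] S1 Z by (simp add: h_def eval_nat_numeral)
    have SL_0: "- ((\<bar>q\<bar> + 1) * h ^ 8) \<le> SL"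
    proof -
      have "(- \<bar>q\<bar> - 1) * (Zf n * hh n ^ 2) \<le> SL" using SL_ge[of 0] S2 x0 by simp
      also have "(- \<bar>q\<bar> - 1) * (Zf n * hh n ^ 2) = - ((\<bar>q\<bar> + 1) * h ^ 8)"
        unfolding Z by (simp add: h_def algebra_simps eval_nat_numeral)
      finally show ?thesis .
    qed
    have sq: "sqrt h = sqrt (sqrt h) * sqrt (sqrt h)" using h by simp
    have "\<bar>DF b \<sigma> kp n M\<bar> \<le> e * Y b n (real M) + SL"
    proof (cases "rg D1 n M")
      case True
      then have r: "rg (2 * D) n M" "rg Dp n M" "rg D n M" by (auto intro: rg_mono simp: D1_def)
      define f where "f = F (zf n M)"
      have f0: "f \<ge> 0" by (simp add: f_def Fz_nonneg)
      have "\<bar>DF b \<sigma> kp n M\<bar> \<le> C * h ^ 3 * (h * (1 + x) ^ D) * f"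
        using C(3)[of n D M] n1 r f0 by (simp add: h_def x_def f_def eval_nat_numeral mult_ac)
      also have "\<dots> \<le> C * h ^ 3 * sqrt h * f"
        using rg_half[OF n1(1) r(1)] C h f0 by (intro mult_right_mono mult_left_mono) (auto simp: h_def x_def)
      also have "\<dots> = (C * sqrt (sqrt h)) * (ef n * f)" by (subst sq) (simp add: ef_def h_def mult_ac)
      also have "\<dots> \<le> 1/8 * (ef n * f)" using Ch f0 ef_nonneg[of n] by (intro mult_right_mono) (auto simp: h_def)
      finally have d: "\<bar>DF b \<sigma> kp n M\<bar> \<le> 1/8 * (ef n * f)" .
      have "1/2 \<le> p0 b n M" using Dp[OF n1(4) r(2)] by linarith
      then have "1/2 * f \<le> Y b n (real M)"
        unfolding Y_p0[OF n1(1)] f_def[symmetric] using f0 by (intro mult_right_mono)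
      then have "ef n * (1/2 * f) \<le> e * Y b n (real M)"
        using e ef_nonneg[of n] f0 by (intro mult_mono) auto
      then have d2: "\<bar>DF b \<sigma> kp n M\<bar> + 3/8 * (ef n * f) \<le> e * Y b n (real M)" using d by simp
      show ?thesis
      proof (cases "X \<le> x")
        case True
        have "0 \<le> ef n * f" "0 \<le> h ^ 8" using f0 ef_nonneg[of n] h by auto
        then show ?thesis using SL_X[OF True] d2 by linarith
      next
        case False
        \<comment> \<open>For \<open>x < X\<close> the slack may be negative, but only of order
          \<open>h ^ 8\<close>. Since \<open>M >= 1\<close>, \<open>F\<close> is at least
          \<open>c0 h\<close>, and \<open>ef n F\<close> is at least of order
          \<open>h ^ 5\<close>.\<close>
        have "h \<le> x" using M h by (simp add: x_def xx_def h_def)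
        also have "\<dots> \<le> cc * x" using mult_right_mono[OF cc(4) x0] by simp
        finally have "c0 * h \<le> c0 * (cc * x)" using c0 by simp
        also have "\<dots> \<le> f"
        proof -
          have "cc * x \<le> 2 * X" using cc False x0 by (intro mult_mono) auto
          then show ?thesis using c0(2)[of "cc * x"] cc x0 by (simp add: f_def zf_def x_def)
        qed
        finally have f: "c0 * h \<le> f" .
        have "h ^ 4 \<le> ef n"
        proof -
          have "h \<le> sqrt h" using h real_le_rsqrt[of h h] by (simp add: power2_eq_square mult_left_le)
          also have "\<dots> \<le> sqrt (sqrt h)" using h by (intro real_sqrt_le_mono) (simp add: \<open>h \<le> sqrt h\<close>)
          finally have "h ^ 3 * h \<le> h ^ 3 * sqrt (sqrt h)" using h by (intro mult_left_mono) auto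
          then show ?thesis by (simp add: ef_def h_def eval_nat_numeral mult_ac)
        qed
        then have "h ^ 4 * (c0 * h) \<le> ef n * f" using f h c0 ef_nonneg[of n] by (intro mult_mono) auto
        then have "3/8 * c0 * h ^ 5 \<le> 3/8 * (ef n * f)" by (simp add: eval_nat_numeral mult_ac)
        moreover have "(\<bar>q\<bar> + 1) * h ^ 8 \<le> 3/8 * c0 * h ^ 5"
        proof -
          have "(\<bar>q\<bar> + 1) * h ^ 8 = ((\<bar>q\<bar> + 1) * h) * h ^ 7" by (simp add: eval_nat_numeral mult_ac)
          also have "\<dots> \<le> (3/8 * c0) * h ^ 7"
            using qh h by (intro mult_right_mono) (auto simp: h_def)
          also have "\<dots> \<le> (3/8 * c0) * h ^ 5"
            using h c0(1) by (intro mult_left_mono power_decreasing) auto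
          finally show ?thesis .
        qed
        ultimately show ?thesis using SL_0 d2 by linarith
      qed
    next
      case False
      then have out: "(1 + x) ^ D1 * h > 1" using M by (simp add: rg_def x_def h_def)
      have Xx: "X \<le> x"
      proof (rule ccontr)
        assume "\<not> X \<le> x"
        then have "(1 + x) ^ D1 * h \<le> (1 + X) ^ D1 * h" using x0 h by (intro mult_right_mono power_mono) auto
        then show False using XD out by (simp add: h_def)
      qed
      have hK: "1 \<le> (1 + x) ^ K * h ^ 9"
      proof -
        have "1 \<le> ((1 + x) ^ D1 * h) ^ 9" using out by (intro one_le_power) simp
        also have "\<dots> = (1 + x) ^ K * h ^ 9"
          unfolding power_mult_distrib K_def by (simp add: mult.commute flip: power_mult)
        finally show ?thesis .
      qed
      have tail: "\<bar>Y b (n - i) m\<bar> \<le> CY * 2 ^ K * h ^ 9" if "i \<le> 3" "m \<ge> 0" "real M \<le> m + 1" for i m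
      proof -
        have ni: "n - i \<ge> 1" using that n1 by simp
        define x' where "x' = m * hh (n - i)"
        have "x = real M * hh n" by (simp add: x_def xx_def)
        also have "\<dots> \<le> (m + 1) * hh (n - i)"
          using that hh_antimono[OF ni] hh_nonneg by (intro mult_mono) auto
        also have "\<dots> \<le> x' + 1" using hh_le_1[OF ni] by (simp add: x'_def algebra_simps)
        finally have xx': "1 + x \<le> 2 * (1 + x')"
          using mult_nonneg_nonneg[OF that(2) hh_nonneg[of "n - i"]] by (simp add: x'_def)
        have "\<bar>Y b (n - i) m\<bar> * 1 \<le> \<bar>Y b (n - i) m\<bar> * ((1 + x) ^ K * h ^ 9)"
          using hK by (intro mult_left_mono) auto
        also have "\<dots> \<le> \<bar>Y b (n - i) m\<bar> * ((2 * (1 + x')) ^ K * h ^ 9)"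
          using xx' x0 h by (intro mult_left_mono mult_right_mono power_mono) auto
        also have "\<dots> = (\<bar>Y b (n - i) m\<bar> * (1 + x') ^ K) * (2 ^ K * h ^ 9)"
          unfolding power_mult_distrib by simp
        also have "\<dots> \<le> CY * (2 ^ K * h ^ 9)"
          using CY(2)[OF ni that(2)] h by (intro mult_right_mono) (auto simp: x'_def)
        finally show ?thesis by (simp add: mult.assoc)
      qed
      define T where "T = CY * 2 ^ K * h ^ 9"
      have T0: "T \<ge> 0" using CY h by (simp add: T_def)
      have h3: "h ^ 3 \<le> 1" "h ^ 2 \<le> 1" using h by (simp_all add: power_le_one)
      have u5: "uf n M \<le> 5" using uf_le[OF n1(1) M, of 0] x0 h3 by (simp add: x_def h_def)
      have sb: "\<bar>s0 \<sigma> n\<bar> \<le> 2 + \<bar>q\<bar> + \<bar>\<sigma>\<bar>"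
      proof -
        have "\<bar>q * h ^ 2\<bar> \<le> \<bar>q\<bar> * 1" "\<bar>\<sigma> * h ^ 3\<bar> \<le> \<bar>\<sigma>\<bar> * 1"
          unfolding abs_mult using h3 h by (intro mult_left_mono; simp)+
        then show ?thesis unfolding s0_def q_def[symmetric] h_def[symmetric] by linarith
      qed
      have e3: "\<bar>e\<bar> \<le> 3"
      proof -
        have "sqrt (sqrt h) \<le> 1" using h by simp
        then have "ef n \<le> 1 * 1" unfolding ef_def h_def[symmetric] using h3 h by (intro mult_mono) auto
        then show ?thesis using e e0 by simp
      qed
      have 1: "\<bar>uf n M * Y b (n - 1) (real M - 1)\<bar> \<le> 5 * T"
        unfolding abs_mult T_def using u5 uf_nonneg[of n M] M by (intro mult_mono tail) auto
      have 2: "\<bar>Y b (n - 1) (real M + 1)\<bar> \<le> T" unfolding T_def by (intro tail) auto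
      have 3: "\<bar>kp n M * Y b (n - 3) (real M - 1)\<bar> \<le> 1 * T"
        unfolding abs_mult T_def using kp1 M by (intro mult_mono tail) auto
      have Yt: "\<bar>Y b n (real M)\<bar> \<le> T" using tail[of 0 "real M"] by (simp add: T_def)
      have 4: "\<bar>s0 \<sigma> n * Y b n (real M)\<bar> \<le> (2 + \<bar>q\<bar> + \<bar>\<sigma>\<bar>) * T"
        unfolding abs_mult using sb Yt by (intro mult_mono) auto
      have 5: "\<bar>e * Y b n (real M)\<bar> \<le> 3 * T"
        unfolding abs_mult using e3 Yt by (intro mult_mono) auto
      have "\<bar>DF b \<sigma> kp n M\<bar> - e * Y b n (real M) \<le> 5 * T + T + 1 * T + (2 + \<bar>q\<bar> + \<bar>\<sigma>\<bar>) * T + 3 * T"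
        unfolding DF_def by (rule abs_combo[OF 1 2 3 4 5])
      also have "\<dots> = (B * h) * h ^ 8" by (simp add: T_def B_def algebra_simps eval_nat_numeral)
      also have "\<dots> \<le> 1 * h ^ 8" using Bh h by (intro mult_right_mono) (auto simp: h_def)
      also have "\<dots> \<le> SL" using SL_X[OF Xx] by simp
      finally show ?thesis by linarith
    qed
    then show "\<bar>DF b \<sigma> kp n M\<bar> \<le> e * Y b n (real M) + ((s0 \<sigma> n - 3 * ef n) * Zf n - (uf n M + 1) * Zf (n - 1))"
      by (simp add: SL_def)
    qed
  qed
qed

text \<open>\<open>Y\<close> is negative only where its polynomial factor is, and there
  \<open>(1 + x) ^ 2 h >= 1\<close>. Then \<open>(1 + x) ^ 14 h ^ 7 >= 1\<close>, so the bound with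
  exponent 14 leaves \<open>|Y| <= C h ^ 7\<close>, below \<open>h ^ 6 / 2\<close> for large
  \<open>n\<close>; the same happens for \<open>M >= n\<close>. This supplies the sign conditions on
  \<open>Vp\<close> and \<open>Vm\<close> in the comparison.\<close>

lemma Y_neg_part:
  assumes "b \<ge> 0"
  shows "\<forall>\<^sub>F n in sequentially. \<forall>M. Y b n (real M) \<ge> - Zf n / 2 \<and> (M \<ge> n \<longrightarrow> Y b n (real M) \<le> Zf n / 2)"
proof -
  obtain C where C: "C \<ge> 0" "\<And>n m. n \<ge> 1 \<Longrightarrow> m \<ge> 0 \<Longrightarrow> \<bar>Y b n m\<bar> * (1 + m * hh n) ^ 14 \<le> C"
    using Y_bound[of b 14] by blast
  have "\<forall>\<^sub>F n in sequentially. C * hh n \<le> 1 / 2" by (rule hh_eventually_le) simp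
  then show ?thesis
    using eventually_ge_at_top[of 1]
  proof (eventually_elim, intro allI)
    fix n M :: nat assume Ch: "C * hh n \<le> 1 / 2" and n: "1 \<le> n"
    define h x where "h = hh n" and "x = xx n M"
    have h: "h > 0" "h \<le> 1" using hh_pos hh_le_1 n by (auto simp: h_def)
    have x0: "x \<ge> 0" by (simp add: x_def xx_nonneg)
    have Z: "Zf n = h ^ 6" using Zf_eq n by (simp add: h_def)
    have small: "\<bar>Y b n (real M)\<bar> \<le> Zf n / 2" if "1 \<le> (1 + x) ^ 2 * h"
    proof -
      have "1 \<le> ((1 + x) ^ 2 * h) ^ 7" using that by (rule one_le_power)
      also have "\<dots> = (1 + x) ^ 14 * h ^ 7" unfolding power_mult_distrib by (simp flip: power_mult)
      finally have "\<bar>Y b n (real M)\<bar> * 1 \<le> \<bar>Y b n (real M)\<bar> * ((1 + x) ^ 14 * h ^ 7)"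
        by (intro mult_left_mono) auto
      also have "\<dots> = (\<bar>Y b n (real M)\<bar> * (1 + x) ^ 14) * h ^ 7" by simp
      also have "\<dots> \<le> C * h ^ 7" using C(2)[OF n, of "real M"] h
        by (intro mult_right_mono) (auto simp: x_def xx_def)
      also have "\<dots> = (C * h) * h ^ 6" by (simp add: eval_nat_numeral)
      also have "\<dots> \<le> 1/2 * h ^ 6" using Ch h by (intro mult_right_mono) (auto simp: h_def)
      finally show ?thesis by (simp add: Z)
    qed
    show "Y b n (real M) \<ge> - Zf n / 2 \<and> (M \<ge> n \<longrightarrow> Y b n (real M) \<le> Zf n / 2)"
    proof
      show "Y b n (real M) \<ge> - Zf n / 2"
      proof (cases "1 \<le> (1 + x) ^ 2 * h")
        case True
        then show ?thesis using small by simp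
      next
        case False
        have "x ^ 2 * h \<le> (1 + x) ^ 2 * h" using x0 h by (intro mult_right_mono power_mono) auto
        then have "2/3 * x ^ 2 * h \<le> 1" using False by linarith
        moreover have "b * x * h ^ 2 \<ge> 0" using assms x0 by simp
        ultimately have "p0 b n M \<ge> 0" by (simp add: p0_def x_def h_def)
        then have "Y b n (real M) \<ge> 0" unfolding Y_p0[OF n] using Fz_nonneg by simp
        then show ?thesis using Zf_nonneg[of n] by linarith
      qed
      show "M \<ge> n \<longrightarrow> Y b n (real M) \<le> Zf n / 2"
      proof
        assume "M \<ge> n"
        have "h ^ 3 * real n = 1" using hh_cube[OF n] n by (simp add: h_def)
        then have "1 = real n * h * h ^ 2" by (simp add: eval_nat_numeral mult_ac)
        also have "\<dots> \<le> x * h ^ 2"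
          using \<open>M \<ge> n\<close> h by (intro mult_right_mono) (auto simp: x_def xx_def h_def)
        also have "\<dots> \<le> (1 + x) ^ 2 * h"
        proof (intro mult_mono)
          show "x \<le> (1 + x) ^ 2" using x0 by (simp add: power2_eq_square algebra_simps)
          show "h ^ 2 \<le> h" using h by (simp add: power2_eq_square mult_left_le)
        qed (use h in auto)
        finally show "Y b n (real M) \<le> Zf n / 2" using small by simp
      qed
    qed
  qed
qed

end

section \<open>Bounds for the recurrence\<close>

text \<open>Induction on \<open>K\<close>: the subtracted term
  \<open>(K - 1) e_num (K - 1) M\<close> of \<open>e_num_Suc\<close> is at most
  \<open>e_num (K - 1) (M + 2)\<close>, because two uses of the induction hypothesis already produce
  the factor \<open>K ^ 2\<close>.\<close>

lemma e_num_ge: "(K + 1) * e_num K M \<le> e_num K (Suc M)"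
proof (induction K arbitrary: M)
  case 0
  then show ?case by (simp add: e_num_Suc_0)
next
  case (Suc K)
  have "K * e_num K M \<le> (K + 1) * ((K + 1) * e_num K M)"
    by (rule order_trans[of _ "(K + 1) * e_num K M"]) auto
  also have "\<dots> \<le> (K + 1) * e_num K (Suc M)" by (intro mult_left_mono Suc.IH) simp
  also have "\<dots> \<le> e_num K (M + 2)" using Suc.IH[of "Suc M"] by simp
  finally show ?case using e_num_Suc[of "Suc K" M] by simp
qed

lemma e_num_pos: "e_num K (Suc M) > 0"
proof (induction K arbitrary: M)
  case 0
  show ?case by (induction M) (simp_all add: e_num_Suc_0 e_num_0)
next
  case (Suc K)
  show ?case
  proof (induction M)
    case 0
    have "e_num K 2 > 0" using Suc.IH[of 1] by (simp add: numeral_2_eq_2)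
    then show ?case using e_num_Suc[of "Suc K" 0] by (cases K) (auto simp: e_num_0 numeral_2_eq_2)
  next
    case (Suc M)
    then show ?case using e_num_ge[of "Suc K" "Suc M"] by (metis add_gr_0 less_le_trans nat_0_less_mult_iff zero_less_one)
  qed
qed

text \<open>Strictness leaves room to fit a small multiple of the subsolution below the initial data
  of \<open>sub_compare\<close>.\<close>

lemma e_num_Suc_strict:
  assumes "K > 0"
  shows "(K + 1) * e_num K M < e_num K (Suc M)"
proof -
  have "(K - 1) * e_num (K - 1) M < e_num (K - 1) (M + 2)"
  proof (cases "e_num (K - 1) M = 0")
    case True
    then show ?thesis using e_num_pos[of "K - 1" "Suc M"] by simp
  next
    case False
    have "(K - 1) * e_num (K - 1) M < K * (K * e_num (K - 1) M)"
    proof -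
      have "(K - 1) * e_num (K - 1) M < K * e_num (K - 1) M" using False assms by simp
      also have "\<dots> \<le> K * (K * e_num (K - 1) M)" using assms by simp
      finally show ?thesis .
    qed
    also have "\<dots> \<le> K * e_num (K - 1) (Suc M)"
      using e_num_ge[of "K - 1" M] assms by (intro mult_left_mono) auto
    also have "\<dots> \<le> e_num (K - 1) (M + 2)" using e_num_ge[of "K - 1" "Suc M"] assms by simp
    finally show ?thesis .
  qed
  then show ?thesis using e_num_Suc[OF assms, of M] by linarith
qed

text \<open>The claim covers all smaller constants as well, so that the constants for two finite
  sets can be replaced by their minimum, whatever the signs of \<open>v\<close>.\<close>

lemma finite_scale:
  fixes v e :: "'a \<Rightarrow> real"
  assumes "finite S" "\<And>s. s \<in> S \<Longrightarrow> e s > 0"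
  shows "\<exists>c>0. \<forall>s\<in>S. \<forall>c'. 0 < c' \<longrightarrow> c' \<le> c \<longrightarrow> c' * v s \<le> e s"
  using assms
proof (induction S rule: finite_induct)
  case empty
  show ?case by (intro exI[of _ 1]) auto
next
  case (insert a S)
  then obtain c where c: "c > 0" "\<And>s c'. s \<in> S \<Longrightarrow> 0 < c' \<Longrightarrow> c' \<le> c \<Longrightarrow> c' * v s \<le> e s" by auto
  define d where "d = e a / (\<bar>v a\<bar> + 1)"
  have ea: "e a > 0" using insert by simp
  then have d: "d > 0" by (simp add: d_def)
  have "c' * v a \<le> e a" if "0 < c'" "c' \<le> d" for c'
  proof -
    have "c' * v a \<le> c' * (\<bar>v a\<bar> + 1)" using that by (intro mult_left_mono) auto
    also have "\<dots> \<le> d * (\<bar>v a\<bar> + 1)" using that by (intro mult_right_mono) auto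
    also have "\<dots> = e a"
    proof -
      have "\<bar>v a\<bar> + 1 \<noteq> 0" by linarith
      then show ?thesis by (simp add: d_def)
    qed
    finally show ?thesis .
  qed
  then show ?case using c d by (intro exI[of _ "min c d"]) auto
qed

context airy_pos
begin

text \<open>After division by \<open>(K + M - 1)!\<close> the recurrence has coefficients \<open>uf\<close> (and \<open>kap\<close>) in the coordinates
  \<open>(n, M)\<close> with \<open>n = 2 * K + M - 1\<close>. The true value \<open>w_num 0 0 = 1\<close> is replaced by \<open>0\<close> to match the zero
  of the Airy function.\<close>

definition wd :: "nat \<Rightarrow> nat \<Rightarrow> real" where
  "wd K M = (if M = 0 then 0 else real (w_num K M) / fact (K + M - 1))"

definition ed :: "nat \<Rightarrow> nat \<Rightarrow> real" where
  "ed K M = (if M = 0 then 0 else real (e_num K M) / fact (K + M - 1))"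

definition kap :: "nat \<Rightarrow> nat \<Rightarrow> real" where
  "kap n M = 2 * real (n - M - 1) / (real (n + M - 1) * real (n + M - 3))"

lemma kap_nonneg: "kap n M \<ge> 0" by (simp add: kap_def)

lemma uf_KM:
  assumes "M \<ge> 1"
  shows "uf (2 * K + M - 1) M = (real K + 1) / real (K + M - 1)"
proof -
  have *: "2 * K + M - 1 + 3 - M = 2 * (K + 1)" "2 * K + M - 1 + M - 1 = 2 * (K + M - 1)" using assms by arith+
  have "real (2 * (K + 1)) / real (2 * (K + M - 1)) = (2 * (real K + 1)) / (2 * real (K + M - 1))" by simp
  also have "\<dots> = (real K + 1) / real (K + M - 1)" by (rule mult_divide_mult_cancel_left) simp
  finally show ?thesis unfolding uf_def * .
qed

lemma kap_KM:
  assumes "M \<ge> 1" "K \<ge> 1"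
  shows "kap (2 * K + M - 1) M = (real K - 1) / (real (K + M - 1) * real (K + M - 2))"
proof -
  have *: "2 * K + M - 1 - M - 1 = 2 * (K - 1)" "2 * K + M - 1 + M - 1 = 2 * (K + M - 1)"
    "2 * K + M - 1 + M - 3 = 2 * (K + M - 2)" using assms by arith+
  have K: "real (K - 1) = real K - 1" using assms by (simp add: of_nat_diff)
  have "kap (2 * K + M - 1) M = (4 * (real K - 1)) / (4 * (real (K + M - 1) * real (K + M - 2)))"
    unfolding kap_def * of_nat_mult K by simp
  then show ?thesis by (simp only: mult_divide_mult_cancel_left zero_neq_numeral not_False_eq_True)
qed

text \<open>\<open>K + M >= 2\<close> excludes \<open>(0, 1)\<close>, the one place where the
  changed value at \<open>(0, 0)\<close> would be felt.\<close>

lemma wd_rec: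
  assumes "M \<ge> 1" "K + M \<ge> 2"
  shows "wd K M \<le> uf (2 * K + M - 1) M * wd K (M - 1) + (if K = 0 then 0 else wd (K - 1) (M + 1))"
proof -
  obtain M' where M: "M = Suc M'" using assms by (cases M) auto
  have f: "fact (K + M') = real (K + M') * fact (K + M' - 1)"
    using assms M by (subst fact_reduce) auto
  have "wd K M = (real K + 1) * real (w_num K M') / fact (K + M')
     + (if K = 0 then 0 else real (w_num (K - 1) (M' + 2))) / fact (K + M')"
    unfolding wd_def M w_num_Suc by (simp add: add_divide_distrib algebra_simps)
  moreover have "(real K + 1) * real (w_num K M') / fact (K + M') \<le> uf (2 * K + M - 1) M * wd K (M - 1)"
  proof (cases "M' = 0")
    case True
    then show ?thesis using assms M by (simp add: w_num_0 wd_def)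
  next
    case False
    then show ?thesis unfolding uf_KM[OF assms(1)] using M f by (simp add: wd_def)
  qed
  moreover have "(if K = 0 then 0 else real (w_num (K - 1) (M' + 2))) / fact (K + M') = (if K = 0 then 0 else wd (K - 1) (M + 1))"
    using M by (simp add: wd_def)
  ultimately show ?thesis by linarith
qed

lemma ed_rec:
  assumes "M \<ge> 1" "K \<ge> 1"
  shows "uf (2 * K + M - 1) M * ed K (M - 1) + ed (K - 1) (M + 1) - kap (2 * K + M - 1) M * ed (K - 1) (M - 1) \<le> ed K M"
proof -
  obtain M' where M: "M = Suc M'" using assms by (cases M) auto
  have f: "fact (K + M') = real (K + M') * fact (K + M' - 1)"
    using assms M by (subst fact_reduce) auto
  have le: "(real K + 1) * real (e_num K M') + real (e_num (K - 1) (M' + 2)) - (real K - 1) * real (e_num (K - 1) M') \<le> real (e_num K M)"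
  proof -
    have "real ((K + 1) * e_num K M' + e_num (K - 1) (M' + 2)) \<le> real (e_num K (Suc M') + (K - 1) * e_num (K - 1) M')"
      using e_num_Suc[of K M'] assms by (intro of_nat_mono) auto
    moreover have "real (K - 1) = real K - 1" using assms by (simp add: of_nat_diff)
    ultimately show ?thesis unfolding of_nat_add of_nat_mult M by (simp add: algebra_simps)
  qed
  have 1: "uf (2 * K + M - 1) M * ed K (M - 1) = (real K + 1) * real (e_num K M') / fact (K + M')"
  proof (cases "M' = 0")
    case True
    then show ?thesis using assms M by (simp add: e_num_0 ed_def)
  next
    case False
    then show ?thesis unfolding uf_KM[OF assms(1)] using M f by (simp add: ed_def)
  qed
  have 2: "ed (K - 1) (M + 1) = real (e_num (K - 1) (M' + 2)) / fact (K + M')"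
    using M assms by (simp add: ed_def)
  have 3: "kap (2 * K + M - 1) M * ed (K - 1) (M - 1) = (real K - 1) * real (e_num (K - 1) M') / fact (K + M')"
  proof (cases "M' = 0")
    case True
    then show ?thesis using assms M by (cases "K = 1") (auto simp: e_num_0 ed_def)
  next
    case False
    have f2: "fact (K + M' - 1) = real (K + M' - 1) * fact (K + M' - 2)"
      using assms False by (subst fact_reduce) (auto simp: numeral_2_eq_2)
    have "K - 1 + (M - 1) - 1 = K + M' - 2" "K + M - 2 = K + M' - 1" "K + M - 1 = K + M'" using M False assms by auto
    then show ?thesis unfolding kap_KM[OF assms] using M f f2 False by (simp add: ed_def)
  qed
  have "uf (2 * K + M - 1) M * ed K (M - 1) + ed (K - 1) (M + 1) - kap (2 * K + M - 1) M * ed (K - 1) (M - 1)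
      = ((real K + 1) * real (e_num K M') + real (e_num (K - 1) (M' + 2)) - (real K - 1) * real (e_num (K - 1) M')) / fact (K + M')"
    unfolding 1 2 3 by (simp add: add_divide_distrib diff_divide_distrib)
  also have "\<dots> \<le> real (e_num K M) / fact (K + M')" by (intro divide_right_mono le) simp
  also have "\<dots> = ed K M" by (simp add: ed_def M)
  finally show ?thesis .
qed

lemma ed_pos: "M \<ge> 1 \<Longrightarrow> ed K M > 0"
  using e_num_pos[of K "M - 1"] by (simp add: ed_def)

lemma ed_strict:
  assumes "M \<ge> 1" "K \<ge> 1"
  shows "uf (2 * K + M - 1) M * ed K (M - 1) < ed K M"
proof -
  obtain M' where M: "M = Suc M'" using assms by (cases M) auto
  have f: "fact (K + M') = real (K + M') * fact (K + M' - 1)"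
    using assms M by (subst fact_reduce) auto
  have 1: "uf (2 * K + M - 1) M * ed K (M - 1) = (real K + 1) * real (e_num K M') / fact (K + M')"
  proof (cases "M' = 0")
    case True
    then show ?thesis using assms M by (simp add: e_num_0 ed_def)
  next
    case False
    then show ?thesis unfolding uf_KM[OF assms(1)] using M f by (simp add: ed_def)
  qed
  have "real ((K + 1) * e_num K M') < real (e_num K (Suc M'))"
    using e_num_Suc_strict[of K M'] assms by (intro of_nat_less_iff[THEN iffD2]) auto
  then have "(real K + 1) * real (e_num K M') / fact (K + M') < real (e_num K M) / fact (K + M')"
    unfolding M by (intro divide_strict_right_mono) (auto simp: algebra_simps)
  then show ?thesis unfolding 1 by (simp add: ed_def M)
qed

text \<open>The coefficients are nonnegative, so domination on the finite slice
  \<open>n = N0\<close> propagates in time. Positivity of \<open>V\<close> settles the boundary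
  cases \<open>M = 1\<close> and \<open>K = 0\<close>, where a term on the side of \<open>wd\<close>
  is 0.\<close>

lemma super_compare:
  assumes ineq: "\<And>n M. n > N0 \<Longrightarrow> M \<ge> 1 \<Longrightarrow> uf n M * V (n - 1) (M - 1) + V (n - 1) (M + 1) \<le> V n M"
    and pos: "\<And>n M. n \<ge> N0 \<Longrightarrow> V n M > 0"
  shows "\<exists>C>0. \<forall>K M. M \<ge> 1 \<longrightarrow> 2 * K + M - 1 \<ge> N0 \<longrightarrow> wd K M \<le> C * V (2 * K + M - 1) M"
proof -
  define S where "S = {(K, M). 2 * K + M - 1 = N0 \<and> M \<ge> 1}"
  have "S \<subseteq> {..N0 + 1} \<times> {..N0 + 1}" by (auto simp: S_def)
  then have finS: "finite S" by (rule finite_subset) auto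
  define C where "C = (\<Sum>(K, M)\<in>S. wd K M / V N0 M) + 1"
  have wd0: "wd K M \<ge> 0" for K M by (simp add: wd_def)
  have term0: "wd K M / V N0 M \<ge> 0" for K M using wd0 pos[of N0 M] by (intro divide_nonneg_pos) auto
  have C: "C > 0" unfolding C_def using term0 by (intro add_nonneg_pos sum_nonneg) auto
  have "wd K M \<le> C * V (2 * K + M - 1) M" if "M \<ge> 1" "2 * K + M - 1 = N0 + i" for K M i
    using that
  proof (induction i arbitrary: K M)
    case 0
    then have "(K, M) \<in> S" by (simp add: S_def)
    then have "(\<lambda>(K, M). wd K M / V N0 M) (K, M) \<le> (\<Sum>(K, M)\<in>S. wd K M / V N0 M)"
      using term0 by (intro member_le_sum finS) auto
    then have "wd K M / V N0 M \<le> C" by (simp add: C_def)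
    then show ?case using pos[of N0 M] 0 by (simp add: divide_le_eq)
  next
    case (Suc i)
    let ?n = "2 * K + M - 1"
    have n: "?n > N0" "N0 + i \<ge> N0" using Suc.prems by auto
    have 1: "wd K (M - 1) \<le> C * V (?n - 1) (M - 1)"
    proof (cases "M = 1")
      case True
      have "V (?n - 1) 0 > 0" using n by (intro pos) auto
      then show ?thesis using C True by (simp add: wd_def)
    next
      case False
      then have *: "M - 1 \<ge> 1" "2 * K + (M - 1) - 1 = N0 + i" using Suc.prems by auto
      then show ?thesis using Suc.IH[OF *] by (metis Suc.prems(2) add_diff_cancel_left' add_Suc_right diff_Suc_1)
    qed
    have 2: "(if K = 0 then 0 else wd (K - 1) (M + 1)) \<le> C * V (?n - 1) (M + 1)"
    proof (cases "K = 0")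
      case True
      have "V (?n - 1) (M + 1) > 0" using n by (intro pos) auto
      then show ?thesis using C True by simp
    next
      case False
      then have *: "M + 1 \<ge> 1" "2 * (K - 1) + (M + 1) - 1 = N0 + i" using Suc.prems by auto
      have "?n - 1 = N0 + i" using Suc.prems by simp
      then show ?thesis using Suc.IH[OF *] * False by simp
    qed
    have "wd K M \<le> uf ?n M * wd K (M - 1) + (if K = 0 then 0 else wd (K - 1) (M + 1))"
      using Suc.prems by (intro wd_rec) auto
    also have "\<dots> \<le> uf ?n M * (C * V (?n - 1) (M - 1)) + C * V (?n - 1) (M + 1)"
      using uf_nonneg by (intro add_mono mult_left_mono 1 2) auto
    also have "\<dots> = C * (uf ?n M * V (?n - 1) (M - 1) + V (?n - 1) (M + 1))" by (simp add: algebra_simps)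
    also have "\<dots> \<le> C * V ?n M" using ineq[OF n(1) Suc.prems(1)] C by (intro mult_left_mono) auto
    finally show ?case .
  qed
  then show ?thesis using C by (metis le_Suc_ex)
qed

text \<open>The recurrence for \<open>ed\<close> has a negative term, so \<open>\<Delta> = ed - c V \<ge> 0\<close> alone is not inductive;
  the stronger invariant \<open>\<Delta> K M \<ge> uf n M * \<Delta> K (M - 1)\<close> absorbs it.\<close>

lemma sub_compare:
  assumes ineq: "\<And>n M. n > N0 \<Longrightarrow> M \<ge> 1 \<Longrightarrow>
      V n M \<le> uf n M * V (n - 1) (M - 1) + V (n - 1) (M + 1) - kap n M * V (n - 3) (M - 1)"
    and V0: "\<And>n. n \<ge> N0 \<Longrightarrow> V n 0 \<le> 0" and Vn: "\<And>n M. n \<ge> N0 \<Longrightarrow> M \<ge> n \<Longrightarrow> V n M \<le> 0"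
    and N0: "N0 \<ge> 1"
  shows "\<exists>c>0. \<forall>K M. M \<ge> 1 \<longrightarrow> 2 * K + M - 1 \<ge> N0 \<longrightarrow> c * V (2 * K + M - 1) M \<le> ed K M"
proof -
  \<comment> \<open>The recurrence reaches back to \<open>n - 3\<close>, so all slices up to
    \<open>N0 + 3\<close> form the base of the induction.\<close>
  define S where "S = {(K, M). 2 * K + M - 1 \<le> N0 + 3 \<and> M \<ge> 1}"
  have "S \<subseteq> {..N0 + 4} \<times> {..N0 + 4}" by (auto simp: S_def)
  then have finS: "finite S" by (rule finite_subset) auto
  have "\<exists>c>0. \<forall>s\<in>S. \<forall>c'. 0 < c' \<longrightarrow> c' \<le> c \<longrightarrow> c' * (case s of (K, M) \<Rightarrow> V (2 * K + M - 1) M) \<le> (case s of (K, M) \<Rightarrow> ed K M)"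
    by (rule finite_scale[OF finS]) (auto simp: S_def ed_pos)
  then obtain c1 where c1: "c1 > 0" "\<And>K M c. (K, M) \<in> S \<Longrightarrow> 0 < c \<Longrightarrow> c \<le> c1 \<Longrightarrow> c * V (2 * K + M - 1) M \<le> ed K M"
    by fastforce
  define S' where "S' = {(K, M). (K, M) \<in> S \<and> K \<ge> 1}"
  have finS': "finite S'" by (rule finite_subset[OF _ finS]) (auto simp: S'_def)
  have "\<exists>c>0. \<forall>s\<in>S'. \<forall>c'. 0 < c' \<longrightarrow> c' \<le> c \<longrightarrow>
     c' * (case s of (K, M) \<Rightarrow> V (2 * K + M - 1) M - uf (2 * K + M - 1) M * V (2 * K + M - 2) (M - 1))
       \<le> (case s of (K, M) \<Rightarrow> ed K M - uf (2 * K + M - 1) M * ed K (M - 1))"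
    by (rule finite_scale[OF finS']) (use ed_strict in \<open>auto simp: S_def S'_def\<close>)
  then obtain c2 where c2: "c2 > 0" "\<And>K M c. (K, M) \<in> S' \<Longrightarrow> 0 < c \<Longrightarrow> c \<le> c2 \<Longrightarrow>
     c * (V (2 * K + M - 1) M - uf (2 * K + M - 1) M * V (2 * K + M - 2) (M - 1)) \<le> ed K M - uf (2 * K + M - 1) M * ed K (M - 1)"
    by fastforce
  define c where "c = min c1 c2"
  have c: "c > 0" "c \<le> c1" "c \<le> c2" using c1 c2 by (auto simp: c_def)
  define \<Delta> where "\<Delta> K M = ed K M - c * V (2 * K + M - 1) M" for K M
  have \<Delta>0: "\<Delta> K 0 \<ge> 0" if "2 * K - 1 \<ge> N0" for K
    using V0[of "2 * K - 1"] that c by (simp add: \<Delta>_def ed_def mult_nonneg_nonpos)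
  have main: "\<Delta> K M \<ge> 0 \<and> (K \<ge> 1 \<longrightarrow> \<Delta> K M \<ge> uf (2 * K + M - 1) M * \<Delta> K (M - 1))"
    if "M \<ge> 1" "2 * K + M - 1 = n" "n \<ge> N0" for K M n
    using that
  proof (induction n arbitrary: K M rule: less_induct)
    case (less n)
    note M = less.prems(1) and n = less.prems(2)
    have nm1: "2 * K + (M - 1) - 1 = n - 1" "2 * K + M - 2 = n - 1" using M n by auto
    show ?case
    proof (cases "n \<le> N0 + 3")
      case True
      then have S: "(K, M) \<in> S" using M n by (simp add: S_def)
      have "K \<ge> 1 \<longrightarrow> \<Delta> K M \<ge> uf (2 * K + M - 1) M * \<Delta> K (M - 1)"
      proof
        assume "K \<ge> 1"
        then have "(K, M) \<in> S'" using S by (simp add: S'_def)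
        from c2(2)[OF this c(1,3)] show "\<Delta> K M \<ge> uf (2 * K + M - 1) M * \<Delta> K (M - 1)"
          using nm1 by (simp add: \<Delta>_def algebra_simps)
      qed
      then show ?thesis using c1(2)[OF S c(1,2)] by (simp add: \<Delta>_def)
    next
      case False
      have IH: "\<Delta> K' M' \<ge> 0" "K' \<ge> 1 \<Longrightarrow> M' \<ge> 1 \<Longrightarrow> \<Delta> K' M' \<ge> uf (2 * K' + M' - 1) M' * \<Delta> K' (M' - 1)"
        if "2 * K' + M' - 1 < n" "2 * K' + M' - 1 \<ge> N0" for K' M'
        using less.IH[of "2 * K' + M' - 1" M' K'] that \<Delta>0[of K'] by (cases "M' = 0"; simp)+
      show ?thesis
      proof (cases "K = 0")
        case True
        \<comment> \<open>For \<open>K = 0\<close> no recurrence is available, but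
          \<open>n = M - 1\<close>, and beyond \<open>n\<close> the function \<open>V\<close> is
          nonpositive.\<close>
        then have "V n M \<le> 0" using n less.prems by (intro Vn) auto
        then have "c * V n M \<le> 0" using c by (simp add: mult_nonneg_nonpos)
        then show ?thesis using True n ed_pos[OF M, of K] by (simp add: \<Delta>_def)
      next
        case False
        then have K: "K \<ge> 1" by simp
        have idx: "2 * (K - 1) + (M + 1) - 1 = n - 1" "2 * (K - 1) + (M - 1) - 1 = n - 3"
          "2 * (K - 1) + M - 1 = n - 2"
          using K M n \<open>\<not> n \<le> N0 + 3\<close> by auto
        have Vi: "V n M \<le> uf n M * V (n - 1) (M - 1) + V (n - 1) (M + 1) - kap n M * V (n - 3) (M - 1)"
          using M \<open>\<not> n \<le> N0 + 3\<close> by (intro ineq) auto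
        have cV: "c * V n M \<le> c * (uf n M * V (n - 1) (M - 1) + V (n - 1) (M + 1) - kap n M * V (n - 3) (M - 1))"
          using Vi c by (intro mult_left_mono) auto
        have "uf n M * \<Delta> K (M - 1) + \<Delta> (K - 1) (M + 1) - kap n M * \<Delta> (K - 1) (M - 1)
           = (uf n M * ed K (M - 1) + ed (K - 1) (M + 1) - kap n M * ed (K - 1) (M - 1))
             - c * (uf n M * V (n - 1) (M - 1) + V (n - 1) (M + 1) - kap n M * V (n - 3) (M - 1))"
          unfolding \<Delta>_def idx nm1 by (simp add: algebra_simps)
        also have "\<dots> \<le> ed K M - c * V n M" using ed_rec[OF M K] cV n by simp
        also have "\<dots> = \<Delta> K M" using n by (simp add: \<Delta>_def)
        finally have step: "uf n M * \<Delta> K (M - 1) + \<Delta> (K - 1) (M + 1) - kap n M * \<Delta> (K - 1) (M - 1) \<le> \<Delta> K M" .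
        have absorb: "kap n M * \<Delta> (K - 1) (M - 1) \<le> \<Delta> (K - 1) (M + 1)"
        proof (cases "K = 1")
          case True
          then have "kap n M = 0" using kap_KM[OF M K] n by simp
          then show ?thesis using IH(1)[of "K - 1" "M + 1"] idx \<open>\<not> n \<le> N0 + 3\<close> by simp
        next
          case False
          then have K2: "K - 1 \<ge> 1" using K by simp
          have u1: "uf (n - 1) (M + 1) = real K / real (K + M - 1)"
            using uf_KM[of "M + 1" "K - 1"] idx(1) K by (simp add: of_nat_diff)
          have u2: "uf (n - 2) M = real K / real (K + M - 2)"
            using uf_KM[of M "K - 1"] idx(3) K M by (simp add: of_nat_diff)
          have D3: "\<Delta> (K - 1) (M - 1) \<ge> 0" using idx \<open>\<not> n \<le> N0 + 3\<close> by (intro IH(1)) auto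
          have "kap n M \<le> uf (n - 1) (M + 1) * uf (n - 2) M"
          proof -
            have "kap n M = (real K - 1) / (real (K + M - 1) * real (K + M - 2))"
              using kap_KM[OF M K] n by simp
            also have "\<dots> \<le> (real K * real K) / (real (K + M - 1) * real (K + M - 2))"
            proof (rule divide_right_mono)
              have "real K * 1 \<le> real K * real K" using K by (intro mult_left_mono) auto
              then show "real K - 1 \<le> real K * real K" by simp
            qed simp
            finally show ?thesis unfolding u1 u2 by (simp only: times_divide_times_eq)
          qed
          then have "kap n M * \<Delta> (K - 1) (M - 1) \<le> uf (n - 1) (M + 1) * uf (n - 2) M * \<Delta> (K - 1) (M - 1)"
            using D3 by (intro mult_right_mono)
          also have "\<dots> = uf (n - 1) (M + 1) * (uf (n - 2) M * \<Delta> (K - 1) (M - 1))" by simp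
          also have "\<dots> \<le> uf (n - 1) (M + 1) * \<Delta> (K - 1) M"
          proof (rule mult_left_mono[OF _ uf_nonneg])
            show "uf (n - 2) M * \<Delta> (K - 1) (M - 1) \<le> \<Delta> (K - 1) M"
              using IH(2)[of "K - 1" M] K2 M idx \<open>\<not> n \<le> N0 + 3\<close> by simp
          qed
          also have "\<dots> \<le> \<Delta> (K - 1) (M + 1)"
            using IH(2)[of "K - 1" "M + 1"] K2 M idx \<open>\<not> n \<le> N0 + 3\<close> by simp
          finally show ?thesis .
        qed
        then have H: "uf n M * \<Delta> K (M - 1) \<le> \<Delta> K M" using step by linarith
        have "0 \<le> uf n M * \<Delta> K (M - 1)"
          using IH(1)[of K "M - 1"] nm1 \<open>\<not> n \<le> N0 + 3\<close> uf_nonneg by simp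
        then show ?thesis using H n by auto
      qed
    qed
  qed
  show ?thesis
  proof (intro exI[of _ c] conjI allI impI c(1))
    fix K M :: nat assume "1 \<le> M" "N0 \<le> 2 * K + M - 1"
    then show "c * V (2 * K + M - 1) M \<le> ed K M" using main[of M K] by (simp add: \<Delta>_def)
  qed
qed

end

section \<open>The growth factor and the explicit sub- and supersolution\<close>

context airy_pos
begin

definition qq :: real where "qq = cc ^ 2 * a1"

text \<open>The last factor makes the quotient of consecutive values differ from \<open>s0\<close> by a term of order \<open>ef n\<close>,
  with the sign opposite to \<open>\<zeta>\<close>.\<close>

definition gf :: "real \<Rightarrow> real \<Rightarrow> nat \<Rightarrow> real" where
  "gf \<sigma> \<zeta> n = 2 ^ n * exp (3/2 * qq * real n powr (1/3)) * real n powr (\<sigma> / 2) * exp (\<zeta> * real n powr (-1/12))"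

lemma gf_pos: "n \<ge> 1 \<Longrightarrow> gf \<sigma> \<zeta> n > 0"
  by (simp add: gf_def)

lemma gf_quotient:
  assumes "n \<ge> 2"
  shows "gf \<sigma> \<zeta> n / gf \<sigma> \<zeta> (n - 1) =
    2 * exp (3/2 * qq * (real n powr (1/3) - (real n - 1) powr (1/3))) * (real n powr (\<sigma> / 2) / (real n - 1) powr (\<sigma> / 2))
     * exp (\<zeta> * (real n powr (-1/12) - (real n - 1) powr (-1/12)))"
proof -
  have "(2::real) ^ n = 2 * 2 ^ (n - 1)" using assms by (cases n) auto
  moreover have "real (n - 1) = real n - 1" using assms by simp
  ultimately show ?thesis
    unfolding gf_def right_diff_distrib exp_diff by simp
qed

lemma gf_ratio_minus:
  "\<forall>\<^sub>F n in sequentially. ef n \<le> s0 \<sigma> n - gf \<sigma> 12 n / gf \<sigma> 12 (n - 1) \<and> s0 \<sigma> n - gf \<sigma> 12 n / gf \<sigma> 12 (n - 1) \<le> 3 * ef n"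
proof -
  let ?f = "\<lambda>n::nat. (2 * exp (3/2 * qq * (real n powr (1/3) - (real n - 1) powr (1/3))) * (real n powr (\<sigma> / 2) / (real n - 1) powr (\<sigma> / 2))
     * exp (12 * (real n powr (-1/12) - (real n - 1) powr (-1/12)))
     - (2 + qq * (real n powr (-1/3)) ^ 2 + \<sigma> * (real n powr (-1/3)) ^ 3)) / ((real n powr (-1/3)) ^ 3 * sqrt (sqrt (real n powr (-1/3))))"
  have lim: "?f \<longlonglongrightarrow> -2" by real_asymp
  have "\<forall>\<^sub>F n in sequentially. -3 < ?f n" "\<forall>\<^sub>F n in sequentially. ?f n < -1"
    by (rule order_tendstoD[OF lim], simp)+
  then show ?thesis using eventually_ge_at_top[of 2]
  proof eventually_elim
    case (elim n)
    have e: "ef n > 0" using hh_pos[of n] elim by (simp add: ef_def)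
    have "?f n = (gf \<sigma> 12 n / gf \<sigma> 12 (n - 1) - s0 \<sigma> n) / ef n"
      using gf_quotient[OF elim(3), of \<sigma> 12] by (simp add: s0_def hh_def ef_def qq_def)
    then show ?case using elim e by (simp add: less_divide_eq divide_less_eq)
  qed
qed

lemma gf_ratio_plus:
  "\<forall>\<^sub>F n in sequentially. ef n \<le> gf \<sigma> (-12) n / gf \<sigma> (-12) (n - 1) - s0 \<sigma> n \<and> gf \<sigma> (-12) n / gf \<sigma> (-12) (n - 1) - s0 \<sigma> n \<le> 3 * ef n"
proof -
  let ?f = "\<lambda>n::nat. (2 * exp (3/2 * qq * (real n powr (1/3) - (real n - 1) powr (1/3))) * (real n powr (\<sigma> / 2) / (real n - 1) powr (\<sigma> / 2))
     * exp (-12 * (real n powr (-1/12) - (real n - 1) powr (-1/12)))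
     - (2 + qq * (real n powr (-1/3)) ^ 2 + \<sigma> * (real n powr (-1/3)) ^ 3)) / ((real n powr (-1/3)) ^ 3 * sqrt (sqrt (real n powr (-1/3))))"
  have lim: "?f \<longlonglongrightarrow> 2" by real_asymp
  have "\<forall>\<^sub>F n in sequentially. 1 < ?f n" "\<forall>\<^sub>F n in sequentially. ?f n < 3"
    by (rule order_tendstoD[OF lim], simp)+
  then show ?thesis using eventually_ge_at_top[of 2]
  proof eventually_elim
    case (elim n)
    have e: "ef n > 0" using hh_pos[of n] elim by (simp add: ef_def)
    have "?f n = (gf \<sigma> (-12) n / gf \<sigma> (-12) (n - 1) - s0 \<sigma> n) / ef n"
      using gf_quotient[OF elim(3), of \<sigma> "-12"] by (simp add: s0_def hh_def ef_def qq_def)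
    then show ?case using elim e by (simp add: less_divide_eq divide_less_eq)
  qed
qed

lemma gf_quotient2:
  assumes "n \<ge> 4"
  shows "gf \<sigma> \<zeta> (n - 3) / gf \<sigma> \<zeta> (n - 1) =
    (1/4) * exp (3/2 * qq * ((real n - 3) powr (1/3) - (real n - 1) powr (1/3))) * ((real n - 3) powr (\<sigma> / 2) / (real n - 1) powr (\<sigma> / 2))
     * exp (\<zeta> * ((real n - 3) powr (-1/12) - (real n - 1) powr (-1/12)))"
proof -
  have "n - 1 = (n - 3) + 2" using assms by simp
  then have "(2::real) ^ (n - 1) = 4 * 2 ^ (n - 3)" by (simp only: power_add) simp
  moreover have "real (n - 1) = real n - 1" "real (n - 3) = real n - 3" using assms by simp_all
  ultimately show ?thesis
    unfolding gf_def right_diff_distrib exp_diff by simp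
qed

lemma sm_gf: "sm 2 (\<lambda>n M. gf \<sigma> 12 (n - 3) / gf \<sigma> 12 (n - 1) - 1/4)"
proof -
  have "(\<lambda>n::nat. (1/4) * exp (3/2 * qq * ((real n - 3) powr (1/3) - (real n - 1) powr (1/3))) * ((real n - 3) powr (\<sigma> / 2) / (real n - 1) powr (\<sigma> / 2))
     * exp (12 * ((real n - 3) powr (-1/12) - (real n - 1) powr (-1/12))) - 1/4) \<in> O(\<lambda>n. (real n powr (-1/3)) ^ 2)"
    by real_asymp
  then obtain C where C: "\<forall>\<^sub>F n in sequentially. norm ((1/4) * exp (3/2 * qq * ((real n - 3) powr (1/3) - (real n - 1) powr (1/3))) * ((real n - 3) powr (\<sigma> / 2) / (real n - 1) powr (\<sigma> / 2))
     * exp (12 * ((real n - 3) powr (-1/12) - (real n - 1) powr (-1/12))) - 1/4) \<le> C * norm ((real n powr (-1/3)) ^ 2)"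
    by (elim landau_o.bigE)
  have "\<forall>\<^sub>F n in sequentially. \<bar>gf \<sigma> 12 (n - 3) / gf \<sigma> 12 (n - 1) - 1/4\<bar> \<le> C * hh n ^ 2"
    using C eventually_ge_at_top[of 4]
  proof eventually_elim
    case (elim n)
    then show ?case unfolding gf_quotient2[OF elim(2)] hh_def by simp
  qed
  then show ?thesis by (rule eventually_swI)
qed

lemma gf_quotient2_le: "\<forall>\<^sub>F n in sequentially. gf \<sigma> 12 (n - 3) / gf \<sigma> 12 (n - 1) \<le> 1"
proof -
  let ?f = "\<lambda>n::nat. (1/4) * exp (3/2 * qq * ((real n - 3) powr (1/3) - (real n - 1) powr (1/3))) * ((real n - 3) powr (\<sigma> / 2) / (real n - 1) powr (\<sigma> / 2))
     * exp (12 * ((real n - 3) powr (-1/12) - (real n - 1) powr (-1/12)))"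
  have lim: "?f \<longlonglongrightarrow> 1/4" by real_asymp
  have "\<forall>\<^sub>F n in sequentially. ?f n < 1" by (rule order_tendstoD[OF lim]) simp
  then show ?thesis using eventually_ge_at_top[of 4]
  proof eventually_elim
    case (elim n)
    show ?case using less_imp_le[OF elim(1)] unfolding gf_quotient2[OF elim(2)] .
  qed
qed

lemma kap_le_1: "kap n M \<le> 1" if "n \<ge> 5"
proof -
  have "2 \<le> n + M - 3" using that by arith
  then have "2 \<le> real (n + M - 3)" by linarith
  then have "2 * real (n - M - 1) \<le> real (n + M - 3) * real (n + M - 1)" by (intro mult_mono) auto
  then show ?thesis unfolding kap_def by (intro divide_le_eq_1[THEN iffD2]) (auto simp: mult.commute)
qed

lemma sm_kap: "sm 5 (\<lambda>n M. kap n M - 2 * hh n ^ 3)"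
proof -
  have "sm (5 + 0) (\<lambda>n M. hh n ^ 5 * (14 * xx n M))" by (intro sm_mult sm_hpow sm0_intros)
  then have "sm 5 (\<lambda>n M. hh n ^ 5 * (14 * xx n M))" by simp
  then show ?thesis
  proof (rule sw_bound[where ?n1.0 = 4 and E = 0])
    fix n M :: nat assume n: "4 \<le> n" and r: "rg 0 n M"
    define a m where "a = real n" and "m = real M"
    have M: "M \<ge> 1" using r by (simp add: rg_def)
    have am: "a \<ge> 4" "m \<ge> 1" using n M by (auto simp: a_def m_def)
    have "hh n ^ 5 * (14 * xx n M) = 14 * m * (hh n ^ 3 * hh n ^ 3)"
      by (simp add: xx_def m_def eval_nat_numeral)
    also have "\<dots> = 14 * m / a ^ 2" using hh_cube[of n] n by (simp add: a_def power2_eq_square)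
    finally have R: "hh n ^ 5 * (14 * xx n M) = 14 * m / a ^ 2" .
    have h3: "2 * hh n ^ 3 = 2 / a" using hh_cube[of n] n by (simp add: a_def)
    have R0: "14 * m / a ^ 2 \<ge> 0" using am by simp
    have "kap n M \<le> 2 / a + 14 * m / a ^ 2"
    proof -
      have "kap n M \<le> 2 * real (n + M - 1) / (real (n + M - 1) * real (n + M - 3))"
        unfolding kap_def by (intro divide_right_mono mult_left_mono) auto
      also have "\<dots> = 2 / real (n + M - 3)"
      proof -
        have "2 * A / (A * B) = 2 / B" if "A \<noteq> 0" for A B :: real using that by simp
        moreover have "real (n + M - 1) \<noteq> 0" using n by simp
        ultimately show ?thesis by blast
      qed
      also have "\<dots> = 2 / (a + m - 3)" using n M by (simp add: a_def m_def of_nat_diff)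
      also have "\<dots> \<le> 2 / (a - 2)" using am by (intro divide_left_mono) auto
      also have "\<dots> = 2 / a + 4 / (a * (a - 2))" using am by (simp add: field_simps)
      also have "4 / (a * (a - 2)) \<le> 4 / (a * (a / 2))" using am by (intro divide_left_mono mult_left_mono mult_pos_pos) auto
      also have "4 / (a * (a / 2)) = 8 / a ^ 2" using am by (simp add: power2_eq_square)
      also have "8 / a ^ 2 \<le> 14 * m / a ^ 2" using am by (intro divide_right_mono) auto
      finally show ?thesis by simp
    qed
    moreover have "2 / a - 14 * m / a ^ 2 \<le> kap n M"
    \<comment> \<open>For \<open>a <= 7 m\<close> the left side is nonpositive and
      \<open>kap >= 0\<close> suffices. Otherwise \<open>M + 1 <= n\<close>, so the subtraction in
      \<open>kap\<close> is exact.\<close>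
    proof (cases "a \<le> 7 * m")
      case True
      have "2 / a - 14 * m / a ^ 2 = 2 * (a - 7 * m) / a ^ 2" using am by (simp add: field_simps power2_eq_square)
      also have "\<dots> \<le> 0" using True by (intro divide_nonpos_nonneg) auto
      finally show ?thesis using kap_nonneg[of n M] by linarith
    next
      case False
      then have Mn: "M + 1 \<le> n" using n M unfolding a_def m_def by linarith
      have "(a - 7 * m) * (a + m) ^ 2 \<le> (a - m - 1) * a ^ 2"
      proof -
        have "(a - m - 1) * a ^ 2 - (a - 7 * m) * (a + m) ^ 2 = (4 * m - 1) * a ^ 2 + 13 * a * m ^ 2 + 7 * m ^ 3"
          by algebra
        moreover have "\<dots> \<ge> 0" using am by (intro add_nonneg_nonneg mult_nonneg_nonneg) auto
        ultimately show ?thesis by linarith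
      qed
      then have "(a - 7 * m) / a ^ 2 \<le> (a - m - 1) / (a + m) ^ 2"
        using am by (simp add: divide_le_eq le_divide_eq mult.commute add_pos_pos)
      also have "\<dots> \<le> (a - m - 1) / ((a + m - 1) * (a + m - 3))"
      proof (rule divide_left_mono)
        show "(a + m - 1) * (a + m - 3) \<le> (a + m)\<^sup>2"
          unfolding power2_eq_square using am by (intro mult_mono) auto
        show "0 \<le> a - m - 1" using Mn by (simp add: a_def m_def)
        show "0 < (a + m)\<^sup>2 * ((a + m - 1) * (a + m - 3))" using am by (intro mult_pos_pos) auto
      qed
      finally have "2 * ((a - 7 * m) / a ^ 2) \<le> 2 * ((a - m - 1) / ((a + m - 1) * (a + m - 3)))"
        by (rule mult_left_mono) simp
      also have "\<dots> = kap n M" using n M Mn by (simp add: kap_def a_def m_def of_nat_diff)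
      also have "2 * ((a - 7 * m) / a ^ 2) = 2 / a - 14 * m / a ^ 2" using am by (simp add: field_simps power2_eq_square)
      finally show ?thesis .
    qed
    ultimately show "\<bar>kap n M - 2 * hh n ^ 3\<bar> \<le> \<bar>hh n ^ 5 * (14 * xx n M)\<bar>"
      unfolding R h3 using R0 by linarith
  qed
qed

text \<open>Measured in units of \<open>gf (n - 1)\<close>, the term at time \<open>n - 3\<close>
  gains a quotient tending to \<open>1/4\<close>. With \<open>kap\<close> about
  \<open>2 h ^ 3\<close> this gives \<open>h ^ 3 / 2\<close>, the case
  \<open>\<theta> = 1\<close>.\<close>

definition kpf :: "real \<Rightarrow> nat \<Rightarrow> nat \<Rightarrow> real" where
  "kpf \<sigma> n M = kap n M * (gf \<sigma> 12 (n - 3) / gf \<sigma> 12 (n - 1))"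

lemma sm_kpf: "sm 5 (\<lambda>n M. kpf \<sigma> n M - 1 * (1/2) * hh n ^ 3)"
proof -
  have k3: "sm 3 kap"
  proof (rule sm_of_approx[OF sm_kap])
    show "sm 3 (\<lambda>n M. 2 * hh n ^ 3)" using sm_mult[OF sm_const[of 2] sm_hpow[of 3]] by simp
  qed simp
  have "sm (3 + 2) (\<lambda>n M. kap n M * (gf \<sigma> 12 (n - 3) / gf \<sigma> 12 (n - 1) - 1/4))"
    by (intro sm_mult k3 sm_gf)
  moreover have "sm (5 + 0) (\<lambda>n M. (kap n M - 2 * hh n ^ 3) * (1/4))"
    by (intro sm_mult sm_kap sm_const)
  ultimately have "sm 5 (\<lambda>n M. kap n M * (gf \<sigma> 12 (n - 3) / gf \<sigma> 12 (n - 1) - 1/4) + (kap n M - 2 * hh n ^ 3) * (1/4))"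
    by (intro sw_add) auto
  then show ?thesis
    by (rule sw_cong[where ?n1.0 = 0 and E = 0]) (simp add: kpf_def algebra_simps)
qed

text \<open>The constants are the values of \<open>\<sigma>\<close> and \<open>b\<close>:
  \<open>8/3\<close> and \<open>11/6\<close> for \<open>\<theta> = 0\<close> here,
  \<open>13/6\<close> and \<open>19/12\<close> for \<open>\<theta> = 1\<close> in \<open>Vm\<close>.
  The supersolution grows slightly faster than \<open>s0\<close> and adds \<open>Zf\<close>; the
  subsolution does the opposite in both respects.\<close>

definition Vp :: "nat \<Rightarrow> nat \<Rightarrow> real" where
  "Vp n M = gf (8/3) (-12) n * (Y (11/6) n (real M) + Zf n)"

definition Vm :: "nat \<Rightarrow> nat \<Rightarrow> real" where
  "Vm n M = gf (13/6) 12 n * (Y (19/12) n (real M) - Zf n)"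

text \<open>This is \<open>barrier\<close> for \<open>e = \<rho> - s0\<close>, the excess of the
  growth quotient over the expected rate.\<close>

lemma Vp_super: "\<forall>\<^sub>F n in sequentially. \<forall>M. M \<ge> 1 \<longrightarrow> uf n M * Vp (n - 1) (M - 1) + Vp (n - 1) (M + 1) \<le> Vp n M"
proof -
  have "sm 5 (\<lambda>n M. (0::real) - 0 * (1/2) * hh n ^ 3)"
    by (rule swI[of 0 0 0]) auto
  then have bar: "\<forall>\<^sub>F n in sequentially. \<forall>M e. M \<ge> 1 \<longrightarrow> ef n \<le> e \<longrightarrow> e \<le> 3 * ef n \<longrightarrow>
    \<bar>DF (11/6) (8/3) (\<lambda>_ _. 0) n M\<bar> \<le> e * Y (11/6) n (real M) + ((s0 (8/3) n - 3 * ef n) * Zf n - (uf n M + 1) * Zf (n - 1))"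
    by (rule barrier) auto
  show ?thesis
    using bar gf_ratio_plus[of "8/3"] eventually_ge_at_top[of 2]
  proof eventually_elim
    case (elim n)
    show ?case
    proof (intro allI impI)
      fix M :: nat assume M: "M \<ge> 1"
      define \<rho> where "\<rho> = gf (8/3) (-12) n / gf (8/3) (-12) (n - 1)"
      have g: "gf (8/3) (-12) (n - 1) > 0" using elim by (intro gf_pos) simp
      have \<rho>: "ef n \<le> \<rho> - s0 (8/3) n" "\<rho> - s0 (8/3) n \<le> 3 * ef n" using elim(2) by (auto simp: \<rho>_def)
      have B: "\<bar>DF (11/6) (8/3) (\<lambda>_ _. 0) n M\<bar> \<le> (\<rho> - s0 (8/3) n) * Y (11/6) n (real M) + ((s0 (8/3) n - 3 * ef n) * Zf n - (uf n M + 1) * Zf (n - 1))"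
        using elim(1) M \<rho> by blast
      have "(s0 (8/3) n - 3 * ef n) * Zf n \<le> \<rho> * Zf n"
        using \<rho> ef_nonneg[of n] Zf_nonneg by (intro mult_right_mono) auto
      moreover have "DF (11/6) (8/3) (\<lambda>_ _. 0) n M = uf n M * Y (11/6) (n - 1) (real M - 1) + Y (11/6) (n - 1) (real M + 1) - s0 (8/3) n * Y (11/6) n (real M)"
        by (simp add: DF_def)
      ultimately have "uf n M * (Y (11/6) (n - 1) (real M - 1) + Zf (n - 1)) + (Y (11/6) (n - 1) (real M + 1) + Zf (n - 1)) \<le> \<rho> * (Y (11/6) n (real M) + Zf n)"
        using B abs_ge_self[of "DF (11/6) (8/3) (\<lambda>_ _. 0) n M"] by (simp add: algebra_simps)
      then have "gf (8/3) (-12) (n - 1) * (uf n M * (Y (11/6) (n - 1) (real M - 1) + Zf (n - 1)) + (Y (11/6) (n - 1) (real M + 1) + Zf (n - 1)))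
         \<le> gf (8/3) (-12) (n - 1) * (\<rho> * (Y (11/6) n (real M) + Zf n))"
        using g by (intro mult_left_mono) auto
      also have "\<dots> = Vp n M" using g by (simp add: \<rho>_def Vp_def)
      finally show "uf n M * Vp (n - 1) (M - 1) + Vp (n - 1) (M + 1) \<le> Vp n M"
        using M by (simp add: Vp_def of_nat_diff algebra_simps)
    qed
  qed
qed

lemma Vm_sub: "\<forall>\<^sub>F n in sequentially. \<forall>M. M \<ge> 1 \<longrightarrow>
  Vm n M \<le> uf n M * Vm (n - 1) (M - 1) + Vm (n - 1) (M + 1) - kap n M * Vm (n - 3) (M - 1)"
proof -
  have kp1: "\<forall>\<^sub>F n in sequentially. \<forall>M. \<bar>kpf (13/6) n M\<bar> \<le> 1"
    using gf_quotient2_le[of "13/6"] eventually_ge_at_top[of 5]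
  proof eventually_elim
    case (elim n)
    have "gf (13/6) 12 (n - 3) > 0" "gf (13/6) 12 (n - 1) > 0" by (rule gf_pos; use elim in simp)+
    then have r0: "gf (13/6) 12 (n - 3) / gf (13/6) 12 (n - 1) \<ge> 0" by simp
    show ?case
    proof
      fix M
      have "kpf (13/6) n M \<le> 1 * 1"
        unfolding kpf_def using r0 elim(1) kap_le_1[OF elim(2)] kap_nonneg by (intro mult_mono) auto
      moreover have "kpf (13/6) n M \<ge> 0" unfolding kpf_def using r0 kap_nonneg by (intro mult_nonneg_nonneg)
      ultimately show "\<bar>kpf (13/6) n M\<bar> \<le> 1" by simp
    qed
  qed
  have bar: "\<forall>\<^sub>F n in sequentially. \<forall>M e. M \<ge> 1 \<longrightarrow> ef n \<le> e \<longrightarrow> e \<le> 3 * ef n \<longrightarrow>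
    \<bar>DF (19/12) (13/6) (kpf (13/6)) n M\<bar> \<le> e * Y (19/12) n (real M) + ((s0 (13/6) n - 3 * ef n) * Zf n - (uf n M + 1) * Zf (n - 1))"
    by (rule barrier[OF sm_kpf _ _ kp1]) auto
  show ?thesis
    using bar gf_ratio_minus[of "13/6"] eventually_ge_at_top[of 4]
  proof eventually_elim
    case (elim n)
    show ?case
    proof (intro allI impI)
      fix M :: nat assume M: "M \<ge> 1"
      define \<rho> where "\<rho> = gf (13/6) 12 n / gf (13/6) 12 (n - 1)"
      define Y0 Y1 Y2 Y3 where "Y0 = Y (19/12) n (real M)" and "Y1 = Y (19/12) (n - 1) (real M - 1)"
        and "Y2 = Y (19/12) (n - 1) (real M + 1)" and "Y3 = Y (19/12) (n - 3) (real M - 1)"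
      have g: "gf (13/6) 12 (n - 1) > 0" "gf (13/6) 12 (n - 3) > 0" using elim by (intro gf_pos; simp)+
      have \<rho>: "ef n \<le> s0 (13/6) n - \<rho>" "s0 (13/6) n - \<rho> \<le> 3 * ef n" using elim(2) by (auto simp: \<rho>_def)
      have B: "\<bar>DF (19/12) (13/6) (kpf (13/6)) n M\<bar> \<le> (s0 (13/6) n - \<rho>) * Y0 + ((s0 (13/6) n - 3 * ef n) * Zf n - (uf n M + 1) * Zf (n - 1))"
        using elim(1) M \<rho> unfolding Y0_def by blast
      have "(s0 (13/6) n - 3 * ef n) * Zf n \<le> \<rho> * Zf n"
        using \<rho> Zf_nonneg by (intro mult_right_mono) auto
      \<comment> \<open>Subtracting \<open>Zf\<close> inside the negative term gives a nonnegative
        contribution, which may be discarded.\<close>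
      moreover have "kpf (13/6) n M * Zf (n - 3) \<ge> 0"
        using kap_nonneg g Zf_nonneg unfolding kpf_def by (intro mult_nonneg_nonneg divide_nonneg_pos) auto
      moreover have "DF (19/12) (13/6) (kpf (13/6)) n M = uf n M * Y1 + Y2 - kpf (13/6) n M * Y3 - s0 (13/6) n * Y0"
        by (simp add: DF_def Y0_def Y1_def Y2_def Y3_def)
      ultimately have "\<rho> * (Y0 - Zf n) \<le> uf n M * (Y1 - Zf (n - 1)) + (Y2 - Zf (n - 1)) - kpf (13/6) n M * (Y3 - Zf (n - 3))"
        using B abs_ge_minus_self[of "DF (19/12) (13/6) (kpf (13/6)) n M"] by (simp add: algebra_simps)
      then have le: "gf (13/6) 12 (n - 1) * (\<rho> * (Y0 - Zf n)) \<le> gf (13/6) 12 (n - 1) * (uf n M * (Y1 - Zf (n - 1)) + (Y2 - Zf (n - 1)) - kpf (13/6) n M * (Y3 - Zf (n - 3)))"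
        using g by (intro mult_left_mono) auto
      have "Vm n M = gf (13/6) 12 (n - 1) * (\<rho> * (Y0 - Zf n))" using g by (simp add: \<rho>_def Vm_def Y0_def)
      also note le
      also have "gf (13/6) 12 (n - 1) * (uf n M * (Y1 - Zf (n - 1)) + (Y2 - Zf (n - 1)) - kpf (13/6) n M * (Y3 - Zf (n - 3)))
         = uf n M * (gf (13/6) 12 (n - 1) * (Y1 - Zf (n - 1))) + gf (13/6) 12 (n - 1) * (Y2 - Zf (n - 1))
           - (gf (13/6) 12 (n - 1) * kpf (13/6) n M) * (Y3 - Zf (n - 3))"
        by (simp add: algebra_simps)
      also have "gf (13/6) 12 (n - 1) * kpf (13/6) n M = kap n M * gf (13/6) 12 (n - 3)"
        using g by (simp add: kpf_def)
      finally show "Vm n M \<le> uf n M * Vm (n - 1) (M - 1) + Vm (n - 1) (M + 1) - kap n M * Vm (n - 3) (M - 1)"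
        using M by (simp add: Vm_def Y1_def Y2_def Y3_def of_nat_diff mult.assoc add.commute[of 1 "real M"])
    qed
  qed
qed

section \<open>From the comparison to bounds for the two counting sequences at
  \<open>M = 1\<close>\<close>

lemma wd_upper: "\<exists>C>0. \<exists>n0. \<forall>n\<ge>n0. wd n 1 \<le> C * Vp (2 * n) 1"
proof -
  have b0: "(0::real) \<le> 11/6" by simp
  have "\<forall>\<^sub>F n in sequentially. \<forall>M. Vp n M > 0"
    using Y_neg_part[OF b0] eventually_ge_at_top[of 1]
  proof eventually_elim
    case (elim n)
    have Z: "Zf n > 0" using elim by (simp add: Zf_def)
    have "Y (11/6) n (real M) + Zf n > 0" for M using elim(1) Z by (smt (verit) field_sum_of_halves)
    then show ?case using gf_pos[OF elim(2)] by (simp add: Vp_def)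
  qed
  then obtain n1 where n1: "\<And>n M. n \<ge> n1 \<Longrightarrow> Vp n M > 0" unfolding eventually_sequentially by blast
  obtain n2 where n2: "\<And>n M. n \<ge> n2 \<Longrightarrow> M \<ge> 1 \<Longrightarrow> uf n M * Vp (n - 1) (M - 1) + Vp (n - 1) (M + 1) \<le> Vp n M"
    using Vp_super unfolding eventually_sequentially by blast
  have "\<exists>C>0. \<forall>K M. M \<ge> 1 \<longrightarrow> 2 * K + M - 1 \<ge> max n1 n2 \<longrightarrow> wd K M \<le> C * Vp (2 * K + M - 1) M"
    by (rule super_compare) (use n1 n2 in auto)
  then obtain C where C: "C > 0" "\<And>K M. M \<ge> 1 \<Longrightarrow> 2 * K + M - 1 \<ge> max n1 n2 \<Longrightarrow> wd K M \<le> C * Vp (2 * K + M - 1) M"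
    by blast
  have "wd n 1 \<le> C * Vp (2 * n) 1" if "n \<ge> max n1 n2" for n using C(2)[of 1 n] that by simp
  then show ?thesis using C(1) by blast
qed

lemma ed_lower: "\<exists>c>0. \<exists>n0. \<forall>n\<ge>n0. c * Vm (2 * n) 1 \<le> ed n 1"
proof -
  have b0: "(0::real) \<le> 19/12" by simp
  have "\<forall>\<^sub>F n in sequentially. Vm n 0 \<le> 0 \<and> (\<forall>M. M \<ge> n \<longrightarrow> Vm n M \<le> 0)"
    using Y_neg_part[OF b0] eventually_ge_at_top[of 1]
  proof eventually_elim
    case (elim n)
    have g: "gf (13/6) 12 n \<ge> 0" using gf_pos[OF elim(2)] less_imp_le by blast
    have Z: "Zf n \<ge> 0" by (rule Zf_nonneg)
    have "Vm n 0 \<le> 0" using g Z unfolding Vm_def of_nat_0 Y_0 by (intro mult_nonneg_nonpos) auto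
    moreover have "Vm n M \<le> 0" if "M \<ge> n" for M
    proof -
      have "Y (19/12) n (real M) \<le> Zf n / 2" using elim(1) that by blast
      then show ?thesis using g Z unfolding Vm_def by (intro mult_nonneg_nonpos) auto
    qed
    ultimately show ?case by blast
  qed
  then obtain n1 where n1: "\<And>n. n \<ge> n1 \<Longrightarrow> Vm n 0 \<le> 0" "\<And>n M. n \<ge> n1 \<Longrightarrow> M \<ge> n \<Longrightarrow> Vm n M \<le> 0"
    unfolding eventually_sequentially by blast
  obtain n2 where n2: "\<And>n M. n \<ge> n2 \<Longrightarrow> M \<ge> 1 \<Longrightarrow>
      Vm n M \<le> uf n M * Vm (n - 1) (M - 1) + Vm (n - 1) (M + 1) - kap n M * Vm (n - 3) (M - 1)"
    using Vm_sub unfolding eventually_sequentially by blast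
  have "\<exists>c>0. \<forall>K M. M \<ge> 1 \<longrightarrow> 2 * K + M - 1 \<ge> max 1 (max n1 n2) \<longrightarrow> c * Vm (2 * K + M - 1) M \<le> ed K M"
    by (rule sub_compare) (use n1 n2 in auto)
  then obtain c where c: "c > 0" "\<And>K M. M \<ge> 1 \<Longrightarrow> 2 * K + M - 1 \<ge> max 1 (max n1 n2) \<Longrightarrow> c * Vm (2 * K + M - 1) M \<le> ed K M"
    by blast
  have "c * Vm (2 * n) 1 \<le> ed n 1" if "n \<ge> max 1 (max n1 n2)" for n using c(2)[of 1 n] that by simp
  then show ?thesis using c(1) by blast
qed

lemma gf_double:
  assumes "n \<ge> 1"
  shows "gf \<sigma> \<zeta> (2 * n) = 4 ^ n * exp (3 * a1 * real n powr (1/3)) * (2 * real n) powr (\<sigma> / 2) * exp (\<zeta> * (2 * real n) powr (-1/12))"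
proof -
  have "cc = 2 powr (1/3)" by (simp add: cc_def root_powr_inverse)
  then have "real (2 * n) powr (1/3) = cc * real n powr (1/3)" by (simp add: powr_mult)
  then have "3/2 * qq * real (2 * n) powr (1/3) = 3/2 * (cc ^ 3) * a1 * real n powr (1/3)"
    by (simp add: qq_def eval_nat_numeral)
  also have "\<dots> = 3 * a1 * real n powr (1/3)" unfolding cc by simp
  finally show ?thesis by (simp add: gf_def power_mult)
qed

lemma Y_1_upper: "\<exists>C>0. \<forall>n\<ge>1. Y (11/6) n 1 + Zf n \<le> C * hh n"
proof -
  have "\<exists>B. \<forall>x. a1 \<le> x \<and> x \<le> a1 + 2 \<longrightarrow> F' x \<le> B"
    using isCont_bounded[of a1 "a1 + 2" F'] isCont_F by simp
  then obtain B where B: "\<And>x. a1 \<le> x \<Longrightarrow> x \<le> a1 + 2 \<Longrightarrow> F' x \<le> B" by blast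
  have B0: "B > 0" using B[of a1] F'_root by simp
  have F_le: "F (a1 + y) \<le> B * y" if "0 \<le> y" "y \<le> 2" for y
  proof -
    have "B * (a1 - a1) - F a1 \<le> B * (a1 + y - a1) - F (a1 + y)"
    proof (rule deriv_mono[of a1 "a1 + y" "\<lambda>x. B * (x - a1) - F x" "\<lambda>x. B - F' x"])
      fix x assume "a1 \<le> x" "x \<le> a1 + y"
      then show "0 \<le> B - F' x" using B[of x] that by simp
      show "((\<lambda>x. B * (x - a1) - F x) has_real_derivative B - F' x) (at x)"
        by (auto intro!: derivative_eq_intros)
    qed (use that in simp)
    then show ?thesis using F_root by simp
  qed
  have "Y (11/6) n 1 + Zf n \<le> (6 * B + 1) * hh n" if n: "n \<ge> 1" for n
  proof -
    have h: "hh n > 0" "hh n \<le> 1" using hh_pos hh_le_1 n by auto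
    have "cc * hh n \<le> 2 * hh n" using cc h by (intro mult_right_mono) auto
    then have "cc * hh n \<le> 2" using h by linarith
    then have "F (a1 + cc * hh n) \<le> B * (cc * hh n)" using cc h by (intro F_le) auto
    also have "\<dots> \<le> B * (2 * hh n)" using \<open>cc * hh n \<le> 2 * hh n\<close> B0 by (intro mult_left_mono) auto
    finally have F2: "F (a1 + cc * hh n) \<le> 2 * B * hh n" by simp
    have F0: "F (a1 + cc * hh n) \<ge> 0" using cc h by (intro F_nonneg) auto
    have "Y (11/6) n 1 = (1 + 7 / 6 / real n) * F (a1 + cc * hh n)" by (simp add: Y_def)
    also have "\<dots> \<le> 3 * F (a1 + cc * hh n)"
    proof (rule mult_right_mono[OF _ F0])
      have "7 / 6 / real n \<le> 7 / 6 / 1" using n by (intro divide_left_mono) auto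
      then show "1 + 7 / 6 / real n \<le> 3" by simp
    qed
    also have "\<dots> \<le> 3 * (2 * B * hh n)" using F2 by simp
    finally have "Y (11/6) n 1 \<le> 6 * B * hh n" by simp
    moreover have "Zf n \<le> hh n"
    proof -
      have "hh n ^ 6 \<le> hh n ^ 1" using h by (intro power_decreasing) auto
      then show ?thesis using Zf_eq[OF n] by simp
    qed
    ultimately show ?thesis by (simp add: algebra_simps)
  qed
  then show ?thesis using B0 by (intro exI[of _ "6 * B + 1"]) auto
qed

lemma Y_1_lower: "\<exists>c>0. \<forall>\<^sub>F n in sequentially. c * hh n \<le> Y (19/12) n 1 - Zf n"
proof -
  obtain c where c: "c > 0" "\<And>y. 0 \<le> y \<Longrightarrow> y \<le> 2 \<Longrightarrow> c * y \<le> F (a1 + y)" using F_lower[of 2] by blast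
  have "\<forall>\<^sub>F n in sequentially. 1 * hh n \<le> c / 2" by (rule hh_eventually_le) (use c in simp)
  then have "\<forall>\<^sub>F n in sequentially. c / 2 * hh n \<le> Y (19/12) n 1 - Zf n"
    using eventually_ge_at_top[of 1]
  proof eventually_elim
    case (elim n)
    have h: "hh n > 0" "hh n \<le> 1" using hh_pos hh_le_1 elim by auto
    have "cc * hh n \<le> 2 * hh n" using cc h by (intro mult_right_mono) auto
    then have "cc * hh n \<le> 2" using h by linarith
    then have "c * (cc * hh n) \<le> F (a1 + cc * hh n)" using cc h by (intro c) auto
    moreover have "c * (1 * hh n) \<le> c * (cc * hh n)" using cc c h by (intro mult_left_mono mult_right_mono) auto
    ultimately have F1: "c * hh n \<le> F (a1 + cc * hh n)" by simp
    have F0: "F (a1 + cc * hh n) \<ge> 0" using cc h by (intro F_nonneg) auto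
    have "1 * F (a1 + cc * hh n) \<le> (1 + 11 / 12 / real n) * F (a1 + cc * hh n)"
      using F0 by (intro mult_right_mono) auto
    also have "\<dots> = Y (19/12) n 1" by (simp add: Y_def)
    finally have "c * hh n \<le> Y (19/12) n 1" using F1 by simp
    moreover have "Zf n \<le> c / 2 * hh n"
    proof -
      have "hh n ^ 6 \<le> hh n ^ 2" using h by (intro power_decreasing) auto
      also have "\<dots> \<le> c / 2 * hh n" using elim h by (simp add: power2_eq_square)
      finally show ?thesis using Zf_eq elim by simp
    qed
    ultimately show ?case by simp
  qed
  then show ?thesis using c by (intro exI[of _ "c / 2"]) auto
qed

lemma w_num_upper:
  "\<exists>C>0. \<exists>n0. \<forall>n\<ge>n0. real (w_num n 1) \<le> C * (fact n * 4 ^ n * exp (3 * a1 * real n powr (1/3)) * real n)"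
proof -
  obtain C n1 where C: "C > 0" "\<And>n. n \<ge> n1 \<Longrightarrow> wd n 1 \<le> C * Vp (2 * n) 1" using wd_upper by blast
  obtain D where D: "D > 0" "\<And>n. n \<ge> 1 \<Longrightarrow> Y (11/6) n 1 + Zf n \<le> D * hh n" using Y_1_upper by blast
  have "real (w_num n 1) \<le> 2 * C * D * (fact n * 4 ^ n * exp (3 * a1 * real n powr (1/3)) * real n)" if n: "n \<ge> max n1 1" for n
  proof -
    define E where "E = 4 ^ n * exp (3 * a1 * real n powr (1/3))"
    have E: "E > 0" by (simp add: E_def)
    have n1: "n \<ge> 1" "2 * n \<ge> 1" using n by auto
    have "gf (8/3) (-12) (2 * n) \<le> E * (2 * real n) powr (4/3)"
    proof -
      have "gf (8/3) (-12) (2 * n) = E * (2 * real n) powr (4/3) * exp (-12 * (2 * real n) powr (-1/12))"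
        unfolding gf_double[OF n1(1)] E_def by simp
      also have "\<dots> \<le> E * (2 * real n) powr (4/3) * 1" using E by (intro mult_left_mono) auto
      finally show ?thesis by simp
    qed
    then have "gf (8/3) (-12) (2 * n) * (D * hh (2 * n)) \<le> (E * (2 * real n) powr (4/3)) * (D * hh (2 * n))"
      using D hh_nonneg by (intro mult_right_mono) auto
    moreover have "Vp (2 * n) 1 \<le> gf (8/3) (-12) (2 * n) * (D * hh (2 * n))"
      unfolding Vp_def of_nat_1 using D(2)[OF n1(2)] gf_pos[OF n1(2), of "8/3" "-12"] by (intro mult_left_mono) auto
    ultimately have "Vp (2 * n) 1 \<le> (E * (2 * real n) powr (4/3)) * (D * hh (2 * n))" by linarith
    also have "\<dots> = E * D * ((2 * real n) powr (4/3) * (2 * real n) powr (-1/3))"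
      by (simp add: hh_def)
    also have "(2 * real n) powr (4/3) * (2 * real n) powr (-1/3) = 2 * real n"
      using n1 by (simp flip: powr_add)
    finally have V: "Vp (2 * n) 1 \<le> E * D * (2 * real n)" .
    have "real (w_num n 1) = fact n * wd n 1" by (simp add: wd_def)
    also have "\<dots> \<le> fact n * (C * Vp (2 * n) 1)" using C(2)[of n] n by (intro mult_left_mono) auto
    also have "\<dots> \<le> fact n * (C * (E * D * (2 * real n)))" using V C by (intro mult_left_mono) auto
    finally show ?thesis by (simp add: E_def mult_ac)
  qed
  then show ?thesis using C D by (intro exI[of _ "2 * C * D"] conjI exI[of _ "max n1 1"]) auto
qed

lemma e_num_lower:
  "\<exists>c>0. \<exists>n0. \<forall>n\<ge>n0. c * (fact n * 4 ^ n * exp (3 * a1 * real n powr (1/3)) * real n powr (3/4)) \<le> real (e_num n 1)"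
proof -
  obtain c n1 where c: "c > 0" "\<And>n. n \<ge> n1 \<Longrightarrow> c * Vm (2 * n) 1 \<le> ed n 1" using ed_lower by blast
  obtain d n2 where d: "d > 0" "\<And>n. n \<ge> n2 \<Longrightarrow> d * hh n \<le> Y (19/12) n 1 - Zf n"
    using Y_1_lower unfolding eventually_sequentially by blast
  have "c * d * (fact n * 4 ^ n * exp (3 * a1 * real n powr (1/3)) * real n powr (3/4)) \<le> real (e_num n 1)" if n: "n \<ge> max (max n1 n2) 1" for n
  proof -
    define E where "E = 4 ^ n * exp (3 * a1 * real n powr (1/3))"
    have E: "E > 0" by (simp add: E_def)
    have n1: "n \<ge> 1" "2 * n \<ge> 1" using n by auto
    have g: "E * (2 * real n) powr (13/12) \<le> gf (13/6) 12 (2 * n)"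
    proof -
      have "E * (2 * real n) powr (13/12) * 1 \<le> E * (2 * real n) powr (13/12) * exp (12 * (2 * real n) powr (-1/12))"
        using E by (intro mult_left_mono) auto
      also have "\<dots> = gf (13/6) 12 (2 * n)"
        unfolding gf_double[OF n1(1)] E_def by simp
      finally show ?thesis by simp
    qed
    have "E * d * real n powr (3/4) \<le> E * d * (2 * real n) powr (3/4)"
      using E d by (intro mult_left_mono powr_mono2) auto
    also have "(2 * real n) powr (3/4) = (2 * real n) powr (13/12) * (2 * real n) powr (-1/3)"
      by (simp flip: powr_add)
    also have "E * d * ((2 * real n) powr (13/12) * (2 * real n) powr (-1/3)) = (E * (2 * real n) powr (13/12)) * (d * hh (2 * n))"
      by (simp add: hh_def)
    also have "\<dots> \<le> gf (13/6) 12 (2 * n) * (Y (19/12) (2 * n) 1 - Zf (2 * n))"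
      using g d E n gf_pos[OF n1(2), of "13/6" 12] hh_nonneg by (intro mult_mono) auto
    also have "\<dots> = Vm (2 * n) 1" by (simp add: Vm_def)
    finally have V: "E * d * real n powr (3/4) \<le> Vm (2 * n) 1" .
    have "fact n * (c * (E * d * real n powr (3/4))) \<le> fact n * (c * Vm (2 * n) 1)" using V c by (intro mult_left_mono) auto
    also have "\<dots> \<le> fact n * ed n 1" using c(2)[of n] n by (intro mult_left_mono) auto
    also have "\<dots> = real (e_num n 1)" by (simp add: ed_def)
    finally show ?thesis by (simp add: E_def mult_ac)
  qed
  then show ?thesis using c d by (intro exI[of _ "c * d"] conjI exI[of _ "max (max n1 n2) 1"]) auto
qed

end

lemma w_num_upper_Ai:
  "\<exists>C>0. \<exists>n0. \<forall>n\<ge>n0. real (w_num n 1) \<le> C * (fact n * 4 ^ n * exp (3 * airy_a1 * real n powr (1/3)) * real n)"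
  using airy_pos_Ai airy_pos.w_num_upper by blast

lemma e_num_lower_Ai:
  "\<exists>c>0. \<exists>n0. \<forall>n\<ge>n0. c * (fact n * 4 ^ n * exp (3 * airy_a1 * real n powr (1/3)) * real n powr (3/4)) \<le> real (e_num n 1)"
  using airy_pos_Ai airy_pos.e_num_lower by blast

section \<open>Automata as labelled pointer trees\<close>

text \<open>The residual language of a state; \<open>deriv_lang\<close> below is the left quotient
  of a language by a word.\<close>

definition res :: "(nat \<Rightarrow> bool \<Rightarrow> nat) \<Rightarrow> nat set \<Rightarrow> nat \<Rightarrow> bool list set" where
  "res \<delta> F q = {v. foldl \<delta> q v \<in> F}"

definition deriv_lang :: "bool list set \<Rightarrow> bool list \<Rightarrow> bool list set" where
  "deriv_lang A w = {v. w @ v \<in> A}"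

lemma deriv_lang_dfa: "deriv_lang (dfa_lang (k, \<delta>, q0, F)) w = res \<delta> F (foldl \<delta> q0 w)"
  by (simp add: deriv_lang_def dfa_lang_def res_def)

lemma res_step: "res \<delta> F (\<delta> q c) = {w. c # w \<in> res \<delta> F q}"
  by (simp add: res_def)

lemma foldl_less:
  assumes "wf_dfa (k, \<delta>, q0, F)" "q < k"
  shows "foldl \<delta> q w < k"
  using assms(2)
proof (induction w arbitrary: q)
  case (Cons c w)
  then have "\<delta> q c < k" using assms(1) by (simp add: wf_dfa_def)
  then show ?case using Cons.IH by simp
qed simp

lemma card_derivs_le:
  assumes "wf_dfa D"
  shows "finite (range (deriv_lang (dfa_lang D)))" "card (range (deriv_lang (dfa_lang D))) \<le> dfa_states D"
proof -
  obtain k \<delta> q0 F where D: "D = (k, \<delta>, q0, F)" by (cases D) auto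
  have sub: "range (deriv_lang (dfa_lang D)) \<subseteq> res \<delta> F ` {..<k}"
    unfolding D deriv_lang_dfa using assms foldl_less[of k \<delta> q0 F q0] unfolding D by (auto simp: wf_dfa_def)
  then show "finite (range (deriv_lang (dfa_lang D)))" by (rule finite_subset) simp
  have "card (range (deriv_lang (dfa_lang D))) \<le> card (res \<delta> F ` {..<k})" by (rule card_mono[OF _ sub]) simp
  also have "\<dots> \<le> card {..<k}" by (rule card_image_le) simp
  finally show "card (range (deriv_lang (dfa_lang D))) \<le> dfa_states D" by (simp add: D dfa_states_def)
qed

text \<open>The witness is the automaton of derivatives (Myhill-Nerode).\<close>

lemma derivs_dfa_exists:
  assumes fin: "finite (range (deriv_lang A))"
  shows "\<exists>D. wf_dfa D \<and> dfa_lang D = A \<and> dfa_states D = card (range (deriv_lang A))"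
proof -
  define m where "m = card (range (deriv_lang A))"
  obtain f where "bij_betw f {0..<m} (range (deriv_lang A))"
    using ex_bij_betw_nat_finite[OF fin] unfolding m_def by blast
  then have f: "bij_betw f {..<m} (range (deriv_lang A))" by (simp add: atLeast0LessThan)
  define g where "g = inv_into {..<m} f"
  have fg: "f (g X) = X" "g X < m" if "X \<in> range (deriv_lang A)" for X
    using that f bij_betw_inv_into_right[OF f] bij_betwE[OF bij_betw_inv_into[OF f]] by (auto simp: g_def)
  have step: "{v. c # v \<in> deriv_lang A w} = deriv_lang A (w @ [c])" for c w by (simp add: deriv_lang_def)
  define \<delta> where "\<delta> i c = g {v. c # v \<in> f i}" for i c
  define q0 where "q0 = g (deriv_lang A [])"
  define E where "E = {i. i < m \<and> [] \<in> f i}"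
  have run: "f (foldl \<delta> q0 w) = deriv_lang A w \<and> foldl \<delta> q0 w < m" for w
  proof (induction w rule: rev_induct)
    case Nil
    then show ?case using fg[of "deriv_lang A []"] by (simp add: q0_def)
  next
    case (snoc c w)
    have "foldl \<delta> q0 (w @ [c]) = g {v. c # v \<in> f (foldl \<delta> q0 w)}"
      by (simp add: \<delta>_def[of _ c])
    then have "foldl \<delta> q0 (w @ [c]) = g (deriv_lang A (w @ [c]))" using snoc step by simp
    then show ?case using fg[of "deriv_lang A (w @ [c])"] by simp
  qed
  have "wf_dfa (m, \<delta>, q0, E)"
    unfolding wf_dfa_def
  proof (simp, intro conjI allI impI)
    show "q0 < m" using fg(2)[of "deriv_lang A []"] by (simp add: q0_def)
    show "E \<subseteq> {..<m}" by (auto simp: E_def)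
    fix q c assume "q < m"
    then have "f q \<in> range (deriv_lang A)" using f bij_betwE by fastforce
    then obtain w where "f q = deriv_lang A w" by blast
    then show "\<delta> q c < m" unfolding \<delta>_def using step fg(2) by simp
  qed
  moreover have "dfa_lang (m, \<delta>, q0, E) = A"
    using run by (auto simp: dfa_lang_def E_def deriv_lang_def)
  ultimately show ?thesis by (intro exI[of _ "(m, \<delta>, q0, E)"]) (simp add: dfa_states_def m_def)
qed

lemma minimal_dfa_iff:
  "minimal_dfa D \<longleftrightarrow> wf_dfa D \<and> dfa_states D = card (range (deriv_lang (dfa_lang D)))"
proof
  assume m: "minimal_dfa D"
  then have wf: "wf_dfa D" by (simp add: minimal_dfa_def)
  obtain D' where "wf_dfa D'" "dfa_lang D' = dfa_lang D" "dfa_states D' = card (range (deriv_lang (dfa_lang D)))"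
    using derivs_dfa_exists[OF card_derivs_le(1)[OF wf]] by blast
  then have "dfa_states D \<le> card (range (deriv_lang (dfa_lang D)))" using m unfolding minimal_dfa_def by metis
  then show "wf_dfa D \<and> dfa_states D = card (range (deriv_lang (dfa_lang D)))"
    using wf card_derivs_le(2)[OF wf] by simp
next
  assume "wf_dfa D \<and> dfa_states D = card (range (deriv_lang (dfa_lang D)))"
  then show "minimal_dfa D" unfolding minimal_dfa_def using card_derivs_le(2) by metis
qed

text \<open>The number of derivatives is at most the number of reachable states, which is at most
  \<open>k\<close>. Minimality makes both inequalities equalities: the first gives distinct
  residuals, the second reachability.\<close>

lemma minimal_dfa_states:
  assumes "minimal_dfa (k, \<delta>, q0, F)"
  shows "inj_on (res \<delta> F) {..<k}" "\<And>q. q < k \<Longrightarrow> \<exists>w. foldl \<delta> q0 w = q"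
proof -
  define R where "R = range (foldl \<delta> q0)"
  have wf: "wf_dfa (k, \<delta>, q0, F)" and k: "k = card (range (deriv_lang (dfa_lang (k, \<delta>, q0, F))))"
    using assms unfolding minimal_dfa_iff by (auto simp: dfa_states_def)
  have sub: "R \<subseteq> {..<k}" using foldl_less[OF wf, of q0] wf by (auto simp: R_def wf_dfa_def)
  then have finR: "finite R" by (rule finite_subset) simp
  have "range (deriv_lang (dfa_lang (k, \<delta>, q0, F))) = res \<delta> F ` R"
    by (auto simp: deriv_lang_dfa R_def)
  then have kR: "k = card (res \<delta> F ` R)" using k by simp
  then have "k \<le> card R" using card_image_le[OF finR, of "res \<delta> F"] by simp
  then have R: "R = {..<k}" using sub by (intro card_seteq) auto
  show "inj_on (res \<delta> F) {..<k}" using kR unfolding R by (intro eq_card_imp_inj_on) auto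
  show "\<exists>w. foldl \<delta> q0 w = q" if "q < k" for q using that R unfolding R_def by (metis lessThan_iff imageE)
qed

section \<open>Isomorphism of automata as an equivalence relation\<close>

lemma dfa_iso_lang:
  assumes "wf_dfa D" "dfa_iso D D'"
  shows "dfa_lang D = dfa_lang D'"
proof -
  obtain k \<delta> q0 F k' \<delta>' q0' F' where D: "D = (k, \<delta>, q0, F)" "D' = (k', \<delta>', q0', F')" by (cases D; cases D') auto
  obtain h where h: "h q0 = q0'" "\<And>q c. q < k \<Longrightarrow> h (\<delta> q c) = \<delta>' (h q) c" "\<And>q. q < k \<Longrightarrow> q \<in> F \<longleftrightarrow> h q \<in> F'"
    using assms(2) unfolding dfa_iso_def D by auto
  have q0: "q0 < k" using assms(1) by (simp add: D wf_dfa_def)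
  have "h (foldl \<delta> q w) = foldl \<delta>' (h q) w" if "q < k" for q w
    using that
  proof (induction w arbitrary: q)
    case (Cons c w)
    then have "\<delta> q c < k" using assms(1) by (simp add: D wf_dfa_def)
    then show ?case using Cons.IH Cons.prems h(2) by simp
  qed simp
  then show ?thesis
    unfolding D dfa_lang_def using h(1,3) q0 foldl_less[OF assms(1)[unfolded D] q0] by auto
qed

lemma dfa_iso_sym:
  assumes "wf_dfa D" "dfa_iso D D'"
  shows "dfa_iso D' D"
proof -
  obtain k \<delta> q0 F k' \<delta>' q0' F' where D: "D = (k, \<delta>, q0, F)" "D' = (k', \<delta>', q0', F')" by (cases D; cases D') auto
  obtain h where h: "bij_betw h {..<k} {..<k'}" "h q0 = q0'" "\<And>q c. q < k \<Longrightarrow> h (\<delta> q c) = \<delta>' (h q) c" "\<And>q. q < k \<Longrightarrow> q \<in> F \<longleftrightarrow> h q \<in> F'"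
    using assms(2) unfolding dfa_iso_def D by auto
  have wf: "q0 < k" "\<And>q c. q < k \<Longrightarrow> \<delta> q c < k" using assms(1) by (auto simp: D wf_dfa_def)
  define g where "g = inv_into {..<k} h"
  have g: "bij_betw g {..<k'} {..<k}" unfolding g_def by (rule bij_betw_inv_into[OF h(1)])
  have gh: "g (h q) = q" if "q < k" for q using bij_betw_inv_into_left[OF h(1)] that by (simp add: g_def)
  have hg: "h (g q) = q" "g q < k" if "q < k'" for q
    using bij_betw_inv_into_right[OF h(1)] bij_betwE[OF g] that by (auto simp: g_def)
  show ?thesis
    unfolding dfa_iso_def D
  proof (simp, intro exI[of _ g] conjI allI impI g)
    show "g q0' = q0" using gh wf h(2) by blast
    fix q assume q: "q < k'"
    show "g (\<delta>' q c) = \<delta> (g q) c" for c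
      using h(3)[OF hg(2)[OF q], of c] gh[OF wf(2)[OF hg(2)[OF q]], of c] hg(1)[OF q] by simp
    show "(q \<in> F') = (g q \<in> F)" using h(4)[OF hg(2)[OF q]] hg(1)[OF q] by simp
  qed
qed

lemma dfa_iso_trans:
  assumes "dfa_iso D D'" "dfa_iso D' D''"
  shows "dfa_iso D D''"
proof -
  obtain k \<delta> q0 F k' \<delta>' q0' F' k'' \<delta>'' q0'' F'' where D: "D = (k, \<delta>, q0, F)" "D' = (k', \<delta>', q0', F')" "D'' = (k'', \<delta>'', q0'', F'')"
    by (cases D; cases D'; cases D'') auto
  obtain h where h: "bij_betw h {..<k} {..<k'}" "h q0 = q0'" "\<And>q c. q < k \<Longrightarrow> h (\<delta> q c) = \<delta>' (h q) c" "\<And>q. q < k \<Longrightarrow> q \<in> F \<longleftrightarrow> h q \<in> F'"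
    using assms(1) unfolding dfa_iso_def D by auto
  obtain g where g: "bij_betw g {..<k'} {..<k''}" "g q0' = q0''" "\<And>q c. q < k' \<Longrightarrow> g (\<delta>' q c) = \<delta>'' (g q) c" "\<And>q. q < k' \<Longrightarrow> q \<in> F' \<longleftrightarrow> g q \<in> F''"
    using assms(2) unfolding dfa_iso_def D by auto
  have hk: "h q < k'" if "q < k" for q using bij_betwE[OF h(1)] that by auto
  show ?thesis unfolding dfa_iso_def D
    using bij_betw_trans[OF h(1) g(1)] h g hk by (auto intro!: exI[of _ "g \<circ> h"])
qed

lemma dfa_iso_refl: "dfa_iso D D"
  by (cases D) (auto simp: dfa_iso_def intro!: exI[of _ id])

text \<open>The relation occurring in \<open>m2\<close>. It also identifies automata whose
  transition functions differ only outside the state set.\<close>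

definition iso_rel :: "nat \<Rightarrow> (dfa \<times> dfa) set" where
  "iso_rel n = {(D, D'). D \<in> min_fin_dfas n \<and> D' \<in> min_fin_dfas n \<and> dfa_iso D D'}"

lemma equiv_iso_rel: "equiv (min_fin_dfas n) (iso_rel n)"
proof (rule equivI)
  show "iso_rel n \<subseteq> min_fin_dfas n \<times> min_fin_dfas n" by (auto simp: iso_rel_def)
  show "refl_on (min_fin_dfas n) (iso_rel n)" by (auto simp: refl_on_def iso_rel_def dfa_iso_refl)
  show "sym (iso_rel n)"
    by (auto simp: sym_def iso_rel_def min_fin_dfas_def minimal_dfa_def intro: dfa_iso_sym)
  show "trans (iso_rel n)" by (auto simp: trans_def iso_rel_def intro: dfa_iso_trans)
qed

text \<open>State \<open>0\<close> is the sink, state \<open>q \<ge> 1\<close> the \<open>q\<close>-th internal node in postorder.\<close>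

definition dstep :: "rt \<Rightarrow> nat \<Rightarrow> bool \<Rightarrow> nat" where
  "dstep t q c = (if 1 \<le> q \<and> q \<le> num_nodes t then (if c then snd else fst) (child_pairs 1 t ! (q - 1)) else 0)"

definition dfa_of :: "rt \<Rightarrow> nat set \<Rightarrow> dfa" where
  "dfa_of t F = (num_nodes t + 1, dstep t, root_label 1 t, F)"

definition finals :: "nat \<Rightarrow> nat set set" where
  "finals n = {F. F \<subseteq> {1..n} \<and> 1 \<in> F}"

lemma card_finals:
  assumes "n \<ge> 1"
  shows "card (finals n) = 2 ^ (n - 1)"
proof -
  have "finals n = insert 1 ` Pow {2..n}"
  proof (intro equalityI subsetI)
    fix F assume F: "F \<in> finals n"
    then have "F = insert 1 (F - {1})" "F - {1} \<subseteq> {2..n}" by (auto simp: finals_def)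
    then show "F \<in> insert 1 ` Pow {2..n}" by blast
  qed (use assms in \<open>auto simp: finals_def\<close>)
  moreover have "inj_on (insert 1) (Pow {2..n})"
  proof (rule inj_onI)
    fix A B assume a: "A \<in> Pow {2..n}" "B \<in> Pow {2..n}" "insert 1 A = insert 1 B"
    then have "1 \<notin> A" "1 \<notin> B" by auto
    then show "A = B" using a(3) by (metis Diff_insert_absorb)
  qed
  ultimately show ?thesis by (simp add: card_image card_Pow)
qed

lemma finite_finals: "finite (finals n)"
  by (rule finite_subset[of _ "Pow {1..n}"]) (auto simp: finals_def)

section \<open>Automata built from pointer trees: finiteness, sink, reachability, minimality\<close>

lemma dstep_less: "well_labelled 1 t \<Longrightarrow> q \<ge> 1 \<Longrightarrow> dstep t q c < q"
  using child_pairs_less[of 1 t "q - 1"] by (auto simp: dstep_def)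

lemma dstep_0: "dstep t 0 c = 0"
  by (simp add: dstep_def)

lemma dstep_le: "well_labelled 1 t \<Longrightarrow> dstep t q c \<le> q"
  using dstep_less[of t q c] dstep_0[of t c] by (cases "q = 0") auto

lemma dstep_1: "well_labelled 1 t \<Longrightarrow> dstep t 1 c = 0"
  using dstep_less[of t 1 c] by simp

lemma wf_dfa_of:
  assumes "t \<in> pointer_trees n" "F \<in> finals n"
  shows "wf_dfa (dfa_of t F)"
proof -
  have t: "well_labelled 1 t" "num_nodes t = n" using assms by (auto simp: pointer_trees_def)
  have "dstep t q c < n + 1" if "q < n + 1" for q c
    using dstep_le[OF t(1), of q c] that by simp
  then show ?thesis using root_label_less[OF t(1)] t assms
    by (auto simp: dfa_of_def wf_dfa_def finals_def)
qed

lemma foldl_dstep_le: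
  assumes "well_labelled 1 t"
  shows "foldl (dstep t) q w \<le> q - length w"
proof (induction w arbitrary: q)
  case (Cons c w)
  have "dstep t q c \<le> q - 1" using dstep_less[OF assms, of q c] dstep_0[of t c] by (cases "q = 0") auto
  then show ?case using Cons.IH[of "dstep t q c"] by simp
qed simp

lemma finite_dfa_of:
  assumes "t \<in> pointer_trees n" "F \<in> finals n"
  shows "finite (dfa_lang (dfa_of t F))"
proof -
  have t: "well_labelled 1 t" "num_nodes t = n" using assms by (auto simp: pointer_trees_def)
  have "length w \<le> n" if "foldl (dstep t) (root_label 1 t) w \<in> F" for w
  proof (rule ccontr)
    assume "\<not> length w \<le> n"
    moreover have "root_label 1 t \<le> n" using root_label_less[OF t(1)] t by simp
    ultimately have "foldl (dstep t) (root_label 1 t) w = 0" using foldl_dstep_le[OF t(1), of "root_label 1 t" w] by simp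
    then show False using that assms by (auto simp: finals_def)
  qed
  then have "dfa_lang (dfa_of t F) \<subseteq> {w. set w \<subseteq> UNIV \<and> length w \<le> n}"
    by (auto simp: dfa_lang_def dfa_of_def)
  then show ?thesis by (rule finite_subset) (rule finite_lists_length_le, simp)
qed

lemma sink_dfa_of:
  assumes "t \<in> pointer_trees n" "F \<in> finals n"
  shows "{q. is_sink (dfa_of t F) q} = {0}"
proof -
  have t: "well_labelled 1 t" "num_nodes t = n" using assms by (auto simp: pointer_trees_def)
  have "is_sink (dfa_of t F) q \<longleftrightarrow> q = 0" for q
  proof
    assume "is_sink (dfa_of t F) q"
    then have "dstep t q True = q" by (simp add: is_sink_def dfa_of_def)
    then show "q = 0" using dstep_less[OF t(1), of q True] by (cases "q = 0") auto
  next
    assume "q = 0"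
    then show "is_sink (dfa_of t F) q" using assms by (auto simp: is_sink_def dfa_of_def dstep_0 finals_def)
  qed
  then show ?thesis by auto
qed

text \<open>\<open>u\<close> sits in \<open>t\<close> as a subtree whose first node has number
  \<open>k\<close>. Comparing the pairs of children lets inductions over \<open>u\<close> read off
  the transitions of \<open>dfa_of t\<close>.\<close>

definition emb :: "rt \<Rightarrow> nat \<Rightarrow> rt \<Rightarrow> bool" where
  "emb t k u \<longleftrightarrow> 1 \<le> k \<and> k + num_nodes u \<le> num_nodes t + 1 \<and> (\<forall>i<num_nodes u. child_pairs 1 t ! (k + i - 1) = child_pairs k u ! i)"

lemma emb_self: "emb t 1 t"
  by (simp add: emb_def)

lemma emb_Node:
  assumes "emb t k (Node l r)"
  shows "emb t k l" "emb t (k + num_nodes l) r"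
    "dstep t (k + num_nodes l + num_nodes r) False = root_label k l" "dstep t (k + num_nodes l + num_nodes r) True = root_label (k + num_nodes l) r"
proof -
  have k: "1 \<le> k" "k + num_nodes l + num_nodes r + 1 \<le> num_nodes t + 1" using assms by (auto simp: emb_def)
  have e: "child_pairs 1 t ! (k + i - 1) = child_pairs k (Node l r) ! i" if "i < num_nodes l + num_nodes r + 1" for i
    using assms that by (auto simp: emb_def)
  show "emb t k l"
    unfolding emb_def
  proof (intro conjI allI impI)
    fix i assume "i < num_nodes l"
    then show "child_pairs 1 t ! (k + i - 1) = child_pairs k l ! i" using e[of i] by (simp add: nth_append)
  qed (use k in auto)
  show "emb t (k + num_nodes l) r"
    unfolding emb_def
  proof (intro conjI allI impI)
    fix i assume "i < num_nodes r"
    then show "child_pairs 1 t ! (k + num_nodes l + i - 1) = child_pairs (k + num_nodes l) r ! i"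
      using e[of "num_nodes l + i"] by (simp add: nth_append add.assoc)
  qed (use k in auto)
  have "child_pairs 1 t ! (k + (num_nodes l + num_nodes r) - 1) = (root_label k l, root_label (k + num_nodes l) r)"
    using e[of "num_nodes l + num_nodes r"] by (simp add: nth_append)
  then show "dstep t (k + num_nodes l + num_nodes r) False = root_label k l" "dstep t (k + num_nodes l + num_nodes r) True = root_label (k + num_nodes l) r"
    using k by (simp_all add: dstep_def add.assoc)
qed

definition reach :: "rt \<Rightarrow> nat \<Rightarrow> bool" where
  "reach t q \<longleftrightarrow> (\<exists>w. foldl (dstep t) (root_label 1 t) w = q)"

lemma reach_step: "reach t q \<Longrightarrow> reach t (dstep t q c)"
proof -
  assume "reach t q"
  then obtain w where "foldl (dstep t) (root_label 1 t) w = q" by (auto simp: reach_def)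
  then have "foldl (dstep t) (root_label 1 t) (w @ [c]) = dstep t q c" by simp
  then show ?thesis unfolding reach_def by blast
qed

lemma reach_emb:
  assumes "emb t k u" "reach t (root_label k u)" "k \<le> v" "v < k + num_nodes u"
  shows "reach t v"
  using assms
proof (induction u arbitrary: k)
  case (Node l r)
  note e = emb_Node[OF Node.prems(1)]
  have rt: "reach t (k + num_nodes l + num_nodes r)" using Node.prems(2) by simp
  have rl: "reach t (root_label k l)" "reach t (root_label (k + num_nodes l) r)"
    using reach_step[OF rt, of False] reach_step[OF rt, of True] e by simp_all
  consider "v < k + num_nodes l" | "k + num_nodes l \<le> v" "v < k + num_nodes l + num_nodes r" | "v = k + num_nodes l + num_nodes r"
    using Node.prems by force
  then show ?case
  proof cases
    case 1
    then show ?thesis using Node.IH(1)[OF e(1) rl(1)] Node.prems by simp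
  next
    case 2
    then show ?thesis using Node.IH(2)[OF e(2) rl(2)] by simp
  next
    case 3
    then show ?thesis using rt by simp
  qed
qed simp

lemma reach_all:
  assumes "t \<in> pointer_trees n" "n \<ge> 1" "q \<le> n"
  shows "reach t q"
proof -
  have t: "well_labelled 1 t" "num_nodes t = n" using assms by (auto simp: pointer_trees_def)
  have r: "reach t (root_label 1 t)" unfolding reach_def by (intro exI[of _ "[]"]) simp
  have pos: "reach t q" if "1 \<le> q" "q \<le> n" for q
    using reach_emb[OF emb_self r] that t by simp
  show ?thesis
  proof (cases "q = 0")
    case True
    then show ?thesis using reach_step[OF pos[of 1], of True] dstep_1[OF t(1)] assms by simp
  qed (use pos assms in auto)
qed

text \<open>The pair of state 1 is \<open>(0, 0)\<close>, as both labels are below 1. By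
  distinctness every later state has a transition to a smaller nonzero state, and induction provides
  a word accepted from there.\<close>

lemma res_nonempty:
  assumes "t \<in> pointer_trees n" "F \<in> finals n" "distinct (child_pairs 1 t)" "1 \<le> q" "q \<le> n"
  shows "res (dstep t) F q \<noteq> {}"
  using assms(4,5)
proof (induction q rule: less_induct)
  case (less q)
  have t: "well_labelled 1 t" "num_nodes t = n" using assms by (auto simp: pointer_trees_def)
  show ?case
  proof (cases "q = 1")
    case True
    then have "[] \<in> res (dstep t) F q" using assms by (simp add: res_def finals_def)
    then show ?thesis by blast
  next
    case False
    then have q: "q - 1 < num_nodes t" "q - 1 \<noteq> 0" "0 < num_nodes t" using less.prems t by auto
    have "child_pairs 1 t ! (q - 1) \<noteq> child_pairs 1 t ! 0"
      using assms(3) q by (simp add: nth_eq_iff_index_eq)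
    then have "\<exists>c. dstep t q c \<noteq> dstep t 1 c"
      using less.prems q t by (auto simp: dstep_def prod_eq_iff intro: exI[of _ True] exI[of _ False])
    then obtain c where c: "dstep t q c \<noteq> 0" using dstep_1[OF t(1)] by metis
    have lt: "dstep t q c < q" using dstep_less[OF t(1)] less.prems by simp
    have "res (dstep t) F (dstep t q c) \<noteq> {}" using less.IH[OF lt] c lt less.prems by simp
    then show ?thesis unfolding res_step by blast
  qed
qed

text \<open>Equal residuals of \<open>u\<close> and \<open>v\<close> pass to their successors, which
  then coincide by induction, against the distinctness of the pairs. Acceptance enters only through
  states 0 and 1, so all other final states can be chosen freely.\<close>

lemma res_distinct:
  assumes "t \<in> pointer_trees n" "F \<in> finals n" "distinct (child_pairs 1 t)" "v \<le> n" "u < v"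
  shows "res (dstep t) F u \<noteq> res (dstep t) F v"
  using assms(4,5)
proof (induction v arbitrary: u rule: less_induct)
  case (less v)
  have t: "well_labelled 1 t" "num_nodes t = n" using assms by (auto simp: pointer_trees_def)
  show ?case
  proof (cases "u = 0")
    case True
    have "foldl (dstep t) 0 w = 0" for w by (induction w) (auto simp: dstep_0)
    then have "res (dstep t) F 0 = {}" using assms by (auto simp: res_def finals_def)
    then show ?thesis using res_nonempty[OF assms(1-3), of v] less.prems True by auto
  next
    case False
    have "child_pairs 1 t ! (u - 1) \<noteq> child_pairs 1 t ! (v - 1)"
      using assms(3) False less.prems t by (simp add: nth_eq_iff_index_eq)
    then have "\<exists>c. dstep t u c \<noteq> dstep t v c"
      using less.prems False t by (auto simp: dstep_def prod_eq_iff intro: exI[of _ True] exI[of _ False])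
    then obtain c where c: "dstep t u c \<noteq> dstep t v c" by blast
    have lt: "dstep t u c < v" "dstep t v c < v"
      using dstep_less[OF t(1), of u c] dstep_less[OF t(1), of v c] less.prems False by auto
    have "res (dstep t) F (dstep t u c) \<noteq> res (dstep t) F (dstep t v c)"
      using less.IH[of "dstep t u c" "dstep t v c"] less.IH[of "dstep t v c" "dstep t u c"] lt c less.prems
      by (cases "dstep t u c < dstep t v c") auto
    then show ?thesis unfolding res_step by auto
  qed
qed

lemma dfa_of_min_fin:
  assumes "t \<in> pointer_trees n" "F \<in> finals n" "distinct (child_pairs 1 t)" "n \<ge> 1"
  shows "dfa_of t F \<in> min_fin_dfas n"
proof -
  have t: "well_labelled 1 t" "num_nodes t = n" using assms by (auto simp: pointer_trees_def)
  have "inj_on (res (dstep t) F) {..n}"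
  proof (rule inj_onI)
    fix u v assume "u \<in> {..n}" "v \<in> {..n}" "res (dstep t) F u = res (dstep t) F v"
    then show "u = v" using res_distinct[OF assms(1-3), of u v] res_distinct[OF assms(1-3), of v u]
      by (cases u v rule: linorder_cases) auto
  qed
  then have "n + 1 = card (res (dstep t) F ` {..n})" by (simp add: card_image)
  also have "\<dots> \<le> card (range (deriv_lang (dfa_lang (dfa_of t F))))"
  proof (rule card_mono[OF card_derivs_le(1)[OF wf_dfa_of[OF assms(1,2)]]])
    show "res (dstep t) F ` {..n} \<subseteq> range (deriv_lang (dfa_lang (dfa_of t F)))"
    proof
      fix X assume "X \<in> res (dstep t) F ` {..n}"
      then obtain q where q: "q \<le> n" "X = res (dstep t) F q" by auto
      then obtain w where "foldl (dstep t) (root_label 1 t) w = q" using reach_all[OF assms(1,4)] unfolding reach_def by blast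
      then show "X \<in> range (deriv_lang (dfa_lang (dfa_of t F)))" unfolding dfa_of_def deriv_lang_dfa q(2) by blast
    qed
  qed
  finally have "dfa_states (dfa_of t F) \<le> card (range (deriv_lang (dfa_lang (dfa_of t F))))"
    by (simp add: dfa_states_def dfa_of_def t)
  then have "minimal_dfa (dfa_of t F)"
    unfolding minimal_dfa_iff using wf_dfa_of[OF assms(1,2)] card_derivs_le(2)[OF wf_dfa_of[OF assms(1,2)]] by simp
  then show ?thesis
    unfolding min_fin_dfas_def using finite_dfa_of[OF assms(1,2)] sink_dfa_of[OF assms(1,2)] t
    by (simp add: dfa_states_def dfa_of_def)
qed

text \<open>Both trees number their nodes by the same traversal. Once \<open>h\<close> fixes all
  earlier labels, a pointer cannot correspond to a new node, by injectivity, and the next new node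
  receives the same number on both sides.\<close>

lemma iso_emb_eq:
  assumes "emb t k u" "emb t' k u'" "well_labelled k u" "well_labelled k u'" "inj_on h {..num_nodes t}"
    "\<And>q. q < k \<Longrightarrow> h q = q" "h (root_label k u) = root_label k u'"
    "\<And>q c. q \<le> num_nodes t \<Longrightarrow> h (dstep t q c) = dstep t' (h q) c"
  shows "u = u' \<and> (\<forall>q < k + num_nodes u. h q = q)"
  using assms(1-4,6,7)
proof (induction u arbitrary: k u')
  case (Ptr j)
  then have "root_label k u' = j" "j < k" by auto
  then have "u' = Ptr j" by (cases u') auto
  then show ?case using Ptr by simp
next
  case (Node l r)
  have num_nodes: "k + num_nodes l + num_nodes r \<le> num_nodes t" using Node.prems(1) by (simp add: emb_def)
  obtain l' r' where u': "u' = Node l' r'"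
  proof (cases u')
    case (Ptr j')
    then have hj: "h (k + num_nodes l + num_nodes r) = h j'" "j' < k" using Node.prems by auto
    have "k + num_nodes l + num_nodes r = j'" by (rule inj_onD[OF assms(5) hj(1)]) (use num_nodes hj(2) in auto)
    then show ?thesis using hj(2) by simp
  qed (use that in auto)
  have e: "emb t' k (Node l' r')" using Node.prems(2) u' by simp
  note e1 = emb_Node[OF Node.prems(1)] and e2 = emb_Node[OF e]
  have hroot: "h (k + num_nodes l + num_nodes r) = k + num_nodes l' + num_nodes r'" using Node.prems(6) u' by simp
  have hl: "h (root_label k l) = root_label k l'"
    using assms(8)[OF num_nodes, of False] e1(3) e2(3) hroot by simp
  have hr: "h (root_label (k + num_nodes l) r) = root_label (k + num_nodes l') r'"
    using assms(8)[OF num_nodes, of True] e1(4) e2(4) hroot by simp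
  have L: "l = l' \<and> (\<forall>q < k + num_nodes l. h q = q)"
    using Node.prems u' hl by (intro Node.IH(1) e1(1) e2(1)) auto
  have R: "r = r' \<and> (\<forall>q < k + num_nodes l + num_nodes r. h q = q)"
    using Node.prems u' hr e1(2) e2(2) L by (intro Node.IH(2)) auto
  then show ?case using L u' hroot by (auto simp: less_Suc_eq add.assoc)
qed

lemma dfa_of_inj:
  assumes "t \<in> pointer_trees n" "F \<in> finals n" "t' \<in> pointer_trees n" "F' \<in> finals n"
    and iso: "dfa_iso (dfa_of t F) (dfa_of t' F')"
  shows "t = t' \<and> F = F'"
proof -
  have t: "well_labelled 1 t" "num_nodes t = n" "well_labelled 1 t'" "num_nodes t' = n" using assms by (auto simp: pointer_trees_def)
  obtain h where h: "bij_betw h {..<n + 1} {..<n + 1}" "h (root_label 1 t) = root_label 1 t'"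
    "\<And>q c. q < n + 1 \<Longrightarrow> h (dstep t q c) = dstep t' (h q) c" "\<And>q. q < n + 1 \<Longrightarrow> q \<in> F \<longleftrightarrow> h q \<in> F'"
    using iso unfolding dfa_iso_def dfa_of_def t by auto
  \<comment> \<open>An isomorphism preserves loops, and state 0 is the only state with a
    loop.\<close>
  have "dstep t' (h 0) True = h 0" using h(3)[of 0 True] dstep_0 by simp
  then have h0: "h 0 = 0" using dstep_less[OF t(3), of "h 0" True] by (cases "h 0 = 0") auto
  have "inj_on h {..num_nodes t}" using h(1) t by (simp add: bij_betw_def lessThan_Suc_atMost)
  then have *: "t = t' \<and> (\<forall>q < 1 + num_nodes t. h q = q)"
    using h h0 t by (intro iso_emb_eq[of t 1 t t' t' h] emb_self) auto
  have "q \<in> F \<longleftrightarrow> q \<in> F'" for q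
  proof (cases "q < n + 1")
    case True
    then show ?thesis using h(4)[OF True] * t by simp
  qed (use assms in \<open>auto simp: finals_def\<close>)
  then show ?thesis using * by auto
qed

text \<open>Depth-first search from \<open>q\<close>, where \<open>vs\<close> lists the states already visited in postorder.\<close>

lemma dfs:
  fixes \<delta> :: "nat \<Rightarrow> bool \<Rightarrow> nat" and meas :: "nat \<Rightarrow> nat"
  assumes meas: "\<And>q c. q \<in> Q \<Longrightarrow> q \<noteq> z \<Longrightarrow> \<delta> q c \<in> Q \<and> meas (\<delta> q c) < meas q"
    and "q \<in> Q" "distinct vs" "z \<in> set vs" "set vs \<subseteq> Q"
  shows "\<exists>t ns. well_labelled (length vs) t \<and> num_nodes t = length ns \<and> distinct (vs @ ns) \<and> set ns \<subseteq> Q \<and>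
    (\<forall>p\<in>set ns. meas p \<le> meas q) \<and> (vs @ ns) ! root_label (length vs) t = q \<and>
    (\<forall>i<length ns. (vs @ ns) ! fst (child_pairs (length vs) t ! i) = \<delta> (ns ! i) False \<and>
                   (vs @ ns) ! snd (child_pairs (length vs) t ! i) = \<delta> (ns ! i) True)"
  using assms(2-5)
proof (induction "meas q" arbitrary: q vs rule: less_induct)
  case less
  show ?case
  proof (cases "q \<in> set vs")
    case True
    then obtain j where "j < length vs" "vs ! j = q" by (metis in_set_conv_nth)
    then show ?thesis using less.prems by (intro exI[of _ "Ptr j"] exI[of _ "[]"]) auto
  next
    case False
    then have "q \<noteq> z" using less.prems by auto
    note m = meas[OF less.prems(1) this]
    obtain t1 n1 where 1: "well_labelled (length vs) t1" "num_nodes t1 = length n1" "distinct (vs @ n1)" "set n1 \<subseteq> Q"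
      "\<forall>p\<in>set n1. meas p \<le> meas (\<delta> q False)" "(vs @ n1) ! root_label (length vs) t1 = \<delta> q False"
      "\<And>i. i < length n1 \<Longrightarrow> (vs @ n1) ! fst (child_pairs (length vs) t1 ! i) = \<delta> (n1 ! i) False \<and>
                   (vs @ n1) ! snd (child_pairs (length vs) t1 ! i) = \<delta> (n1 ! i) True"
      using less.hyps[of "\<delta> q False" vs] m less.prems by blast
    have "set (vs @ n1) \<subseteq> Q" "z \<in> set (vs @ n1)" using 1 less.prems by auto
    then obtain t2 n2 where 2: "well_labelled (length (vs @ n1)) t2" "num_nodes t2 = length n2" "distinct ((vs @ n1) @ n2)" "set n2 \<subseteq> Q"
      "\<forall>p\<in>set n2. meas p \<le> meas (\<delta> q True)" "((vs @ n1) @ n2) ! root_label (length (vs @ n1)) t2 = \<delta> q True"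
      "\<And>i. i < length n2 \<Longrightarrow> ((vs @ n1) @ n2) ! fst (child_pairs (length (vs @ n1)) t2 ! i) = \<delta> (n2 ! i) False \<and>
                   ((vs @ n1) @ n2) ! snd (child_pairs (length (vs @ n1)) t2 ! i) = \<delta> (n2 ! i) True"
      using less.hyps[of "\<delta> q True" "vs @ n1"] m 1(3) by blast
    define ns where "ns = n1 @ n2 @ [q]"
    have A1: "(vs @ ns) ! j = (vs @ n1) ! j" if "j < length vs + length n1" for j
      using that nth_append[of "vs @ n1" "n2 @ [q]" j] by (simp add: ns_def)
    have A2: "(vs @ ns) ! j = ((vs @ n1) @ n2) ! j" if "j < length vs + length n1 + length n2" for j
      using that nth_append[of "(vs @ n1) @ n2" "[q]" j] by (simp add: ns_def)
    have len: "length (vs @ n1) = length vs + num_nodes t1" using 1 by simp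
    have r1: "root_label (length vs) t1 < length vs + length n1" using root_label_less[OF 1(1)] 1(2) by simp
    have r2: "root_label (length vs + num_nodes t1) t2 < length vs + length n1 + length n2"
      using root_label_less[OF 2(1)] 1(2) 2(2) by simp
    \<comment> \<open>Everything discovered below \<open>q\<close> has smaller measure than
      \<open>q\<close>. Hence \<open>q\<close> is still new when both subtrees are complete, as
      postorder requires.\<close>
    have qn: "q \<notin> set (vs @ n1 @ n2)"
    proof -
      have "q \<notin> set n1" using 1(5) m[of False] by auto
      moreover have "q \<notin> set n2" using 2(5) m[of True] by auto
      ultimately show ?thesis using False by simp
    qed
    have last: "(vs @ ns) ! (length vs + num_nodes t1 + num_nodes t2) = q"
      using nth_append[of "(vs @ n1) @ n2" "[q]" "length vs + num_nodes t1 + num_nodes t2"] 1(2) 2(2) by (simp add: ns_def)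
    have tr: "(vs @ ns) ! fst (child_pairs (length vs) (Node t1 t2) ! i) = \<delta> (ns ! i) False \<and>
         (vs @ ns) ! snd (child_pairs (length vs) (Node t1 t2) ! i) = \<delta> (ns ! i) True" if "i < length ns" for i
    proof -
      have "i < length n1 + length n2 + 1" using that by (simp add: ns_def)
      then consider "i < length n1" | "length n1 \<le> i" "i < length n1 + length n2" | "i = length n1 + length n2"
        by linarith
      then show ?thesis
      proof cases
        case a: 1
        have lt: "fst (child_pairs (length vs) t1 ! i) < length vs + length n1" "snd (child_pairs (length vs) t1 ! i) < length vs + length n1"
          using child_pairs_less[OF 1(1), of i] a 1(2) by auto
        have "child_pairs (length vs) (Node t1 t2) ! i = child_pairs (length vs) t1 ! i" "ns ! i = n1 ! i"
          using a 1(2) by (simp_all add: nth_append ns_def)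
        then show ?thesis using 1(7)[OF a] A1 lt by simp
      next
        case a: 2
        define i' where "i' = i - length n1"
        have i': "i' < length n2" "i = length n1 + i'" using a by (auto simp: i'_def)
        have lt: "fst (child_pairs (length (vs @ n1)) t2 ! i') < length vs + length n1 + length n2"
          "snd (child_pairs (length (vs @ n1)) t2 ! i') < length vs + length n1 + length n2"
          using child_pairs_less[OF 2(1), of i'] i' 2(2) by auto
        have "child_pairs (length vs) (Node t1 t2) ! i = child_pairs (length (vs @ n1)) t2 ! i'" "ns ! i = n2 ! i'"
          using i' 1(2) 2(2) by (simp_all add: nth_append ns_def)
        then show ?thesis using 2(7)[OF i'(1)] A2 lt by simp
      next
        case a: 3
        have "child_pairs (length vs) (Node t1 t2) ! i = (root_label (length vs) t1, root_label (length vs + num_nodes t1) t2)" "ns ! i = q"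
          using a 1(2) 2(2) by (simp_all add: nth_append ns_def)
        then show ?thesis using 1(6) 2(6) A1[OF r1] A2[OF r2] len by simp
      qed
    qed
    have "meas p \<le> meas q" if "p \<in> set ns" for p
      using that 1(5) 2(5) m[of False] m[of True] unfolding ns_def by fastforce
    moreover have "distinct (vs @ ns)" using 2(3) qn by (auto simp: ns_def)
    moreover have "set ns \<subseteq> Q" using 1 2 less.prems by (auto simp: ns_def)
    moreover have "well_labelled (length vs) (Node t1 t2)" "num_nodes (Node t1 t2) = length ns"
      using 1 2 by (simp_all add: ns_def)
    moreover have "(vs @ ns) ! root_label (length vs) (Node t1 t2) = q" using last by simp
    ultimately show ?thesis using tr by blast
  qed
qed

lemma min_fin_iso_dfa_of:
  assumes D: "D \<in> min_fin_dfas n" and n: "n \<ge> 1"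
  shows "\<exists>t F. t \<in> pointer_trees n \<and> F \<in> finals n \<and> dfa_of t F \<in> min_fin_dfas n \<and> dfa_iso (dfa_of t F) D"
proof -
  obtain k \<delta> q0 F where Deq: "D = (k, \<delta>, q0, F)" by (cases D) auto
  have k: "k = n + 1" and min: "minimal_dfa (k, \<delta>, q0, F)" and fin: "finite (dfa_lang (k, \<delta>, q0, F))"
    and sink: "card {q. is_sink (k, \<delta>, q0, F) q} = 1"
    using D by (auto simp: min_fin_dfas_def Deq dfa_states_def)
  have wf: "wf_dfa (k, \<delta>, q0, F)" using min by (simp add: minimal_dfa_def)
  then have wf': "q0 < k" "F \<subseteq> {..<k}" "\<And>q c. q < k \<Longrightarrow> \<delta> q c < k" by (auto simp: wf_dfa_def)
  note inj = minimal_dfa_states(1)[OF min] and reachable = minimal_dfa_states(2)[OF min]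
  obtain z where "{q. is_sink (k, \<delta>, q0, F) q} = {z}" using sink by (rule card_1_singletonE)
  then have "is_sink (k, \<delta>, q0, F) z" by auto
  then have z: "z < k" "z \<notin> F" "\<And>c. \<delta> z c = z" by (auto simp: is_sink_def)
  have "foldl \<delta> z w = z" for w by (induction w) (auto simp: z)
  then have rz: "res \<delta> F z = {}" using z by (simp add: res_def)
  have ne: "res \<delta> F q \<noteq> {}" if "q < k" "q \<noteq> z" for q
    using inj_onD[OF inj, of q z] rz that z by auto
  have finres: "finite (res \<delta> F q)" if q: "q < k" for q
  proof -
    obtain w where w: "foldl \<delta> q0 w = q" using reachable[OF q] by blast
    have "(\<lambda>v. w @ v) ` res \<delta> F q \<subseteq> dfa_lang (k, \<delta>, q0, F)"
      using w by (auto simp: res_def dfa_lang_def)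
    then have "finite ((\<lambda>v. w @ v) ` res \<delta> F q)" using fin finite_subset by blast
    then show ?thesis by (rule finite_imageD) (simp add: inj_on_def)
  qed
  \<comment> \<open>One more than the length of the longest word accepted from \<open>q\<close>. The
    maximum exists because residuals of states other than the sink are finite and nonempty.\<close>
  define meas where "meas q = (if q = z then 0 else Suc (Max (length ` res \<delta> F q)))" for q
  have meas: "\<delta> q c \<in> {..<k} \<and> meas (\<delta> q c) < meas q" if q: "q \<in> {..<k}" "q \<noteq> z" for q c
  proof
    show d: "\<delta> q c \<in> {..<k}" using wf' q by simp
    show "meas (\<delta> q c) < meas q"
    proof (cases "\<delta> q c = z")
      case False
      have "Max (length ` res \<delta> F (\<delta> q c)) \<in> length ` res \<delta> F (\<delta> q c)"
        using finres ne d False by (intro Max_in) auto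
      then obtain v where v: "v \<in> res \<delta> F (\<delta> q c)" "Max (length ` res \<delta> F (\<delta> q c)) = length v" by auto
      then have "c # v \<in> res \<delta> F q" unfolding res_step by simp
      then have "length (c # v) \<le> Max (length ` res \<delta> F q)" using finres q by (intro Max_ge imageI finite_imageI) auto
      then show ?thesis using v False q by (simp add: meas_def)
    qed (use q in \<open>simp add: meas_def\<close>)
  qed
  \<comment> \<open>Counting the sink as already visited gives it the label 0, the role of the
    left-most leaf.\<close>
  obtain t ns where t: "well_labelled 1 t" "num_nodes t = length ns" "distinct ([z] @ ns)" "set ns \<subseteq> {..<k}"
    "([z] @ ns) ! root_label 1 t = q0"
    "\<And>i. i < length ns \<Longrightarrow> ([z] @ ns) ! fst (child_pairs 1 t ! i) = \<delta> (ns ! i) False \<and> ([z] @ ns) ! snd (child_pairs 1 t ! i) = \<delta> (ns ! i) True"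
    using dfs[of "{..<k}" z \<delta> meas q0 "[z]"] meas wf'(1) z(1) by fastforce
  define h where "h i = ([z] @ ns) ! i" for i
  have hz: "h 0 = z" by (simp add: h_def)
  have step: "h (dstep t q c) = \<delta> (h q) c" if "q < length ns + 1" for q c
  proof (cases "q = 0")
    case True
    then show ?thesis using z by (simp add: dstep_0 hz)
  next
    case False
    then have q: "q - 1 < length ns" "h q = ns ! (q - 1)" using that by (auto simp: h_def)
    then show ?thesis using t(6)[OF q(1)] False that t(2) by (cases c) (auto simp: dstep_def h_def)
  qed
  have h_lt: "dstep t q c < length ns + 1" if "q < length ns + 1" for q c
    using dstep_le[OF t(1), of q c] that by simp
  have root_lt: "root_label 1 t < length ns + 1" using root_label_less[OF t(1)] t(2) by simp
  have run: "\<exists>i < length ns + 1. h i = foldl \<delta> q0 w" for w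
  proof (induction w rule: rev_induct)
    case Nil
    then show ?case using t(5) root_lt by (auto simp: h_def)
  next
    case (snoc c w)
    then obtain i where i: "i < length ns + 1" "h i = foldl \<delta> q0 w" by blast
    then show ?case using step[OF i(1), of c] h_lt[OF i(1), of c] by (intro exI[of _ "dstep t i c"]) simp
  qed
  have img: "h ` {..<length ns + 1} = {..<k}"
  proof
    show "h ` {..<length ns + 1} \<subseteq> {..<k}"
    proof
      fix x assume "x \<in> h ` {..<length ns + 1}"
      then obtain i where "i < length ([z] @ ns)" "x = ([z] @ ns) ! i" by (auto simp: h_def)
      then have "x \<in> set ([z] @ ns)" using nth_mem by blast
      then show "x \<in> {..<k}" using t(4) z(1) by auto
    qed
    show "{..<k} \<subseteq> h ` {..<length ns + 1}"
    proof
      fix q assume "q \<in> {..<k}"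
      then obtain w where "foldl \<delta> q0 w = q" using reachable by blast
      then obtain i where "i < length ns + 1" "h i = q" using run[of w] by blast
      then show "q \<in> h ` {..<length ns + 1}" by blast
    qed
  qed
  have injh: "inj_on h {..<length ns + 1}"
    using t(3) by (auto simp: inj_on_def h_def nth_eq_iff_index_eq simp del: append_Cons)
  have "card (h ` {..<length ns + 1}) = length ns + 1" using injh by (simp add: card_image)
  then have len: "length ns = n" using img k by simp
  have bij: "bij_betw h {..<n + 1} {..<k}" using injh img len by (simp add: bij_betw_def)
  define F' where "F' = {i. i < n + 1 \<and> h i \<in> F}"
  have rt: "t \<in> pointer_trees n" using t len by (simp add: pointer_trees_def)
  have iso: "dfa_iso (dfa_of t F') D"
    unfolding dfa_iso_def dfa_of_def Deq
  proof (simp, intro exI[of _ h] conjI allI impI)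
    show "bij_betw h {..<Suc (num_nodes t)} {..<k}" using bij t(2) len by simp
    show "h (root_label (Suc 0) t) = q0" using t(5) by (simp add: h_def)
    fix q assume "q < Suc (num_nodes t)"
    then have q: "q < length ns + 1" using t(2) by simp
    show "h (dstep t q c) = \<delta> (h q) c" for c by (rule step[OF q])
    show "(q \<in> F') = (h q \<in> F)" using q len by (simp add: F'_def)
  qed
  have finals: "F' \<in> finals n"
  proof -
    have "0 \<notin> F'" using z by (simp add: F'_def hz)
    then have "F' \<subseteq> {1..n}" by (auto simp: F'_def) (metis Suc_leI gr0I)
    \<comment> \<open>All transitions of the first completed state lead to the sink, yet its
      residual is nonempty; so it accepts the empty word.\<close>
    moreover have "1 \<in> F'"
    proof -
      have h1: "h 1 < k" "h 1 \<noteq> z"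
        using bij_betwE[OF bij] n inj_onD[OF injh, of 1 0] len hz by auto
      then obtain v where v: "v \<in> res \<delta> F (h 1)" using ne by blast
      have "\<delta> (h 1) c = z" for c using step[of 1 c] n len dstep_1[OF t(1)] hz by simp
      then have "v = []" using v rz by (cases v) (auto simp: res_def)
      then show ?thesis using v n by (simp add: F'_def res_def)
    qed
    ultimately show ?thesis by (simp add: finals_def)
  qed
  have wfo: "wf_dfa (dfa_of t F')" using wf_dfa_of[OF rt finals] .
  have lang: "dfa_lang (dfa_of t F') = dfa_lang D" using dfa_iso_lang[OF wfo iso] .
  have "minimal_dfa (dfa_of t F')"
    using min wfo lang unfolding minimal_dfa_iff Deq by (simp add: dfa_states_def dfa_of_def t(2) len k)
  then have "dfa_of t F' \<in> min_fin_dfas n"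
    using finite_dfa_of[OF rt finals] sink_dfa_of[OF rt finals] t(2) len
    by (simp add: min_fin_dfas_def dfa_states_def dfa_of_def)
  then show ?thesis using rt finals iso by blast
qed

text \<open>A tree with repeated pairs of children may still give a minimal automaton for some sets
  of final states, when these separate the nodes concerned. Hence the upper bound has to admit all
  trees, while the lower bound takes only those that are minimal for every choice of final
  states.\<close>

lemma m2_bounds:
  assumes n: "n \<ge> 1"
  shows "m2 n \<le> 2 ^ (n - 1) * card (pointer_trees n)"
    and "2 ^ (n - 1) * card {t \<in> pointer_trees n. distinct (child_pairs 1 t)} \<le> m2 n"
proof -
  let ?cl = "\<lambda>(t, F). iso_rel n `` {dfa_of t F}"
  have m2: "m2 n = card (min_fin_dfas n // iso_rel n)" by (simp add: m2_def iso_rel_def)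
  have sub: "min_fin_dfas n // iso_rel n \<subseteq> ?cl ` (pointer_trees n \<times> finals n)"
  proof
    fix X assume "X \<in> min_fin_dfas n // iso_rel n"
    then obtain D where D: "D \<in> min_fin_dfas n" "X = iso_rel n `` {D}" by (auto elim: quotientE)
    then obtain t F where tF: "t \<in> pointer_trees n" "F \<in> finals n" "dfa_of t F \<in> min_fin_dfas n" "dfa_iso (dfa_of t F) D"
      using min_fin_iso_dfa_of[OF _ n] by blast
    then have "(dfa_of t F, D) \<in> iso_rel n" using D by (simp add: iso_rel_def)
    then have "X = iso_rel n `` {dfa_of t F}" using equiv_class_eq[OF equiv_iso_rel] D by blast
    then show "X \<in> ?cl ` (pointer_trees n \<times> finals n)" using tF by auto
  qed
  have fin: "finite (?cl ` (pointer_trees n \<times> finals n))" by (simp add: finite_pointer_trees finite_finals)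
  have "m2 n \<le> card (?cl ` (pointer_trees n \<times> finals n))" unfolding m2 by (rule card_mono[OF fin sub])
  also have "\<dots> \<le> card (pointer_trees n \<times> finals n)" by (rule card_image_le) (simp add: finite_pointer_trees finite_finals)
  finally show "m2 n \<le> 2 ^ (n - 1) * card (pointer_trees n)"
    by (simp add: card_cartesian_product card_finals[OF n] mult.commute)
  let ?S = "{t \<in> pointer_trees n. distinct (child_pairs 1 t)} \<times> finals n"
  have inj: "inj_on ?cl ?S"
  proof (rule inj_onI, clarify)
    fix t F t' F' assume a: "t \<in> pointer_trees n" "distinct (child_pairs 1 t)" "t' \<in> pointer_trees n" "distinct (child_pairs 1 t')" "F \<in> finals n" "F' \<in> finals n"
      "iso_rel n `` {dfa_of t F} = iso_rel n `` {dfa_of t' F'}"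
    have "(dfa_of t F, dfa_of t' F') \<in> iso_rel n"
      by (rule eq_equiv_class[OF a(7) equiv_iso_rel]) (use a n dfa_of_min_fin in auto)
    then show "t = t' \<and> F = F'" using a by (intro dfa_of_inj[of t n F t' F']) (auto simp: iso_rel_def)
  qed
  have "card ?S = card (?cl ` ?S)" using inj by (simp add: card_image)
  also have "\<dots> \<le> m2 n" unfolding m2
  proof (rule card_mono)
    show "finite (min_fin_dfas n // iso_rel n)" using fin sub finite_subset by blast
    show "?cl ` ?S \<subseteq> min_fin_dfas n // iso_rel n"
      using dfa_of_min_fin n by (auto intro!: quotientI)
  qed
  finally show "2 ^ (n - 1) * card {t \<in> pointer_trees n. distinct (child_pairs 1 t)} \<le> m2 n"
    by (simp add: card_cartesian_product card_finals[OF n] mult.commute)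
qed

section \<open>Relaxed trees as pointer trees\<close>

fun shape :: "rt \<Rightarrow> bt" where
  "shape (Ptr j) = L"
| "shape (Node l r) = N (shape l) (shape r)"

text \<open>\<open>conv \<rho> off T\<close> labels the leaf of \<open>T\<close> at postorder position \<open>off + i\<close> by \<open>\<rho> (off + i)\<close>.\<close>

fun conv :: "(nat \<Rightarrow> nat) \<Rightarrow> nat \<Rightarrow> bt \<Rightarrow> rt" where
  "conv \<rho> off L = Ptr (\<rho> off)"
| "conv \<rho> off (N l r) = Node (conv \<rho> off l) (conv \<rho> (off + length (po l)) r)"

lemma num_nodes_conv [simp]: "num_nodes (conv \<rho> off T) = bt_size T"
  by (induction \<rho> off T rule: conv.induct) auto

lemma length_po: "length (po T) = 2 * bt_size T + 1"
  by (induction T) auto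

lemma po_nonempty [simp]: "po T \<noteq> []" "0 < length (po T)"
  using length_po[of T] by auto

lemma count_po: "count_list (po T) True = bt_size T"
  by (induction T) auto

lemma po_0: "\<not> po T ! 0"
  by (induction T) (auto simp: nth_append)

lemma length_nodes [simp]: "length (nodes off T) = length (po T)"
  by (induction T arbitrary: off) auto

lemma nodes_None: "p < length (po T) \<Longrightarrow> nodes off T ! p = None \<longleftrightarrow> \<not> po T ! p"
proof (induction T arbitrary: off p)
  case (N l r)
  consider "p < length (po l)" | "length (po l) \<le> p" "p < length (po l) + length (po r)" | "p = length (po l) + length (po r)"
    using N.prems by fastforce
  then show ?case
    by cases (use N.IH in \<open>auto simp: nth_append\<close>)
qed auto

lemma nodes_less:
  "p < length (po T) \<Longrightarrow> nodes off T ! p = Some (i, j) \<Longrightarrow> i < off + p \<and> j < off + p"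
proof (induction T arbitrary: off p)
  case (N l r)
  consider "p < length (po l)" | "length (po l) \<le> p" "p < length (po l) + length (po r)" | "p = length (po l) + length (po r)"
    using N.prems(1) by fastforce
  then show ?case
  proof cases
    case 1
    then show ?thesis using N.IH(1)[of p off] N.prems by (auto simp: nth_append)
  next
    case 2
    then obtain p' where p': "p = length (po l) + p'" "p' < length (po r)" using le_Suc_ex by fastforce
    then show ?thesis using N.IH(2)[of p' "off + length (po l)"] N.prems(2) by (auto simp: nth_append)
  next
    case 3
    then have "i = off + length (po l) - 1" "j = off + length (po l) + length (po r) - 1"
      using N.prems(2) by (auto simp: nth_append)
    then show ?thesis using 3 by (simp add: length_po)
  qed
qed auto

text \<open>At a vertex this is its number in the labelling of pointer trees. At any other leaf it
  is one more than the number of internal nodes before it, a strict bound for the ranks of its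
  admissible targets.\<close>

definition vertex_rank :: "bool list \<Rightarrow> nat \<Rightarrow> nat" where
  "vertex_rank w p = (if p = 0 then 0 else 1 + count_list (take p w) True)"

lemma vertex_rank_strict_mono:
  assumes "p < q" "p = 0 \<or> w ! p" "p < length w" 
  shows "vertex_rank w p < vertex_rank w q"
proof (cases "p = 0")
  case False
  have "take (Suc p) w = take p w @ [w ! p]" using assms by (simp add: take_Suc_conv_app_nth)
  then have "count_list (take (Suc p) w) True = Suc (count_list (take p w) True)" using assms False by simp
  moreover have "take q w = take (Suc p) w @ drop (Suc p) (take q w)"
    using assms append_take_drop_id[of "Suc p" "take q w"] by (simp add: min_def)
  then have "count_list (take q w) True \<ge> count_list (take (Suc p) w) True"
    by (metis count_list_append le_add1)
  ultimately show ?thesis using assms False by (simp add: vertex_rank_def)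
qed (use assms in \<open>simp add: vertex_rank_def\<close>)

lemma vertex_rank_inj:
  assumes "p = 0 \<or> w ! p" "p < length w" "q = 0 \<or> w ! q" "q < length w" "vertex_rank w p = vertex_rank w q"
  shows "p = q"
  using vertex_rank_strict_mono[of p q w] vertex_rank_strict_mono[of q p w] assms
  by (cases p q rule: linorder_cases) auto

lemma vertex_rank_surj:
  assumes "j \<le> count_list (take m w) True" "m \<le> length w" "0 < m" "\<not> w ! 0"
  shows "\<exists>p < m. (p = 0 \<or> w ! p) \<and> vertex_rank w p = j"
  using assms
proof (induction m)
  case (Suc m)
  have t: "take (Suc m) w = take m w @ [w ! m]" using Suc.prems by (simp add: take_Suc_conv_app_nth)
  show ?case
  proof (cases "m = 0")
    case True
    then have "j = 0" using Suc.prems t by simp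
    then show ?thesis by (auto simp: vertex_rank_def)
  next
    case False
    show ?thesis
    proof (cases "j \<le> count_list (take m w) True")
      case True
      then have "\<exists>p < m. (p = 0 \<or> w ! p) \<and> vertex_rank w p = j" using Suc.IH Suc.prems False by simp
      then show ?thesis using less_SucI by blast
    next
      case no: False
      then have "w ! m" "j = count_list (take m w) True + 1" using Suc.prems(1) unfolding t by (auto split: if_splits)
      then show ?thesis using False by (intro exI[of _ m]) (simp add: vertex_rank_def)
    qed
  qed
qed simp

lemma tgt_less:
  assumes "valid_ptr T ptr" "c < length (po T)"
  shows "tgt T ptr c \<le> c" "tgt T ptr c = 0 \<or> po T ! tgt T ptr c"
proof -
  have "\<not> (c = 0 \<or> po T ! c) \<Longrightarrow> ptr c < c \<and> (ptr c = 0 \<or> po T ! ptr c)"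
    using assms unfolding valid_ptr_def by (metis neq0_conv)
  then show "tgt T ptr c \<le> c" "tgt T ptr c = 0 \<or> po T ! tgt T ptr c" by (auto simp: tgt_def)
qed

text \<open>\<open>pre\<close> and \<open>post\<close> are the parts of the postorder word around
  the subtree \<open>S\<close>; the internal nodes in \<open>pre\<close> determine the first number
  used in \<open>S\<close>. A pointer at a leaf goes to an earlier vertex, and ranks increase with
  position.\<close>

lemma well_labelled_conv:
  assumes "valid_ptr T ptr" "po T = pre @ po S @ post"
  shows "well_labelled (1 + count_list pre True) (conv (\<lambda>i. vertex_rank (po T) (ptr i)) (length pre) S)"
  using assms(2)
proof (induction S arbitrary: pre post)
  case L
  let ?off = "length pre"
  have w: "?off < length (po T)" "\<not> po T ! ?off" "take ?off (po T) = pre" using L by (auto simp: nth_append)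
  show ?case
  proof (cases "?off = 0")
    case True
    then have "ptr ?off = 0" using assms(1) unfolding valid_ptr_def by (metis less_irrefl)
    then show ?thesis by (simp add: vertex_rank_def)
  next
    case False
    then have p: "ptr ?off < ?off" "ptr ?off = 0 \<or> po T ! ptr ?off"
      using assms(1) w unfolding valid_ptr_def by (metis neq0_conv)+
    have "vertex_rank (po T) (ptr ?off) < vertex_rank (po T) ?off"
      using p w by (intro vertex_rank_strict_mono) auto
    also have "\<dots> = 1 + count_list pre True" using False w by (simp add: vertex_rank_def)
    finally show ?thesis by simp
  qed
next
  case (N l r)
  have 1: "po T = pre @ po l @ (po r @ [True] @ post)" and 2: "po T = (pre @ po l) @ po r @ ([True] @ post)"
    using N.prems by simp_all
  show ?case using N.IH(1)[OF 1] N.IH(2)[OF 2] by (simp add: count_po add.assoc)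
qed

section \<open>Pairs of children and the trees \<open>B(u)\<close>\<close>

definition somes :: "'a option list \<Rightarrow> 'a list" where
  "somes xs = map the (filter (\<lambda>x. x \<noteq> None) xs)"

lemma somes_simps [simp]: "somes [] = []" "somes (None # xs) = somes xs" "somes (Some a # xs) = a # somes xs"
  "somes (xs @ ys) = somes xs @ somes ys"
  by (simp_all add: somes_def)

lemma distinct_map_somes:
  "distinct (map f (somes xs)) \<longleftrightarrow>
     (\<forall>v<length xs. \<forall>u<v. \<forall>a b. xs ! u = Some a \<longrightarrow> xs ! v = Some b \<longrightarrow> f a \<noteq> f b)"
proof (induction xs rule: rev_induct)
  case (snoc x xs)
  have mem: "a \<in> set (somes xs) \<longleftrightarrow> (\<exists>u<length xs. xs ! u = Some a)" for a
    by (force simp: somes_def in_set_conv_nth image_iff)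
  show ?case
  proof (cases x)
    case None
    then show ?thesis using snoc by (auto simp: nth_append less_Suc_eq)
  next
    case (Some b)
    have "distinct (map f (somes (xs @ [x]))) \<longleftrightarrow> distinct (map f (somes xs)) \<and> (\<forall>a\<in>set (somes xs). f a \<noteq> f b)"
      using Some by (simp add: image_iff) metis
    also have "\<dots> \<longleftrightarrow> (\<forall>v<length xs. \<forall>u<v. \<forall>a b. xs ! u = Some a \<longrightarrow> xs ! v = Some b \<longrightarrow> f a \<noteq> f b)
        \<and> (\<forall>u<length xs. \<forall>a. xs ! u = Some a \<longrightarrow> f a \<noteq> f b)"
      unfolding snoc Ball_def mem by auto
    finally show ?thesis using Some by (auto simp: nth_append less_Suc_eq)
  qed
qed simp

lemma root_label_conv:
  assumes v: "valid_ptr T ptr" and S: "po T = pre @ po S @ post"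
  shows "root_label (1 + count_list pre True) (conv (\<lambda>i. vertex_rank (po T) (ptr i)) (length pre) S)
      = vertex_rank (po T) (tgt T ptr (length pre + length (po S) - 1))"
proof (cases S)
  case L
  then have w: "\<not> po T ! length pre" using S by (simp add: nth_append)
  show ?thesis
  proof (cases "length pre = 0")
    case True
    then have "ptr (length pre) = 0" using v unfolding valid_ptr_def by (metis less_irrefl)
    then show ?thesis using L True by (simp add: tgt_def)
  next
    case False
    then show ?thesis using L w by (simp add: tgt_def)
  qed
next
  case (N l r)
  let ?p = "length pre + length (po l) + length (po r)"
  have p: "po T ! ?p" "take ?p (po T) = pre @ po l @ po r" using S N by (auto simp: nth_append)
  have "vertex_rank (po T) (tgt T ptr ?p) = 1 + count_list (pre @ po l @ po r) True"
    using p by (simp add: tgt_def vertex_rank_def)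
  then show ?thesis using N by (simp add: count_po add.assoc)
qed

lemma child_pairs_conv:
  assumes v: "valid_ptr T ptr" and S: "po T = pre @ po S @ post"
  shows "child_pairs (1 + count_list pre True) (conv (\<lambda>i. vertex_rank (po T) (ptr i)) (length pre) S)
      = map (\<lambda>(i, j). (vertex_rank (po T) (tgt T ptr i), vertex_rank (po T) (tgt T ptr j))) (somes (nodes (length pre) S))"
  using S
proof (induction S arbitrary: pre post)
  case (N l r)
  have 1: "po T = pre @ po l @ (po r @ [True] @ post)" and 2: "po T = (pre @ po l) @ po r @ ([True] @ post)"
    using N.prems by simp_all
  have c: "1 + count_list (pre @ po l) True = 1 + count_list pre True + bt_size l" by (simp add: count_po)
  have l: "length (pre @ po l) = length pre + length (po l)" by simp
  show ?case
    using N.IH(1)[OF 1] N.IH(2)[OF 2] root_label_conv[OF v 1] root_label_conv[OF v 2]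
    unfolding c l by (simp add: add.assoc)
qed simp

lemma foldl_build:
  fixes e :: "'a list \<Rightarrow> nat \<Rightarrow> 'a"
  defines "B \<equiv> \<lambda>m. foldl (\<lambda>acc k. acc @ [e acc k]) [] [0..<m]"
  shows "length (B m) = m" "k < m \<Longrightarrow> B m ! k = e (B k) k" "j < k \<Longrightarrow> k \<le> m \<Longrightarrow> B k ! j = B m ! j"
proof -
  have step: "B (Suc m) = B m @ [e (B m) m]" for m by (simp add: B_def)
  show len: "length (B m) = m" for m by (induction m) (auto simp: step, simp add: B_def)
  show "B k ! j = B m ! j" if "j < k" "k \<le> m" for j k m
    using that(2)
  proof (induction m rule: dec_induct)
    case (step n)
    then show ?case using \<open>B (Suc n) = B n @ [e (B n) n]\<close>[unfolded step] len[of n] that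
      by (simp add: \<open>\<And>m. B (Suc m) = B m @ [e (B m) m]\<close> nth_append)
  qed simp
  show "B m ! k = e (B k) k" if "k < m"
    using that
  proof (induction m)
    case (Suc m)
    then show ?case using len[of m] by (cases "k = m") (auto simp: step nth_append)
  qed simp
qed

lemma bvals_nth:
  assumes v: "valid_ptr T ptr" and p: "p < length (po T)"
  shows "bvals T ptr ! p = (case nodes 0 T ! p of None \<Rightarrow> L
     | Some (i, j) \<Rightarrow> N (bvals T ptr ! tgt T ptr i) (bvals T ptr ! tgt T ptr j))"
proof -
  define e where "e acc k = (case nodes 0 T ! k of None \<Rightarrow> L
      | Some (i, j) \<Rightarrow> N (acc ! tgt T ptr i) (acc ! tgt T ptr j))" for acc k
  define B where "B m = foldl (\<lambda>acc k. acc @ [e acc k]) [] [0..<m]" for m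
  have bv: "bvals T ptr = B (length (po T))" by (simp add: bvals_def B_def e_def)
  have "bvals T ptr ! p = e (B p) p" unfolding bv B_def using foldl_build(2)[OF p, of e] .
  also have "\<dots> = e (bvals T ptr) p"
  proof (cases "nodes 0 T ! p")
    case (Some a)
    obtain i j where a: "a = (i, j)" by (cases a)
    have "i < p" "j < p" using nodes_less[OF p, of 0 i j] Some a by auto
    then have lt: "tgt T ptr i < p" "tgt T ptr j < p"
      using tgt_less(1)[OF v, of i] tgt_less(1)[OF v, of j] p by auto
    have "B p ! q = bvals T ptr ! q" if "q < p" for q
      unfolding bv B_def using foldl_build(3)[OF that, of "length (po T)" e] p by simp
    then show ?thesis using Some a lt by (simp add: e_def)
  qed (simp add: e_def)
  finally show ?thesis by (simp add: e_def)
qed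

text \<open>Compactedness compares whole unfoldings, the right side only one level of them. Along
  postorder, earlier vertices already have different unfoldings, so two nodes unfold equally only if
  their targets agree; ranks are injective on vertices.\<close>

lemma bvals_distinct_iff:
  assumes v: "valid_ptr T ptr"
  shows "(\<forall>u v. is_vertex T u \<and> is_vertex T v \<and> u \<noteq> v \<longrightarrow> bvals T ptr ! u \<noteq> bvals T ptr ! v)
     \<longleftrightarrow> distinct (child_pairs 1 (conv (\<lambda>i. vertex_rank (po T) (ptr i)) 0 T))"
proof -
  let ?f = "\<lambda>(i, j). (vertex_rank (po T) (tgt T ptr i), vertex_rank (po T) (tgt T ptr j))"
  let ?b = "bvals T ptr"
  have child_pairs: "child_pairs 1 (conv (\<lambda>i. vertex_rank (po T) (ptr i)) 0 T) = map ?f (somes (nodes 0 T))"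
    using child_pairs_conv[OF v, of "[]" T "[]"] by simp
  have kids: "tgt T ptr i < p \<and> is_vertex T (tgt T ptr i) \<and> tgt T ptr j < p \<and> is_vertex T (tgt T ptr j)"
    if "p < length (po T)" "nodes 0 T ! p = Some (i, j)" for p i j
  proof -
    have "i < p" "j < p" using nodes_less[OF that] by auto
    then show ?thesis using tgt_less[OF v, of i] tgt_less[OF v, of j] that(1) by (auto simp: is_vertex_def)
  qed
  show ?thesis
    unfolding child_pairs distinct_map_somes
  proof
    assume *: "\<forall>u v. is_vertex T u \<and> is_vertex T v \<and> u \<noteq> v \<longrightarrow> ?b ! u \<noteq> ?b ! v"
    show "\<forall>q<length (nodes 0 T). \<forall>u<q. \<forall>a b. nodes 0 T ! u = Some a \<longrightarrow> nodes 0 T ! q = Some b \<longrightarrow> ?f a \<noteq> ?f b"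
    proof (intro allI impI notI)
      fix q u a b assume q: "q < length (nodes 0 T)" and u: "u < q" and ua: "nodes 0 T ! u = Some a" and qb: "nodes 0 T ! q = Some b"
        and eq: "?f a = ?f b"
      obtain i j i' j' where ab: "a = (i, j)" "b = (i', j')" by (cases a, cases b)
      have lt: "q < length (po T)" "u < length (po T)" using q u by auto
      have k: "is_vertex T (tgt T ptr i)" "is_vertex T (tgt T ptr j)" "is_vertex T (tgt T ptr i')" "is_vertex T (tgt T ptr j')"
        using kids[OF lt(2), of i j] kids[OF lt(1), of i' j'] ua qb ab by auto
      have "tgt T ptr i = tgt T ptr i'" "tgt T ptr j = tgt T ptr j'"
        using eq ab k by (auto simp: is_vertex_def intro: vertex_rank_inj)
      then have "?b ! u = ?b ! q" using bvals_nth[OF v lt(1)] bvals_nth[OF v lt(2)] ua qb ab by simp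
      moreover have "is_vertex T u" "is_vertex T q"
        using nodes_None[OF lt(1), of 0] nodes_None[OF lt(2), of 0] ua qb lt by (auto simp: is_vertex_def)
      ultimately show False using * u by blast
    qed
  next
    assume *: "\<forall>q<length (nodes 0 T). \<forall>u<q. \<forall>a b. nodes 0 T ! u = Some a \<longrightarrow> nodes 0 T ! q = Some b \<longrightarrow> ?f a \<noteq> ?f b"
    have "?b ! u \<noteq> ?b ! q" if "is_vertex T u" "is_vertex T q" "u < q" for u q
      using that
    proof (induction q arbitrary: u rule: less_induct)
      case (less q)
      have lt: "q < length (po T)" "u < length (po T)" using less.prems by (auto simp: is_vertex_def)
      have "po T ! q" using less.prems by (auto simp: is_vertex_def)
      then obtain i' j' where q: "nodes 0 T ! q = Some (i', j')" using nodes_None[OF lt(1), of 0] by auto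
      have bq: "?b ! q = N (?b ! tgt T ptr i') (?b ! tgt T ptr j')" using bvals_nth[OF v lt(1)] q by simp
      show ?case
      proof (cases "u = 0")
        case True
        then have "nodes 0 T ! u = None" using nodes_None[OF lt(2), of 0] po_0 by simp
        then show ?thesis using bvals_nth[OF v lt(2)] bq by simp
      next
        case False
        then have "po T ! u" using less.prems by (auto simp: is_vertex_def)
        then obtain i j where u: "nodes 0 T ! u = Some (i, j)" using nodes_None[OF lt(2), of 0] by auto
        have bu: "?b ! u = N (?b ! tgt T ptr i) (?b ! tgt T ptr j)" using bvals_nth[OF v lt(2)] u by simp
        note ku = kids[OF lt(2) u] and kq = kids[OF lt(1) q]
        have same: "x = y" if "?b ! x = ?b ! y" "is_vertex T x" "is_vertex T y" "x < q" "y < q" for x y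
          using less.IH[of x y] less.IH[of y x] that by (cases x y rule: linorder_cases) auto
        have "?f (i, j) \<noteq> ?f (i', j')" using * lt less.prems(3) u q by (metis length_nodes)
        then show ?thesis unfolding bu bq using same[of "tgt T ptr i" "tgt T ptr i'"] same[of "tgt T ptr j" "tgt T ptr j'"] ku kq less.prems(3)
          by auto
      qed
    qed
    then show "\<forall>u v. is_vertex T u \<and> is_vertex T v \<and> u \<noteq> v \<longrightarrow> ?b ! u \<noteq> ?b ! v"
      by (metis linorder_neqE_nat)
  qed
qed

section \<open>The bijection between relaxed trees and pointer trees\<close>

definition enc :: "bt \<times> (nat \<Rightarrow> nat) \<Rightarrow> rt" where
  "enc = (\<lambda>(T, ptr). conv (\<lambda>i. vertex_rank (po T) (ptr i)) 0 T)"

lemma shape_conv: "shape (conv \<rho> off T) = T"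
  by (induction \<rho> off T rule: conv.induct) auto

lemma conv_eqD:
  "conv \<rho> off T = conv \<rho>' off T \<Longrightarrow> i < length (po T) \<Longrightarrow> \<not> po T ! i \<Longrightarrow> \<rho> (off + i) = \<rho>' (off + i)"
proof (induction T arbitrary: off i)
  case (N l r)
  consider "i < length (po l)" | "length (po l) \<le> i" "i < length (po l) + length (po r)" | "i = length (po l) + length (po r)"
    using N.prems(2) by fastforce
  then show ?case
  proof cases
    case 1
    then show ?thesis using N.IH(1)[of off i] N.prems by (simp add: nth_append)
  next
    case 2
    then obtain i' where i': "i = length (po l) + i'" "i' < length (po r)" using le_Suc_ex by fastforce
    then show ?thesis using N.IH(2)[of "off + length (po l)" i'] N.prems by (simp add: nth_append add.assoc)
  next
    case 3
    then show ?thesis using N.prems by (simp add: nth_append)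
  qed
qed simp

lemma inj_enc: "inj_on enc (relaxed_trees n)"
proof (rule inj_onI, clarify)
  fix T ptr T' ptr'
  assume a: "(T, ptr) \<in> relaxed_trees n" "(T', ptr') \<in> relaxed_trees n" "enc (T, ptr) = enc (T', ptr')"
  have "shape (enc (T, ptr)) = shape (enc (T', ptr'))" using a(3) by simp
  then have T: "T' = T" by (simp add: enc_def shape_conv)
  have v: "valid_ptr T ptr" "valid_ptr T ptr'" using a T by (auto simp: relaxed_trees_def)
  have "ptr i = ptr' i" for i
  proof (cases "i < length (po T) \<and> 0 < i \<and> \<not> po T ! i")
    case True
    then have p: "ptr i < i" "ptr i = 0 \<or> po T ! ptr i" "ptr' i < i" "ptr' i = 0 \<or> po T ! ptr' i"
      using v unfolding valid_ptr_def by metis+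
    have "vertex_rank (po T) (ptr i) = vertex_rank (po T) (ptr' i)"
      using conv_eqD[of "\<lambda>i. vertex_rank (po T) (ptr i)" 0 T "\<lambda>i. vertex_rank (po T) (ptr' i)" i] a(3) True T by (simp add: enc_def)
    then show ?thesis using p(1,3) True by (intro vertex_rank_inj[OF p(2) _ p(4)]) simp_all
  next
    case False
    then have "ptr i = 0" "ptr' i = 0"
      using v[unfolded valid_ptr_def, THEN spec, of i] by (simp_all only: if_False)
    then show ?thesis by simp
  qed
  then have "ptr = ptr'" by (rule ext)
  with T show "T = T' \<and> ptr = ptr'" by simp
qed

text \<open>The zeros at internal nodes are placeholders that keep the list aligned with the
  postorder word of the shape.\<close>

fun labels :: "rt \<Rightarrow> nat list" where
  "labels (Ptr j) = [j]"
| "labels (Node l r) = labels l @ labels r @ [0]"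

lemma length_labels [simp]: "length (labels t) = length (po (shape t))"
  by (induction t) auto

lemma bt_size_shape [simp]: "bt_size (shape t) = num_nodes t"
  by (induction t) auto

lemma labels_le:
  "well_labelled (1 + k) t \<Longrightarrow> i < length (po (shape t)) \<Longrightarrow> \<not> po (shape t) ! i \<Longrightarrow>
    labels t ! i \<le> k + count_list (take i (po (shape t))) True"
proof (induction t arbitrary: k i)
  case (Node l r)
  let ?l = "po (shape l)" and ?r = "po (shape r)"
  consider "i < length ?l" | "length ?l \<le> i" "i < length ?l + length ?r" | "i = length ?l + length ?r"
    using Node.prems(2) by fastforce
  then show ?case
  proof cases
    case 1
    then show ?thesis using Node.IH(1)[of k i] Node.prems by (simp add: nth_append)
  next
    case 2
    then obtain i' where i': "i = length ?l + i'" "i' < length ?r" using le_Suc_ex by fastforce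
    have v: "well_labelled (1 + (k + num_nodes l)) r" using Node.prems by (simp add: add.assoc)
    show ?thesis using Node.IH(2)[OF v i'(2)] Node.prems i' by (simp add: nth_append count_po)
  next
    case 3
    then show ?thesis using Node.prems by (simp add: nth_append)
  qed
qed simp

lemma conv_labels:
  "(\<And>i. i < length (po (shape t)) \<Longrightarrow> \<not> po (shape t) ! i \<Longrightarrow> \<rho> (off + i) = labels t ! i) \<Longrightarrow> conv \<rho> off (shape t) = t"
proof (induction t arbitrary: off)
  case (Ptr j)
  then show ?case using Ptr[of 0] by simp
next
  case (Node l r)
  let ?l = "po (shape l)" and ?r = "po (shape r)"
  have "conv \<rho> off (shape l) = l"
  proof (rule Node.IH(1))
    fix i assume "i < length ?l" "\<not> ?l ! i"
    then show "\<rho> (off + i) = labels l ! i" using Node.prems[of i] by (simp add: nth_append)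
  qed
  moreover have "conv \<rho> (off + length ?l) (shape r) = r"
  proof (rule Node.IH(2))
    fix i assume "i < length ?r" "\<not> ?r ! i"
    then show "\<rho> (off + length ?l + i) = labels r ! i"
      using Node.prems[of "length ?l + i"] by (simp add: nth_append add.assoc)
  qed
  ultimately show ?case by simp
qed

lemma enc_image: "enc ` relaxed_trees n = pointer_trees n"
proof (intro equalityI subsetI)
  fix t assume "t \<in> enc ` relaxed_trees n"
  then obtain T ptr where "t = conv (\<lambda>i. vertex_rank (po T) (ptr i)) 0 T" "bt_size T = n" "valid_ptr T ptr"
    by (auto simp: enc_def relaxed_trees_def)
  then show "t \<in> pointer_trees n" using well_labelled_conv[of T ptr "[]" T "[]"] by (simp add: pointer_trees_def)
next
  fix t assume t: "t \<in> pointer_trees n"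
  then have v: "well_labelled (1 + 0) t" and num_nodes: "num_nodes t = n" by (auto simp: pointer_trees_def)
  define T where "T = shape t"
  let ?P = "\<lambda>i p. p < i \<and> (p = 0 \<or> po T ! p) \<and> vertex_rank (po T) p = labels t ! i"
  define ptr where "ptr i = (if i < length (po T) \<and> 0 < i \<and> \<not> po T ! i then (SOME p. ?P i p) else 0)" for i
  have P: "?P i (ptr i)" if "i < length (po T)" "0 < i" "\<not> po T ! i" for i
  proof -
    have "\<exists>p<i. (p = 0 \<or> po T ! p) \<and> vertex_rank (po T) p = labels t ! i"
      by (rule vertex_rank_surj) (use labels_le[OF v, of i] that po_0[of T] in \<open>auto simp: T_def\<close>)
    then have "?P i (SOME p. ?P i p)" by (rule someI_ex)
    then show ?thesis using that by (simp add: ptr_def)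
  qed
  have valid: "valid_ptr T ptr"
    unfolding valid_ptr_def
  proof (intro allI)
    fix i
    show "if i < length (po T) \<and> 0 < i \<and> \<not> po T ! i then ptr i < i \<and> (ptr i = 0 \<or> po T ! ptr i) else ptr i = 0"
      using P[of i] by (auto simp: ptr_def)
  qed
  have "conv (\<lambda>i. vertex_rank (po T) (ptr i)) 0 (shape t) = t"
  proof (rule conv_labels)
    fix i assume i: "i < length (po (shape t))" "\<not> po (shape t) ! i"
    show "vertex_rank (po T) (ptr (0 + i)) = labels t ! i"
    proof (cases "i = 0")
      case True
      \<comment> \<open>The left-most leaf is visited before any internal node, so its label is
        0.\<close>
      then show ?thesis using labels_le[OF v, of i] i by (simp add: ptr_def vertex_rank_def)
    next
      case False
      then show ?thesis using P[of i] i by (simp add: T_def)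
    qed
  qed
  then have "enc (T, ptr) = t" by (simp add: enc_def T_def)
  moreover have "(T, ptr) \<in> relaxed_trees n" using valid num_nodes by (simp add: relaxed_trees_def T_def)
  ultimately show "t \<in> enc ` relaxed_trees n" by force
qed

lemma r_num_eq: "r_num n = card (pointer_trees n)"
  unfolding r_num_def enc_image[symmetric] by (simp add: card_image inj_enc)

lemma c_num_eq: "c_num n = card {t \<in> pointer_trees n. distinct (child_pairs 1 t)}"
proof -
  have iff: "x \<in> compacted_trees n \<longleftrightarrow> x \<in> relaxed_trees n \<and> distinct (child_pairs 1 (enc x))" for x
  proof -
    obtain T ptr where x: "x = (T, ptr)" by (cases x)
    have "valid_ptr T ptr" if "x \<in> relaxed_trees n" using that x by (simp add: relaxed_trees_def)
    then show ?thesis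
      unfolding compacted_trees_def enc_def x using bvals_distinct_iff[of T ptr] by auto
  qed
  have "{t \<in> pointer_trees n. distinct (child_pairs 1 t)} = enc ` compacted_trees n"
    unfolding enc_image[symmetric] using iff by blast
  moreover have "inj_on enc (compacted_trees n)"
    by (rule inj_on_subset[OF inj_enc]) (use iff in blast)
  ultimately show ?thesis by (simp add: c_num_def card_image)
qed

text \<open>Enlarging the constant absorbs the finitely many \<open>n < n0\<close>, because
  \<open>g\<close> is positive there. This extends the asymptotic bounds to all
  \<open>n >= 1\<close>.\<close>

lemma le_scale_all:
  fixes f g :: "nat \<Rightarrow> real"
  assumes g: "\<And>n. n \<ge> 1 \<Longrightarrow> g n > 0" and C: "C > 0" "\<And>n. n \<ge> n0 \<Longrightarrow> f n \<le> C * g n"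
  shows "\<exists>D>0. \<forall>n\<ge>1. f n \<le> D * g n"
proof -
  define D where "D = C + (\<Sum>k\<in>{1..<n0}. \<bar>f k\<bar> / g k)"
  have nonneg: "\<bar>f k\<bar> / g k \<ge> 0" if "k \<in> {1..<n0}" for k using g[of k] that by simp
  have CD: "C \<le> D" unfolding D_def using sum_nonneg[of "{1..<n0}" "\<lambda>k. \<bar>f k\<bar> / g k"] nonneg by simp
  have "f n \<le> D * g n" if n: "n \<ge> 1" for n
  proof (cases "n \<ge> n0")
    case True
    have "C * g n \<le> D * g n" using g[OF n] CD by (intro mult_right_mono) auto
    then show ?thesis using C(2)[OF True] by linarith
  next
    case False
    have "\<bar>f n\<bar> / g n \<le> (\<Sum>k\<in>{1..<n0}. \<bar>f k\<bar> / g k)"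
      by (rule member_le_sum) (use n False nonneg in auto)
    then have "\<bar>f n\<bar> / g n \<le> D" using C(1) by (simp add: D_def)
    then show ?thesis using g[OF n] by (simp add: divide_le_eq)
  qed
  then show ?thesis using C(1) CD by (intro exI[of _ D]) auto
qed

theorem theorem6p2:
  shows "(\<forall>n\<ge>1. 2 ^ (n - 1) * c_num n \<le> m2 n \<and> m2 n \<le> 2 ^ (n - 1) * r_num n)
       \<and> (\<exists>\<kappa>1 \<kappa>2 :: real. \<kappa>1 > 0 \<and> \<kappa>2 > 0 \<and>
            (\<forall>n::nat\<ge>1.
               \<kappa>1 * real n powr (3/4)
                 \<le> real (m2 n) / (fact n * 8 ^ n * exp (3 * airy_a1 * real n powr (1/3)))
             \<and> real (m2 n) / (fact n * 8 ^ n * exp (3 * airy_a1 * real n powr (1/3)))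
                 \<le> \<kappa>2 * real n))"
proof (intro conjI)
  show "\<forall>n\<ge>1. 2 ^ (n - 1) * c_num n \<le> m2 n \<and> m2 n \<le> 2 ^ (n - 1) * r_num n"
    using m2_bounds unfolding r_num_eq c_num_eq by blast
  define G :: "nat \<Rightarrow> real" where "G n = fact n * 4 ^ n * exp (3 * airy_a1 * real n powr (1/3))" for n
  have G: "G n > 0" for n by (simp add: G_def)
  have G8: "fact n * 8 ^ n * exp (3 * airy_a1 * real n powr (1/3)) = 2 ^ n * G n" for n
    unfolding G_def by (simp flip: power_mult_distrib)
  have two: "(2::real) ^ n = 2 * 2 ^ (n - 1)" if "n \<ge> 1" for n using that by (cases n) auto
  have upper: "real (m2 n) \<le> 2 ^ (n - 1) * real (w_num n 1)"
    and lower: "2 ^ (n - 1) * real (e_num n 1) \<le> real (m2 n)" if "n \<ge> 1" for n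
    using m2_bounds[OF that, folded of_nat_le_iff[where 'a = real]] unfolding card_pointer_trees card_distinct_pointer_trees by simp_all
  obtain C n1 where "C > 0" "\<And>n. n \<ge> n1 \<Longrightarrow> real (w_num n 1) \<le> C * (G n * real n)"
    using w_num_upper_Ai unfolding G_def by blast
  then obtain \<kappa>2 where \<kappa>2: "\<kappa>2 > 0" "\<And>n. n \<ge> 1 \<Longrightarrow> real (w_num n 1) \<le> \<kappa>2 * (G n * real n)"
    using le_scale_all[of "\<lambda>n. G n * real n" C n1 "\<lambda>n. real (w_num n 1)"] G by auto
  obtain c n2 where c: "c > 0" "\<And>n. n \<ge> n2 \<Longrightarrow> c * (G n * real n powr (3/4)) \<le> real (e_num n 1)"
    using e_num_lower_Ai unfolding G_def by blast
  \<comment> \<open>Read as an upper bound for \<open>G n * real n powr (3/4)\<close>, the estimate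
    can be extended to all \<open>n >= 1\<close> by the same lemma, as \<open>e_num n 1\<close> is
    positive.\<close>
  have "G n * real n powr (3/4) \<le> 1 / c * real (e_num n 1)" if "n \<ge> n2" for n
    using c(2)[OF that] c(1) by (simp add: field_simps)
  then obtain D where D: "D > 0" "\<And>n. n \<ge> 1 \<Longrightarrow> G n * real n powr (3/4) \<le> D * real (e_num n 1)"
    using le_scale_all[of "\<lambda>n. real (e_num n 1)" "1 / c" n2 "\<lambda>n. G n * real n powr (3/4)"] c(1) e_num_pos[of _ 0]
    by auto
  show "\<exists>\<kappa>1 \<kappa>2 :: real. \<kappa>1 > 0 \<and> \<kappa>2 > 0 \<and>
            (\<forall>n::nat\<ge>1.
               \<kappa>1 * real n powr (3/4)
                 \<le> real (m2 n) / (fact n * 8 ^ n * exp (3 * airy_a1 * real n powr (1/3)))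
             \<and> real (m2 n) / (fact n * 8 ^ n * exp (3 * airy_a1 * real n powr (1/3)))
                 \<le> \<kappa>2 * real n)"
  proof (rule exI[of _ "1 / (2 * D)"], rule exI[of _ "\<kappa>2 / 2"], intro conjI allI impI)
    fix n :: nat assume n: "n \<ge> 1"
    have "2 ^ (n - 1) * (G n * real n powr (3/4)) \<le> 2 ^ (n - 1) * (D * real (e_num n 1))"
      using D(2)[OF n] by (intro mult_left_mono) auto
    also have "\<dots> \<le> D * real (m2 n)"
      using lower[OF n] D(1) by (simp add: mult.left_commute)
    finally show "1 / (2 * D) * real n powr (3/4) \<le> real (m2 n) / (fact n * 8 ^ n * exp (3 * airy_a1 * real n powr (1/3)))"
      unfolding G8 two[OF n] using G[of n] D(1) by (simp add: field_simps)
    have "2 ^ (n - 1) * real (w_num n 1) \<le> 2 ^ (n - 1) * (\<kappa>2 * (G n * real n))"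
      using \<kappa>2(2)[OF n] by (rule mult_left_mono) simp
    with upper[OF n] have "real (m2 n) \<le> 2 ^ (n - 1) * (\<kappa>2 * (G n * real n))" by linarith
    then show "real (m2 n) / (fact n * 8 ^ n * exp (3 * airy_a1 * real n powr (1/3))) \<le> \<kappa>2 / 2 * real n"
      unfolding G8 two[OF n] using G[of n] by (simp add: field_simps)
  qed (use D \<kappa>2 in auto)
qed

end
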